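(* Let $\kappa<0$, $\tau\in\mathbb{R}$, $c=\sqrt{-\kappa}/2$, and let $\mathbb{E}=\mathbb{E}^3(\kappa,\tau)$, with unit tangent bundle $\mathrm{U}\mathbb{E}$. There exists a unique map $\Pi:\mathrm{U}\mathbb{E}\to\mathcal{S}$, $(x,Z)\mapsto\Pi_x(Z)$, such that (a) for any $f\in\mathrm{Isom}_0(\mathbb{E})$, if $M\in\mathrm{SU}_{1,1}$ is such that the horizontal part of $f$ is $\varphi_M$, then $\Pi\circ \mathrm{d}f=\psi_M\circ\Pi$; (b) for any $(x,Z)\in\mathrm{U}\mathbb{E}$, $\Pi_x(Z)\in\mathcal{E}$ (respectively $\Pi_x(Z)\in\mathcal{S}^+$, $\Pi_x(Z)\in\mathcal{S}^-$) if and only if $Z$ is horizontal (respectively upwards pointing, downwards pointing); (c) for any point $x\in\mathbb{E}$ and any horizontal vector $Z\in\mathrm{U}_x\mathbb{E}$, $\Pi_x(Z)=\sigma(p)$, where $p\in\partial_\infty\mathbb{H}^2(\kappa)$ denotes the endpoint of the oriented geodesic of $\mathbb{H}^2(\kappa)$ passing through $\pi(x)$ with $\mathrm{d}\pi(Z)$ as tangent vector; (d) for any point $x\in\mathbb{E}$, the map $\Pi_x:\mathrm{U}_x\mathbb{E}\to\mathcal{S}$ is a conformal diffeomorphism. Moreover, the map $\Pi$ is (real) analytic, and its expression in the frame $(V_1,V_2,V_3)$ is $$\Pi_x(Z)=\frac{Z_1+iZ_2+c\zeta(1+Z_3)}{c\bar\zeta(Z_1+iZ_2)+1+Z_3},$$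 where $x=(x_1,x_2,x_3)$, $\zeta=x_1+ix_2$ and $Z=Z_1V_1+Z_2V_2+Z_3V_3$.
   Context: Here $\kappa<0$, $\tau\in\mathbb{R}$, $c=\sqrt{-\kappa}/2>0$. Hyperbolic plane: $\mathbb{H}^2(\kappa)$ is the disk $\{\zeta=x_1+ix_2\in\mathbb{C}: |\zeta|<1/c\}$ with metric $\Lambda^2(\mathrm{d}x_1^2+\mathrm{d}x_2^2)$, $\Lambda=\frac{1}{1-c^2|\zeta|^2}$ (constant curvature $\kappa$); its asymptotic boundary $\partial_\infty\mathbb{H}^2(\kappa)$ is the circle $|\zeta|=1/c$. The homogeneous manifold $\mathbb{E}^3(\kappa,\tau)$ is $\{|x_1+ix_2|<1/c\}\times\mathbb{R}$ with metric $\Lambda^2(\mathrm{d}x_1^2+\mathrm{d}x_2^2)+(\tau\Lambda(x_2\mathrm{d}x_1-x_1\mathrm{d}x_2)+\mathrm{d}x_3)^2$. The map $\pi(x_1,x_2,x_3)=(x_1,x_2)$ is a Riemannian submersion onto $\mathbb{H}^2(\kappa)$. An orthonormal frame is $$V_1=\tfrac1\Lambda\tfrac{\partial}{\partial x_1}-\tau x_2\tfrac{\partial}{\partial x_3},\quad V_2=\tfrac1\Lambda\tfrac{\partial}{\partial x_2}+\tau x_1\tfrac{\partial}{\partial x_3},\quad V_3=\tfrac{\partial}{\partial x_3}=:\xi.$$ A tangent vector $v$ is horizontal if $\langle v,\xi\rangle=0$, upwards pointing if $\langle v,\xi\rangle>0$, downwards pointing if $\langle v,\xi\rangle<0$. $\mathrm{Isom}_0(\mathbb{E})$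 is the identity component of the isometry group of $\mathbb{E}$. Every $f\in\mathrm{Isom}_0(\mathbb{E})$ preserves $\xi$ and induces an orientation-preserving isometry $\tilde f$ of $\mathbb{H}^2(\kappa)$ with $\tilde f\circ\pi=\pi\circ f$, called the horizontal part of $f$. $\mathrm{SU}_{1,1}$ is the group of matrices $M=\begin{pmatrix}\alpha&\beta\\ \bar\beta&\bar\alpha\end{pmatrix}$ with $\alpha,\beta\in\mathbb{C}$, $|\alpha|^2-|\beta|^2=1$. $\mathcal{S}$ is the Riemann sphere $\mathbb{C}\cup\{\infty\}$ with equator $\mathcal{E}=\{|z|=1\}$, northern hemisphere $\mathcal{S}^+=\{|z|<1\}$ and southern hemisphere $\mathcal{S}^-=\{|z|>1\}\cup\{\infty\}$. For $M=\begin{pmatrix}\alpha&\beta\\ \bar\beta&\bar\alpha\end{pmatrix}\in\mathrm{SU}_{1,1}$, $\psi_M:\mathcal{S}\to\mathcal{S}$ and $\varphi_M:\mathbb{H}^2(\kappa)\to\mathbb{H}^2(\kappa)$ are $$\psi_M(z)=\frac{\alpha z+\beta}{\bar\beta z+\bar\alpha},\qquad \varphi_M(\zeta)=\frac1c\,\frac{\alpha c\zeta+\beta}{\bar\beta c\zeta+\bar\alpha}.$$ Every orientation-preserving isometry of $\mathbb{H}^2(\kappa)$ is some $\varphi_M$, with $M$ unique up to sign. The map $\sigma:\mathbb{H}^2(\kappa)\cup\partial_\infty\mathbb{H}^2(\kappa)\to\mathcal{S}^+\cup\mathcal{E}$ is $\sigma(\zeta)=c\zeta$; it is the unique conformal diffeomorphism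 satisfying $\sigma\circ\varphi_M=\psi_M\circ\sigma$ for all $M$. *)

theory Defs
  imports "HOL-Analysis.Analysis"
begin

section \<open>Smooth and real analytic functions on open subsets of Euclidean spaces\<close>

primrec Ck_on ::
  "nat \<Rightarrow> 'a::euclidean_space set \<Rightarrow> ('a \<Rightarrow> 'b::real_normed_vector) \<Rightarrow> bool" where
  "Ck_on 0 S f \<longleftrightarrow> continuous_on S f"
| "Ck_on (Suc k) S f \<longleftrightarrow> (\<forall>x\<in>S. f differentiable (at x)) \<and>
     (\<forall>v. Ck_on k S (\<lambda>x. frechet_derivative f (at x) v))"

definition smooth_on ::
  "'a::euclidean_space set \<Rightarrow> ('a \<Rightarrow> 'b::real_normed_vector) \<Rightarrow> bool" where
  "smooth_on S f \<longleftrightarrow> (\<forall>k. Ck_on k S f)"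

text \<open>A function is real analytic at \<open>x\<close> if it is the sum of a (multi-index) power series
  in the Euclidean coordinates of \<open>y - x\<close>, for all \<open>y\<close> near \<open>x\<close>.\<close>

definition real_analytic_at ::
  "('a::euclidean_space \<Rightarrow> 'b::real_normed_vector) \<Rightarrow> 'a \<Rightarrow> bool" where
  "real_analytic_at f x \<longleftrightarrow> (\<exists>a :: ('a \<Rightarrow> nat) \<Rightarrow> 'b. \<exists>r>0. \<forall>y\<in>ball x r.
     ((\<lambda>\<alpha>. (\<Prod>b\<in>Basis. ((y - x) \<bullet> b) ^ \<alpha> b) *\<^sub>R a \<alpha>) has_sum f y) (Basis \<rightarrow>\<^sub>E UNIV))"

definition real_analytic_on ::
  "'a::euclidean_space set \<Rightarrow> ('a \<Rightarrow> 'b::real_normed_vector) \<Rightarrow> bool" where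
  "real_analytic_on S f \<longleftrightarrow> (\<forall>x\<in>S. real_analytic_at f x)"

abbreviation differential ::
  "('a::real_normed_vector \<Rightarrow> 'b::real_normed_vector) \<Rightarrow> 'a \<Rightarrow> 'a \<Rightarrow> 'b" where
  "differential f x \<equiv> frechet_derivative f (at x)"


section \<open>The hyperbolic plane and its geodesics\<close>

definition cpar :: "real \<Rightarrow> real" where
  "cpar \<kappa> = sqrt (- \<kappa>) / 2"

definition Lam :: "real \<Rightarrow> complex \<Rightarrow> real" where
  "Lam \<kappa> \<zeta> = 1 / (1 - (cpar \<kappa>)\<^sup>2 * (cmod \<zeta>)\<^sup>2)"

definition H2 :: "real \<Rightarrow> complex set" where
  "H2 \<kappa> = {\<zeta>. cmod \<zeta> < 1 / cpar \<kappa>}"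

definition H2_boundary :: "real \<Rightarrow> complex set" where
  "H2_boundary \<kappa> = {\<zeta>. cmod \<zeta> = 1 / cpar \<kappa>}"

definition H2_metric :: "real \<Rightarrow> complex \<Rightarrow> complex \<Rightarrow> complex \<Rightarrow> real" where
  "H2_metric \<kappa> \<zeta> v w = (Lam \<kappa> \<zeta>)\<^sup>2 * (Re v * Re w + Im v * Im w)"

text \<open>Christoffel symbols of the first kind of a Riemannian metric \<open>g\<close> on an open set of a
  Euclidean space, as a trilinear form: \<open>christoffel g p (e i) (e j) (e k)\<close> is
  \<open>(\<partial>\<^sub>i g\<^sub>j\<^sub>k + \<partial>\<^sub>j g\<^sub>i\<^sub>k - \<partial>\<^sub>k g\<^sub>i\<^sub>j) / 2\<close>. The geodesic equation below is the usual one
  with its index lowered by the metric.\<close>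

definition christoffel ::
  "('a::euclidean_space \<Rightarrow> 'a \<Rightarrow> 'a \<Rightarrow> real) \<Rightarrow> 'a \<Rightarrow> 'a \<Rightarrow> 'a \<Rightarrow> 'a \<Rightarrow> real" where
  "christoffel g p u v w =
     (differential (\<lambda>q. g q v w) p u + differential (\<lambda>q. g q u w) p v
      - differential (\<lambda>q. g q u v) p w) / 2"

text \<open>\<open>is_geodesic g S \<gamma> \<gamma>'\<close>: the curve \<open>\<gamma>\<close> with velocity \<open>\<gamma>'\<close> is a geodesic of \<open>(S, g)\<close>
  defined for all times.\<close>

definition is_geodesic ::
  "('a::euclidean_space \<Rightarrow> 'a \<Rightarrow> 'a \<Rightarrow> real) \<Rightarrow> 'a set \<Rightarrow> (real \<Rightarrow> 'a) \<Rightarrow> (real \<Rightarrow> 'a) \<Rightarrow> bool" where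
  "is_geodesic g S \<gamma> \<gamma>' \<longleftrightarrow>
     (\<forall>t. \<gamma> t \<in> S \<and> (\<gamma> has_vector_derivative \<gamma>' t) (at t)) \<and>
     (\<exists>\<gamma>''. \<forall>t. (\<gamma>' has_vector_derivative \<gamma>'' t) (at t) \<and>
        (\<forall>w. g (\<gamma> t) (\<gamma>'' t) w + christoffel g (\<gamma> t) (\<gamma>' t) (\<gamma>' t) w = 0))"

text \<open>The endpoint in the asymptotic boundary of the geodesic starting at \<open>\<zeta>\<close> with velocity \<open>v\<close>.\<close>

definition geodesic_endpoint :: "real \<Rightarrow> complex \<Rightarrow> complex \<Rightarrow> complex" where
  "geodesic_endpoint \<kappa> \<zeta> v = (THE p. p \<in> H2_boundary \<kappa> \<and>
     (\<exists>\<gamma> \<gamma>'. is_geodesic (H2_metric \<kappa>) (H2 \<kappa>) \<gamma> \<gamma>' \<and> \<gamma> 0 = \<zeta> \<and> \<gamma>' 0 = v \<and>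
        (\<gamma> \<longlongrightarrow> p) at_top))"


section \<open>The homogeneous manifold and its isometries\<close>

text \<open>The point \<open>(x\<^sub>1, x\<^sub>2, x\<^sub>3)\<close> is \<open>(x\<^sub>1 + \<i> x\<^sub>2, x\<^sub>3) :: complex \<times> real\<close>. Tangent vectors are
  given by their components in the coordinate basis, with the same encoding.\<close>

type_synonym pt = "complex \<times> real"

definition E3 :: "real \<Rightarrow> pt set" where
  "E3 \<kappa> = H2 \<kappa> \<times> UNIV"

definition E3_form :: "real \<Rightarrow> real \<Rightarrow> pt \<Rightarrow> pt \<Rightarrow> real" where
  "E3_form \<kappa> \<tau> x v =
     \<tau> * Lam \<kappa> (fst x) * (Im (fst x) * Re (fst v) - Re (fst x) * Im (fst v)) + snd v"

definition E3_metric :: "real \<Rightarrow> real \<Rightarrow> pt \<Rightarrow> pt \<Rightarrow> pt \<Rightarrow> real" where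
  "E3_metric \<kappa> \<tau> x v w =
     (Lam \<kappa> (fst x))\<^sup>2 * (Re (fst v) * Re (fst w) + Im (fst v) * Im (fst w))
     + E3_form \<kappa> \<tau> x v * E3_form \<kappa> \<tau> x w"

definition V1 :: "real \<Rightarrow> real \<Rightarrow> pt \<Rightarrow> pt" where
  "V1 \<kappa> \<tau> x = (complex_of_real (1 / Lam \<kappa> (fst x)), - \<tau> * Im (fst x))"

definition V2 :: "real \<Rightarrow> real \<Rightarrow> pt \<Rightarrow> pt" where
  "V2 \<kappa> \<tau> x = (\<i> * complex_of_real (1 / Lam \<kappa> (fst x)), \<tau> * Re (fst x))"

definition xi :: pt where
  "xi = (0, 1)"

definition hproj :: "pt \<Rightarrow> complex" where
  "hproj x = fst x"

definition horizontal :: "real \<Rightarrow> real \<Rightarrow> pt \<Rightarrow> pt \<Rightarrow> bool" where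
  "horizontal \<kappa> \<tau> x Z \<longleftrightarrow> E3_metric \<kappa> \<tau> x Z xi = 0"

definition upwards :: "real \<Rightarrow> real \<Rightarrow> pt \<Rightarrow> pt \<Rightarrow> bool" where
  "upwards \<kappa> \<tau> x Z \<longleftrightarrow> E3_metric \<kappa> \<tau> x Z xi > 0"

definition downwards :: "real \<Rightarrow> real \<Rightarrow> pt \<Rightarrow> pt \<Rightarrow> bool" where
  "downwards \<kappa> \<tau> x Z \<longleftrightarrow> E3_metric \<kappa> \<tau> x Z xi < 0"

definition UE :: "real \<Rightarrow> real \<Rightarrow> (pt \<times> pt) set" where
  "UE \<kappa> \<tau> = {(x, Z). x \<in> E3 \<kappa> \<and> E3_metric \<kappa> \<tau> x Z Z = 1}"

definition isometries :: "real \<Rightarrow> real \<Rightarrow> (pt \<Rightarrow> pt) set" where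
  "isometries \<kappa> \<tau> = {f \<in> E3 \<kappa> \<rightarrow>\<^sub>E E3 \<kappa>.
     bij_betw f (E3 \<kappa>) (E3 \<kappa>) \<and> smooth_on (E3 \<kappa>) f \<and>
     smooth_on (E3 \<kappa>) (inv_into (E3 \<kappa>) f) \<and>
     (\<forall>x\<in>E3 \<kappa>. \<forall>v w. E3_metric \<kappa> \<tau> (f x) (differential f x v) (differential f x w)
        = E3_metric \<kappa> \<tau> x v w)}"

text \<open>The compact-open topology on a set \<open>F\<close> of maps with domain \<open>A\<close>.\<close>

definition compact_open ::
  "'a::topological_space set \<Rightarrow> ('a \<Rightarrow> 'b::topological_space) set \<Rightarrow> ('a \<Rightarrow> 'b) topology" where
  "compact_open A F = topology_generated_by
     {{f \<in> F. f ` K \<subseteq> U} | K U. compact K \<and> K \<subseteq> A \<and> open U}"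

definition Isom0 :: "real \<Rightarrow> real \<Rightarrow> (pt \<Rightarrow> pt) set" where
  "Isom0 \<kappa> \<tau> = {f. connected_component_of
     (compact_open (E3 \<kappa>) (isometries \<kappa> \<tau>)) (\<lambda>x\<in>E3 \<kappa>. x) f}"

definition is_horizontal_part :: "real \<Rightarrow> (pt \<Rightarrow> pt) \<Rightarrow> (complex \<Rightarrow> complex) \<Rightarrow> bool" where
  "is_horizontal_part \<kappa> f h \<longleftrightarrow> (\<forall>x\<in>E3 \<kappa>. h (hproj x) = hproj (f x))"


section \<open>The Riemann sphere\<close>

text \<open>\<open>None\<close> is the point at infinity.\<close>

type_synonym riemann_sphere = "complex option"

definition equator :: "riemann_sphere set" where
  "equator = Some ` {z. cmod z = 1}"

definition north :: "riemann_sphere set" where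
  "north = Some ` {z. cmod z < 1}"

definition south :: "riemann_sphere set" where
  "south = insert None (Some ` {z. cmod z > 1})"

text \<open>The quotient \<open>a / b\<close> in the Riemann sphere, that is, the point with homogeneous
  coordinates \<open>[a : b]\<close>; meaningful only if \<open>a\<close> and \<open>b\<close> are not both zero.\<close>

definition sphere_frac :: "complex \<Rightarrow> complex \<Rightarrow> riemann_sphere" where
  "sphere_frac a b = (if b = 0 then None else Some (a / b))"

text \<open>The inverses of the two standard charts \<open>z\<close> and \<open>1 / z\<close> of the Riemann sphere.\<close>

definition sphere_param :: "bool \<Rightarrow> complex \<Rightarrow> riemann_sphere" where
  "sphere_param b w = (if b then Some w else sphere_frac 1 w)"

text \<open>\<open>F\<close>, defined on a neighbourhood \<open>U\<close> of \<open>p\<close> in the ambient Euclidean space, extends the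
  expression of \<open>f\<close> near \<open>p\<close> in one of the charts. As usual, smoothness and analyticity of maps
  on an embedded submanifold \<open>M\<close> are defined through such local extensions.\<close>

definition local_expr ::
  "'a::euclidean_space set \<Rightarrow> ('a \<Rightarrow> riemann_sphere) \<Rightarrow> 'a \<Rightarrow> 'a set \<Rightarrow> ('a \<Rightarrow> complex) \<Rightarrow> bool" where
  "local_expr M f p U F \<longleftrightarrow> open U \<and> p \<in> U \<and>
     (\<exists>b. \<forall>q\<in>M \<inter> U. f q = sphere_param b (F q))"

definition real_analytic_to_sphere ::
  "'a::euclidean_space set \<Rightarrow> ('a \<Rightarrow> riemann_sphere) \<Rightarrow> bool" where
  "real_analytic_to_sphere M f \<longleftrightarrow>
     (\<forall>p\<in>M. \<exists>U F. local_expr M f p U F \<and> real_analytic_on U F)"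

text \<open>Conformal diffeomorphisms from the unit sphere of a Euclidean inner product \<open>g\<close>, with its
  induced metric, onto the Riemann sphere. The tangent space at \<open>Z\<close> is the \<open>g\<close>-orthogonal
  complement of \<open>Z\<close>. Conformal means angle-preserving; no orientation is involved.\<close>

definition conformal_diffeo_to_sphere ::
  "('a::euclidean_space \<Rightarrow> 'a \<Rightarrow> real) \<Rightarrow> ('a \<Rightarrow> riemann_sphere) \<Rightarrow> bool" where
  "conformal_diffeo_to_sphere g f \<longleftrightarrow>
     bij_betw f {Z. g Z Z = 1} UNIV \<and>
     (\<forall>Z. g Z Z = 1 \<longrightarrow> (\<exists>U F. local_expr {Z. g Z Z = 1} f Z U F \<and> smooth_on U F \<and>
        (\<exists>\<mu>>0. \<forall>W W'. g Z W = 0 \<and> g Z W' = 0 \<longrightarrow>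
           differential F Z W \<bullet> differential F Z W' = \<mu> * g W W'))) \<and>
     (\<forall>b. smooth_on UNIV (\<lambda>w. inv_into {Z. g Z Z = 1} f (sphere_param b w)))"

definition SU11 :: "(complex^2^2) set" where
  "SU11 = {M. \<exists>\<alpha> \<beta>. M$1$1 = \<alpha> \<and> M$1$2 = \<beta> \<and> M$2$1 = cnj \<beta> \<and> M$2$2 = cnj \<alpha> \<and>
     (cmod \<alpha>)\<^sup>2 - (cmod \<beta>)\<^sup>2 = 1}"

fun psi :: "complex^2^2 \<Rightarrow> riemann_sphere \<Rightarrow> riemann_sphere" where
  "psi M (Some z) = sphere_frac (M$1$1 * z + M$1$2) (M$2$1 * z + M$2$2)"
| "psi M None = sphere_frac (M$1$1) (M$2$1)"

definition phi :: "real \<Rightarrow> complex^2^2 \<Rightarrow> complex \<Rightarrow> complex" where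
  "phi \<kappa> M \<zeta> = of_real (1 / cpar \<kappa>) *
     moebius (M$1$1) (M$1$2) (M$2$1) (M$2$2) (of_real (cpar \<kappa>) * \<zeta>)"

definition sigma :: "real \<Rightarrow> complex \<Rightarrow> riemann_sphere" where
  "sigma \<kappa> \<zeta> = Some (of_real (cpar \<kappa>) * \<zeta>)"


section \<open>The conditions characterizing the map\<close>

definition equivariant :: "real \<Rightarrow> real \<Rightarrow> (pt \<times> pt \<Rightarrow> riemann_sphere) \<Rightarrow> bool" where
  "equivariant \<kappa> \<tau> P \<longleftrightarrow>
     (\<forall>f\<in>Isom0 \<kappa> \<tau>. \<forall>M\<in>SU11. is_horizontal_part \<kappa> f (phi \<kappa> M) \<longrightarrow>
        (\<forall>(x, Z)\<in>UE \<kappa> \<tau>. P (f x, differential f x Z) = psi M (P (x, Z))))"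

definition respects_hemispheres :: "real \<Rightarrow> real \<Rightarrow> (pt \<times> pt \<Rightarrow> riemann_sphere) \<Rightarrow> bool" where
  "respects_hemispheres \<kappa> \<tau> P \<longleftrightarrow> (\<forall>(x, Z)\<in>UE \<kappa> \<tau>.
     (P (x, Z) \<in> equator \<longleftrightarrow> horizontal \<kappa> \<tau> x Z) \<and>
     (P (x, Z) \<in> north \<longleftrightarrow> upwards \<kappa> \<tau> x Z) \<and>
     (P (x, Z) \<in> south \<longleftrightarrow> downwards \<kappa> \<tau> x Z))"

definition endpoint_on_horizontal :: "real \<Rightarrow> real \<Rightarrow> (pt \<times> pt \<Rightarrow> riemann_sphere) \<Rightarrow> bool" where
  "endpoint_on_horizontal \<kappa> \<tau> P \<longleftrightarrow> (\<forall>(x, Z)\<in>UE \<kappa> \<tau>. horizontal \<kappa> \<tau> x Z \<longrightarrow>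
     P (x, Z) = sigma \<kappa> (geodesic_endpoint \<kappa> (hproj x) (differential hproj x Z)))"

definition fibrewise_conformal :: "real \<Rightarrow> real \<Rightarrow> (pt \<times> pt \<Rightarrow> riemann_sphere) \<Rightarrow> bool" where
  "fibrewise_conformal \<kappa> \<tau> P \<longleftrightarrow> (\<forall>x\<in>E3 \<kappa>.
     conformal_diffeo_to_sphere (E3_metric \<kappa> \<tau> x) (\<lambda>Z. P (x, Z)))"

end

(*
  The map is stereographic projection of the unit tangent sphere from - xi, written in the frame
  (V1, V2, V3), followed by the Moebius map z |-> (z + a) / (cnj a * z + 1) with a = c * zeta.

  Uniqueness: two maps satisfying (b), (c), (d) differ in each fibre by a conformal self-map of the
  sphere that preserves both hemispheres and is the identity on the equator. On each closed
  hemisphere it is holomorphic or antiholomorphic, so by the maximum principle it is the identity.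

  Equivariance: an isometry over phi_M maps xi to xi or to - xi. If it maps xi to xi, it acts on the
  frame coordinates as a rotation, and (a) is an identity between Moebius transformations. If it
  maps xi to - xi, it reverses orientation; its local degree is then - 1, whereas local degree is
  locally constant in the compact-open topology, so it is not in the identity component.

  Endpoints: a disk isometry moves the starting point of a geodesic to the centre, where conserved
  quantities reduce the geodesic equation to y' = 1 - c^2 y^2, solved by tanh.
*)
theory Submission
  imports Defs "HOL-Complex_Analysis.Conformal_Mappings" "HOL-Homology.Brouwer_Degree"
begin

section \<open>Smooth functions\<close>

text \<open>Stereographic projection from \<open>- xi\<close> degenerates at \<open>- xi\<close>,
  and the image can be infinite in the southern hemisphere. The formulas therefore use homogeneous
  coordinates, with a second form [1 - s : cnj w] of [w : 1 + s] that survives at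
  \<open>- xi\<close>; conformality, analyticity and equivariance become identities between
  numerators and denominators. The Moebius factor is forced by (c): for a base point at the centre
  of the disk, the endpoint in direction w is w up to scale, and z -> (z + a) / (cnj a * z + 1) is
  the disk isometry carrying 0 to a. Degree enters because the identity component is a connected
  component for the compact-open topology, where neither paths nor convergence of derivatives are at
  hand: the sign of a Jacobian is not visibly locally constant, but the degree is determined by
  uniform closeness alone. Conformality is stated pointwise, for an ambient extension restricted to
  tangent vectors, and allows either orientation. Two parametrizations are therefore compared
  through their transition map, an honest map between plane domains.\<close>

lemma frechet_derivative_cong_open:
  assumes "open S" "x \<in> S" "\<And>y. y \<in> S \<Longrightarrow> f y = g y"
  shows "differential f x = differential g x"
proof -
  have "(f has_derivative D) (at x) \<longleftrightarrow> (g has_derivative D) (at x)" for D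
    using has_derivative_transform_within_open[OF _ assms(1,2)] assms(3) by metis
  then show ?thesis by (simp add: frechet_derivative_def)
qed

lemma Ck_on_cong:
  assumes "open S" "\<And>x. x \<in> S \<Longrightarrow> f x = g x" "Ck_on k S f"
  shows "Ck_on k S g"
  using assms(2,3)
proof (induction k arbitrary: f g)
  case 0
  then show ?case using continuous_on_cong[of S S f g] by simp
next
  case (Suc k)
  have f: "(f has_derivative differential f x) (at x)" if "x \<in> S" for x
    using Suc.prems(2) that by (simp add: frechet_derivative_works)
  have "g differentiable (at x)" if "x \<in> S" for x
    using has_derivative_transform_within_open[OF f[OF that] assms(1) that] Suc.prems(1)
    by (auto simp: differentiable_def)
  moreover have "Ck_on k S (\<lambda>x. differential g x v)" for v
  proof (rule Suc.IH)
    show "Ck_on k S (\<lambda>x. differential f x v)" using Suc.prems(2) by simp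
  qed (use frechet_derivative_cong_open[OF assms(1)] Suc.prems(1) in metis)
  ultimately show ?case by simp
qed

text \<open>\<open>Ck_on\<close> speaks of the total function \<open>frechet_derivative\<close>; on
  an open set any explicitly computed derivative may replace it, which is how all closure rules
  below are proved.\<close>

lemma Ck_on_SucI:
  assumes S: "open S" and f: "\<And>x. x \<in> S \<Longrightarrow> (f has_derivative f' x) (at x)"
    and f': "\<And>v. Ck_on k S (\<lambda>x. f' x v)"
  shows "Ck_on (Suc k) S f"
proof -
  have "differential f x = f' x" if "x \<in> S" for x
    using f[OF that] frechet_derivative_at by metis
  then have "Ck_on k S (\<lambda>x. differential f x v)" for v
    by (intro Ck_on_cong[OF S _ f'[of v]]) simp
  then show ?thesis using f by (auto simp: differentiable_def)
qed

lemma Ck_on_SucD: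
  assumes "Ck_on (Suc k) S f"
  shows "x \<in> S \<Longrightarrow> (f has_derivative differential f x) (at x)"
    and "Ck_on k S (\<lambda>x. differential f x v)"
  using assms by (auto simp: frechet_derivative_works)

lemma Ck_on_Suc_le: "Ck_on (Suc k) S f \<Longrightarrow> Ck_on k S f"
proof (induction k arbitrary: f)
  case 0
  then show ?case
    by (auto intro!: continuous_at_imp_continuous_on differentiable_imp_continuous_within)
next
  case (Suc k)
  then show ?case by (metis Ck_on.simps(2))
qed

lemma Ck_on_const: "open S \<Longrightarrow> Ck_on k S (\<lambda>x. c)"
proof (induction k arbitrary: c)
  case (Suc k)
  show ?case
    by (rule Ck_on_SucI[where f' = "\<lambda>x v. 0", OF Suc.prems]) (use Suc in auto)
qed simp

lemma Ck_on_bounded_linear: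
  assumes "bounded_linear L" "open S"
  shows "Ck_on k S L"
proof (cases k)
  case 0
  then show ?thesis using assms(1) by (simp add: linear_continuous_on)
next
  case (Suc n)
  show ?thesis unfolding Suc
    by (rule Ck_on_SucI[where f' = "\<lambda>x. L"])
      (use assms bounded_linear_imp_has_derivative Ck_on_const in auto)
qed

lemma Ck_on_add:
  assumes "open S" "Ck_on k S f" "Ck_on k S g"
  shows "Ck_on k S (\<lambda>x. f x + g x)"
  using assms(2,3)
proof (induction k arbitrary: f g)
  case (Suc k)
  note D = Ck_on_SucD[OF Suc.prems(1)] Ck_on_SucD[OF Suc.prems(2)]
  show ?case
    by (rule Ck_on_SucI[OF assms(1) has_derivative_add[OF D(1) D(3)]])
      (assumption | rule Suc.IH D assms(1))+
qed (auto intro!: continuous_intros)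

lemma Ck_on_linear_compose:
  assumes "open S" "bounded_linear L" "Ck_on k S f"
  shows "Ck_on k S (\<lambda>x. L (f x))"
  using assms(3)
proof (induction k arbitrary: f)
  case 0
  then show ?case using assms(2) by (simp add: bounded_linear.continuous_on)
next
  case (Suc k)
  note D = Ck_on_SucD[OF Suc.prems]
  show ?case
    by (rule Ck_on_SucI[OF assms(1) bounded_linear.has_derivative[OF assms(2) D(1)]])
      (assumption | rule Suc.IH D assms(1))+
qed

text \<open>Each summand of the product rule keeps one factor undifferentiated, so the induction
  hypothesis needs that factor one order lower; \<open>Ck_on_Suc_le\<close> supplies it.\<close>

lemma Ck_on_bilinear:
  assumes "open S" "bounded_bilinear B" "Ck_on k S f" "Ck_on k S g"
  shows "Ck_on k S (\<lambda>x. B (f x) (g x))"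
  using assms(3,4)
proof (induction k arbitrary: f g)
  case 0
  then show ?case using assms(2) by (simp add: bounded_bilinear.continuous_on)
next
  case (Suc k)
  note D = Ck_on_SucD[OF Suc.prems(1)] Ck_on_SucD[OF Suc.prems(2)]
  show ?case
    by (rule Ck_on_SucI[OF assms(1) bounded_bilinear.FDERIV[OF assms(2) D(1) D(3)]])
      (assumption | rule Ck_on_add Suc.IH D Ck_on_Suc_le[OF Suc.prems(1)] Ck_on_Suc_le[OF Suc.prems(2)] assms(1))+
qed

lemmas Ck_on_mult = Ck_on_bilinear[OF _ bounded_bilinear_mult]

text \<open>The derivative of the reciprocal is a product of the derivative of \<open>f\<close> with
  two copies of the reciprocal itself, which the induction hypothesis already controls at one order
  less.\<close>

lemma Ck_on_inverse:
  fixes f :: "'a::euclidean_space \<Rightarrow> 'b::real_normed_field"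
  assumes "open S" "Ck_on k S f" "\<And>x. x \<in> S \<Longrightarrow> f x \<noteq> 0"
  shows "Ck_on k S (\<lambda>x. inverse (f x))"
  using assms(2)
proof (induction k)
  case 0
  then show ?case using assms(3) by (auto intro!: continuous_intros)
next
  case (Suc k)
  note D = Ck_on_SucD[OF Suc.prems]
  have I: "Ck_on k S (\<lambda>x. inverse (f x))"
    by (rule Suc.IH[OF Ck_on_Suc_le[OF Suc.prems]])
  have "Ck_on k S (\<lambda>x. (- 1) * (inverse (f x) * differential f x v * inverse (f x)))" for v
    by (intro Ck_on_mult Ck_on_const I D(2) assms(1))
  then show ?case
    by (intro Ck_on_SucI[OF assms(1) Deriv.has_derivative_inverse[OF assms(3) D(1)]])
      (use assms(1) in auto)
qed

lemma smooth_on_const: "open S \<Longrightarrow> smooth_on S (\<lambda>x. c)"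
  by (simp add: smooth_on_def Ck_on_const)

lemma smooth_on_bounded_linear: "\<lbrakk>bounded_linear L; open S\<rbrakk> \<Longrightarrow> smooth_on S L"
  by (simp add: smooth_on_def Ck_on_bounded_linear)

lemma smooth_on_add: "\<lbrakk>open S; smooth_on S f; smooth_on S g\<rbrakk> \<Longrightarrow> smooth_on S (\<lambda>x. f x + g x)"
  by (simp add: smooth_on_def Ck_on_add)

lemma smooth_on_linear_compose:
  "\<lbrakk>open S; bounded_linear L; smooth_on S f\<rbrakk> \<Longrightarrow> smooth_on S (\<lambda>x. L (f x))"
  by (simp add: smooth_on_def Ck_on_linear_compose)

lemma smooth_on_mult:
  fixes f g :: "'a::euclidean_space \<Rightarrow> 'b::real_normed_algebra"
  shows "\<lbrakk>open S; smooth_on S f; smooth_on S g\<rbrakk> \<Longrightarrow> smooth_on S (\<lambda>x. f x * g x)"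
  by (simp add: smooth_on_def Ck_on_mult)

lemma smooth_on_divide:
  fixes f g :: "'a::euclidean_space \<Rightarrow> 'b::real_normed_field"
  assumes "open S" "smooth_on S f" "smooth_on S g" "\<And>x. x \<in> S \<Longrightarrow> g x \<noteq> 0"
  shows "smooth_on S (\<lambda>x. f x / g x)"
  using assms by (simp add: smooth_on_def divide_inverse Ck_on_mult Ck_on_inverse)

lemma smooth_on_has_derivative:
  assumes "smooth_on S f" "x \<in> S"
  shows "(f has_derivative differential f x) (at x)"
  using assms Ck_on_SucD(1) unfolding smooth_on_def by blast

lemma smooth_on_continuous_derivative:
  assumes "smooth_on S f"
  shows "continuous_on S (\<lambda>x. differential f x v)"
  using assms Ck_on_SucD(2)[of 0 S f v] unfolding smooth_on_def by (simp del: Ck_on.simps(2))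

lemma smooth_on_continuous_on: "smooth_on S f \<Longrightarrow> continuous_on S f"
  using Ck_on.simps(1) unfolding smooth_on_def by metis

section \<open>Real analytic functions\<close>

text \<open>The index set of \<open>real_analytic_at\<close>; extensionality makes every multi-index
  a single function, so no term is counted twice.\<close>

definition multi_indices :: "('a::euclidean_space \<Rightarrow> nat) set" where
  "multi_indices = Basis \<rightarrow>\<^sub>E UNIV"

definition multi_degree :: "('a::euclidean_space \<Rightarrow> nat) \<Rightarrow> nat" where
  "multi_degree \<alpha> = (\<Sum>b\<in>Basis. \<alpha> b)"

definition monomial_at :: "'a::euclidean_space \<Rightarrow> ('a \<Rightarrow> nat) \<Rightarrow> real" where
  "monomial_at v \<alpha> = (\<Prod>b\<in>Basis. (v \<bullet> b) ^ \<alpha> b)"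

abbreviation in_cube :: "'a::euclidean_space \<Rightarrow> real \<Rightarrow> bool" where
  "in_cube v \<rho> \<equiv> \<forall>b\<in>Basis. \<bar>v \<bullet> b\<bar> \<le> \<rho>"

abbreviation power_series_sum ::
  "(('a::euclidean_space \<Rightarrow> nat) \<Rightarrow> 'b::real_normed_vector) \<Rightarrow> 'a \<Rightarrow> 'b \<Rightarrow> bool" where
  "power_series_sum a v S \<equiv> ((\<lambda>\<alpha>. monomial_at v \<alpha> *\<^sub>R a \<alpha>) has_sum S) multi_indices"

abbreviation power_series_norm ::
  "(('a::euclidean_space \<Rightarrow> nat) \<Rightarrow> 'b::real_normed_vector) \<Rightarrow> real \<Rightarrow> real \<Rightarrow> bool" where
  "power_series_norm a \<rho> s \<equiv> ((\<lambda>\<alpha>. \<rho> ^ multi_degree \<alpha> * norm (a \<alpha>)) has_sum s) multi_indices"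

text \<open>On the cube of half-side \<open>\<rho>\<close> around \<open>x\<close>, \<open>f\<close> is the sum of a power series whose weighted
  \<open>\<ell>\<^sup>1\<close> norm is at most \<open>N\<close>; these norms are submultiplicative, which is what makes the Neumann
  series for the reciprocal converge.\<close>

definition expansion ::
  "('a::euclidean_space \<Rightarrow> 'b::{real_normed_field,banach}) \<Rightarrow> 'a \<Rightarrow> real \<Rightarrow> real \<Rightarrow> bool" where
  "expansion f x \<rho> N \<longleftrightarrow> \<rho> > 0 \<and> (\<exists>a. (\<exists>s\<le>N. power_series_norm a \<rho> s) \<and>
     (\<forall>y. in_cube (y - x) \<rho> \<longrightarrow> power_series_sum a (y - x) (f y)))"

lemma expansion_mono: "expansion f x \<rho> N \<Longrightarrow> N \<le> N' \<Longrightarrow> expansion f x \<rho> N'"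
  unfolding expansion_def using order_trans by blast

lemma abs_monomial_at_le:
  assumes "in_cube v \<rho>"
  shows "\<bar>monomial_at v \<alpha>\<bar> \<le> \<rho> ^ multi_degree \<alpha>"
proof -
  have "\<bar>monomial_at v \<alpha>\<bar> = (\<Prod>b\<in>Basis. \<bar>v \<bullet> b\<bar> ^ \<alpha> b)"
    by (simp add: monomial_at_def abs_prod power_abs)
  also have "\<dots> \<le> (\<Prod>b\<in>Basis. \<rho> ^ \<alpha> b)"
    using assms by (intro prod_mono) (auto intro: power_mono)
  finally show ?thesis by (simp add: multi_degree_def power_sum)
qed

lemma expansion_imp_real_analytic_at:
  assumes "expansion f x \<rho> N"
  shows "real_analytic_at f x"
proof -
  obtain a where "\<rho> > 0" and a: "\<And>y. in_cube (y - x) \<rho> \<Longrightarrow>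
        power_series_sum a (y - x) (f y)"
    using assms unfolding expansion_def by blast
  have "\<bar>(y - x) \<bullet> b\<bar> \<le> \<rho>" if "y \<in> ball x \<rho>" "b \<in> Basis" for y b
    using Basis_le_norm[OF that(2), of "y - x"] that(1) by (simp add: dist_norm norm_minus_commute)
  then show ?thesis
    using a \<open>\<rho> > 0\<close> unfolding real_analytic_at_def monomial_at_def multi_indices_def by blast
qed

text \<open>Regrouping by multi-index lets products and series of expansions be summed over their
  natural index sets.\<close>

lemma expansion_family:
  fixes c :: "'i \<Rightarrow> 'b::{real_normed_field,banach}" and x :: "'a::euclidean_space"
  assumes \<rho>: "\<rho> > 0" and m: "\<And>i. i \<in> I \<Longrightarrow> m i \<in> multi_indices"
    and s: "((\<lambda>i. \<rho> ^ multi_degree (m i) * norm (c i)) has_sum s) I" "s \<le> N"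
    and f: "\<And>y. in_cube (y - x) \<rho> \<Longrightarrow>
              ((\<lambda>i. monomial_at (y - x) (m i) *\<^sub>R c i) has_sum f y) I"
  shows "expansion f x \<rho> N"
proof -
  \<comment> \<open>The fibres of \<open>m\<close> partition \<open>I\<close>. Summing inside a
    fibre first gives the coefficient of one monomial, and the triangle inequality there shows that
    regrouping does not increase the weighted norm.\<close>
  define B where "B \<alpha> = {i\<in>I. m i = \<alpha>}" for \<alpha>
  define a where "a \<alpha> = infsum c (B \<alpha>)" for \<alpha>
  define n where "n \<alpha> = infsum (\<lambda>i. norm (c i)) (B \<alpha>)" for \<alpha>
  have reindex: "((\<lambda>(\<alpha>, i). g i) has_sum S) (Sigma multi_indices B)" if "(g has_sum S) I"
    for g :: "'i \<Rightarrow> 'c::real_normed_vector" and S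
  proof -
    have "((\<lambda>(\<alpha>, i). g i) has_sum S) (Sigma multi_indices B) \<longleftrightarrow> (g has_sum S) I"
      by (rule has_sum_reindex_bij_witness[where i = "\<lambda>i. (m i, i)" and j = snd])
        (use m in \<open>auto simp: B_def\<close>)
    with that show ?thesis by blast
  qed
  have abs: "(\<lambda>i. norm (c i)) summable_on B \<alpha>" for \<alpha>
  proof -
    have "(\<lambda>i. \<rho> ^ multi_degree (m i) * norm (c i)) summable_on B \<alpha>"
      by (rule summable_on_subset_banach[of _ I]) (use s(1) in \<open>auto simp: B_def summable_on_def\<close>)
    then have "(\<lambda>i. \<rho> ^ multi_degree \<alpha> * norm (c i)) summable_on B \<alpha>"
      by (rule summable_on_cong[THEN iffD1, rotated]) (simp add: B_def)
    from summable_on_cmult_right[OF this, of "1 / \<rho> ^ multi_degree \<alpha>"]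
    show ?thesis using \<rho> by simp
  qed
  have "((\<lambda>i. \<rho> ^ multi_degree (m i) * norm (c i)) has_sum (\<rho> ^ multi_degree \<alpha> * n \<alpha>)) (B \<alpha>)" for \<alpha>
  proof -
    have "((\<lambda>i. \<rho> ^ multi_degree \<alpha> * norm (c i)) has_sum (\<rho> ^ multi_degree \<alpha> * n \<alpha>)) (B \<alpha>)"
      unfolding n_def by (intro has_sum_cmult_right has_sum_infsum abs)
    then show ?thesis
      by (rule has_sum_cong[THEN iffD1, rotated]) (simp add: B_def)
  qed
  then have n: "((\<lambda>\<alpha>. \<rho> ^ multi_degree \<alpha> * n \<alpha>) has_sum s) multi_indices"
    using has_sum_SigmaD[OF reindex[OF s(1)]] by simp
  have le: "\<rho> ^ multi_degree \<alpha> * norm (a \<alpha>) \<le> \<rho> ^ multi_degree \<alpha> * n \<alpha>" for \<alpha>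
    unfolding a_def n_def using \<rho> abs by (intro mult_left_mono norm_infsum_bound) auto
  have sm: "(\<lambda>\<alpha>. \<rho> ^ multi_degree \<alpha> * norm (a \<alpha>)) summable_on multi_indices"
    by (rule summable_on_comparison_test[OF has_sum_imp_summable[OF n] le]) (use \<rho> in auto)
  have 1: "infsum (\<lambda>\<alpha>. \<rho> ^ multi_degree \<alpha> * norm (a \<alpha>)) multi_indices \<le> N"
    using has_sum_mono[OF has_sum_infsum[OF sm] n le] s(2) by linarith
  have 2: "power_series_sum a (y - x) (f y)"
    if "in_cube (y - x) \<rho>" for y
  proof -
    have "((\<lambda>i. monomial_at (y - x) (m i) *\<^sub>R c i) has_sum (monomial_at (y - x) \<alpha> *\<^sub>R a \<alpha>)) (B \<alpha>)" for \<alpha>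
    proof -
      have "((\<lambda>i. monomial_at (y - x) \<alpha> *\<^sub>R c i) has_sum (monomial_at (y - x) \<alpha> *\<^sub>R a \<alpha>)) (B \<alpha>)"
        unfolding a_def
        by (rule has_sum_scaleR, rule has_sum_infsum, rule abs_summable_summable, rule abs)
      then show ?thesis
        by (rule has_sum_cong[THEN iffD1, rotated]) (simp add: B_def)
    qed
    then show ?thesis
      using has_sum_SigmaD[OF reindex[OF f[OF that]]] by simp
  qed
  show ?thesis
    unfolding expansion_def using \<rho> 1 2 has_sum_infsum[OF sm] by blast
qed

lemma multi_degree_eq_0_iff:
  "\<alpha> \<in> multi_indices \<Longrightarrow> multi_degree \<alpha> = 0 \<longleftrightarrow> \<alpha> = (\<lambda>b\<in>Basis. 0)"
  by (auto simp: multi_degree_def multi_indices_def PiE_def extensional_def fun_eq_iff)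

lemma monomial_at_0: "\<alpha> \<in> multi_indices \<Longrightarrow> \<alpha> \<noteq> (\<lambda>b\<in>Basis. 0) \<Longrightarrow> monomial_at 0 \<alpha> = 0"
  using multi_degree_eq_0_iff[of \<alpha>] by (auto simp: monomial_at_def multi_degree_def)

lemma expansion_affine:
  fixes L :: "'a::euclidean_space \<Rightarrow> 'b::{real_normed_field,banach}"
  assumes "linear L"
  shows "expansion (\<lambda>y. k + L y) x 1 (norm (k + L x) + (\<Sum>b\<in>Basis. norm (L b)))"
proof (rule expansion_family)
  \<comment> \<open>The vector \<open>0\<close> is not in \<open>Basis\<close> and so can index the
    constant term; the radius 1 is arbitrary, since an affine function equals its expansion
    everywhere.\<close>
  let ?I = "insert 0 (Basis :: 'a set)"
  let ?m = "\<lambda>i. \<lambda>b\<in>Basis. if b = i then 1 else (0::nat)"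
  let ?c = "\<lambda>i. if i = 0 then k + L x else L i"
  show "((\<lambda>i. 1 ^ multi_degree (?m i) * norm (?c i)) has_sum
      (norm (k + L x) + (\<Sum>b\<in>Basis. norm (L b)))) ?I"
    by (rule has_sum_finiteI) (auto intro!: sum.cong)
  fix y
  have "L (y - x) = (\<Sum>b\<in>Basis. ((y - x) \<bullet> b) *\<^sub>R L b)"
    using linear_sum[OF assms, of "\<lambda>b. ((y - x) \<bullet> b) *\<^sub>R b" Basis]
    by (simp add: euclidean_representation linear_scale[OF assms])
  then have L: "L y = L x + (\<Sum>b\<in>Basis. ((y - x) \<bullet> b) *\<^sub>R L b)"
    using linear_diff[OF assms, of y x] by (simp add: algebra_simps)
  have "monomial_at (y - x) (?m i) = (\<Prod>b\<in>Basis. if b = i then (y - x) \<bullet> i else 1)" for i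
    unfolding monomial_at_def by (intro prod.cong) auto
  then have "monomial_at (y - x) (?m i) = (if i \<in> Basis then (y - x) \<bullet> i else 1)" for i
    by (simp add: prod.delta)
  then show "((\<lambda>i. monomial_at (y - x) (?m i) *\<^sub>R ?c i) has_sum (k + L y)) ?I"
    by (intro has_sum_finiteI) (auto simp: L intro!: sum.cong)
qed (auto simp: multi_indices_def)

text \<open>Iterated summation yields the value; summability over the product set comes from the
  norms, whose iterated sums are finite.\<close>

lemma has_sum_times:
  fixes f :: "'i \<Rightarrow> 'b::{real_normed_field,banach}"
  assumes f: "(f has_sum s) A" "(\<lambda>x. norm (f x)) summable_on A"
    and g: "(g has_sum t) B" "(\<lambda>x. norm (g x)) summable_on B"
  shows "((\<lambda>(x, y). f x * g y) has_sum s * t) (A \<times> B)"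
proof (rule has_sum_SigmaI)
  show "((\<lambda>y. case (x, y) of (x, y) \<Rightarrow> f x * g y) has_sum f x * t) B" for x
    using has_sum_cmult_right[OF g(1)] by simp
  show "((\<lambda>x. f x * t) has_sum s * t) A"
    using has_sum_cmult_left[OF f(1)] by simp
  have "(\<lambda>(x, y). norm (f x) * norm (g y)) summable_on (A \<times> B)"
  proof (rule summable_on_SigmaI)
    show "((\<lambda>y. case (x, y) of (x, y) \<Rightarrow> norm (f x) * norm (g y)) has_sum
        norm (f x) * infsum (\<lambda>y. norm (g y)) B) B" for x
      using has_sum_cmult_right[OF has_sum_infsum[OF g(2)]] by simp
    show "(\<lambda>x. norm (f x) * infsum (\<lambda>y. norm (g y)) B) summable_on A"
      using f(2) by (rule summable_on_cmult_left)
  qed auto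
  then show "(\<lambda>(x, y). f x * g y) summable_on A \<times> B"
    by - (rule abs_summable_summable, simp add: case_prod_unfold norm_mult)
qed

lemma expansionE:
  assumes "expansion f x \<rho> N"
  obtains a s where "\<rho> > 0" "s \<le> N"
    "power_series_norm a \<rho> s"
    "\<And>y. in_cube (y - x) \<rho> \<Longrightarrow>
        power_series_sum a (y - x) (f y)"
    "\<And>y. in_cube (y - x) \<rho> \<Longrightarrow>
        (\<lambda>\<alpha>. norm (monomial_at (y - x) \<alpha> *\<^sub>R a \<alpha>)) summable_on multi_indices"
proof -
  obtain a s where as: "\<rho> > 0" "s \<le> N"
    "power_series_norm a \<rho> s"
    "\<And>y. in_cube (y - x) \<rho> \<Longrightarrow>
        power_series_sum a (y - x) (f y)"
    using assms unfolding expansion_def by blast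
  have "(\<lambda>\<alpha>. norm (monomial_at (y - x) \<alpha> *\<^sub>R a \<alpha>)) summable_on multi_indices"
    if "in_cube (y - x) \<rho>" for y
    by (rule summable_on_comparison_test[OF has_sum_imp_summable[OF as(3)]])
      (use abs_monomial_at_le[OF that] in \<open>auto intro: mult_right_mono\<close>)
  with as that show ?thesis by blast
qed

text \<open>The product is summed over pairs of multi-indices and regrouped along their sum. Weights
  and monomials are multiplicative along this map, so the norms multiply and no convolution formula
  is written down.\<close>

lemma expansion_mult:
  assumes "expansion f x \<rho> N" "expansion g x \<rho> N'"
  shows "expansion (\<lambda>y. f y * g y) x \<rho> (N * N')"
proof -
  obtain a s where a: "\<rho> > 0" "s \<le> N"
    "power_series_norm a \<rho> s"
    "\<And>y. in_cube (y - x) \<rho> \<Longrightarrow>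
        power_series_sum a (y - x) (f y)"
    "\<And>y. in_cube (y - x) \<rho> \<Longrightarrow>
        (\<lambda>\<alpha>. norm (monomial_at (y - x) \<alpha> *\<^sub>R a \<alpha>)) summable_on multi_indices"
    by (rule expansionE[OF assms(1)]) blast
  obtain b t where b: "t \<le> N'"
    "power_series_norm b \<rho> t"
    "\<And>y. in_cube (y - x) \<rho> \<Longrightarrow>
        power_series_sum b (y - x) (g y)"
    "\<And>y. in_cube (y - x) \<rho> \<Longrightarrow>
        (\<lambda>\<alpha>. norm (monomial_at (y - x) \<alpha> *\<^sub>R b \<alpha>)) summable_on multi_indices"
    by (rule expansionE[OF assms(2)]) blast
  let ?m = "\<lambda>(\<alpha>, \<beta>). \<lambda>i\<in>Basis. \<alpha> i + \<beta> i :: nat"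
  let ?c = "\<lambda>(\<alpha>, \<beta>). a \<alpha> * b \<beta>"
  have st: "s \<ge> 0" "t \<ge> 0"
    using a(1) by (auto intro!: has_sum_nonneg[OF a(3)] has_sum_nonneg[OF b(2)])
  have deg: "multi_degree (?m p) = multi_degree (fst p) + multi_degree (snd p)" for p :: "('a \<Rightarrow> nat) \<times> ('a \<Rightarrow> nat)"
    by (simp add: multi_degree_def case_prod_beta sum.distrib)
  have mon: "monomial_at v (?m p) = monomial_at v (fst p) * monomial_at v (snd p)" for v and p :: "('a \<Rightarrow> nat) \<times> ('a \<Rightarrow> nat)"
    by (simp add: monomial_at_def case_prod_beta power_add prod.distrib)
  show ?thesis
  proof (rule expansion_family[where m = ?m and c = ?c])
    have "((\<lambda>(\<alpha>, \<beta>). (\<rho> ^ multi_degree \<alpha> * norm (a \<alpha>)) * (\<rho> ^ multi_degree \<beta> * norm (b \<beta>)))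
        has_sum s * t) (multi_indices \<times> multi_indices)"
      using a(1) has_sum_imp_summable[OF a(3)] has_sum_imp_summable[OF b(2)]
      by (intro has_sum_times a b) auto
    then show "((\<lambda>i. \<rho> ^ multi_degree (?m i) * norm (?c i)) has_sum s * t) (multi_indices \<times> multi_indices)"
      unfolding deg by (simp add: case_prod_unfold norm_mult power_add mult_ac)
    show "s * t \<le> N * N'" using a(2) b(1) st by (intro mult_mono) auto
    fix y assume y: "in_cube (y - x) \<rho>"
    have "((\<lambda>(\<alpha>, \<beta>). (monomial_at (y - x) \<alpha> *\<^sub>R a \<alpha>) * (monomial_at (y - x) \<beta> *\<^sub>R b \<beta>))
        has_sum f y * g y) (multi_indices \<times> multi_indices)"
      using y by (intro has_sum_times a b) auto
    then show "((\<lambda>i. monomial_at (y - x) (?m i) *\<^sub>R ?c i) has_sum f y * g y) (multi_indices \<times> multi_indices)"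
      unfolding mon by (simp add: case_prod_unfold mult_ac)
  qed (use a in \<open>auto simp: multi_indices_def\<close>)
qed

lemma expansion_add:
  assumes "expansion f x \<rho> N" "expansion g x \<rho> N'"
  shows "expansion (\<lambda>y. f y + g y) x \<rho> (N + N')"
proof -
  obtain a s where a: "\<rho> > 0" "s \<le> N"
    "power_series_norm a \<rho> s"
    "\<And>y. in_cube (y - x) \<rho> \<Longrightarrow>
        power_series_sum a (y - x) (f y)"
    by (rule expansionE[OF assms(1)]) blast
  obtain b t where b: "t \<le> N'"
    "power_series_norm b \<rho> t"
    "\<And>y. in_cube (y - x) \<rho> \<Longrightarrow>
        power_series_sum b (y - x) (g y)"
    by (rule expansionE[OF assms(2)]) blast
  note n = has_sum_add[OF a(3) b(2)]
  have le: "\<rho> ^ multi_degree \<alpha> * norm (a \<alpha> + b \<alpha>) \<le>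
      \<rho> ^ multi_degree \<alpha> * norm (a \<alpha>) + \<rho> ^ multi_degree \<alpha> * norm (b \<alpha>)" for \<alpha>
    using a(1) by (simp flip: distrib_left add: norm_triangle_ineq)
  have sm: "(\<lambda>\<alpha>. \<rho> ^ multi_degree \<alpha> * norm (a \<alpha> + b \<alpha>)) summable_on multi_indices"
    by (rule summable_on_comparison_test[OF has_sum_imp_summable[OF n] le]) (use a(1) in auto)
  have "infsum (\<lambda>\<alpha>. \<rho> ^ multi_degree \<alpha> * norm (a \<alpha> + b \<alpha>)) multi_indices \<le> N + N'"
    using has_sum_mono[OF has_sum_infsum[OF sm] n le] a(2) b(1) by linarith
  then show ?thesis
    unfolding expansion_def
    using a(1) has_sum_infsum[OF sm] has_sum_add[OF a(4) b(3)]
    by (intro conjI exI[where x = "\<lambda>\<alpha>. a \<alpha> + b \<alpha>"]) (auto simp: scaleR_add_right)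
qed

text \<open>Scaling the radius by \<theta> multiplies a term of degree n by \<theta>^n. The norm
  never grows, and if the constant term vanishes it gains a full factor \<theta>. The first
  alternative brings two expansions to a common radius; the second makes the norm small enough for a
  geometric series.\<close>

lemma expansion_shrink:
  assumes "expansion f x \<rho> N" "0 < \<theta>" "\<theta> \<le> 1" and 0: "K = N \<or> f x = 0 \<and> K = \<theta> * N"
  shows "expansion f x (\<theta> * \<rho>) K"
proof -
  obtain a s where a: "\<rho> > 0" "s \<le> N"
    "power_series_norm a \<rho> s"
    "\<And>y. in_cube (y - x) \<rho> \<Longrightarrow>
        power_series_sum a (y - x) (f y)"
    by (rule expansionE[OF assms(1)]) blast
  let ?z = "\<lambda>b\<in>(Basis::'a set). 0::nat"
  define l where "l = (if K = N then 1 else \<theta>)"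
  \<comment> \<open>Evaluation at the centre isolates the constant coefficient, since all other
    monomials vanish there.\<close>
  have "((\<lambda>\<alpha>. monomial_at 0 \<alpha> *\<^sub>R a \<alpha>) has_sum f x) multi_indices"
    using a(1) a(4)[of x] by simp
  moreover have "((\<lambda>\<alpha>. monomial_at 0 \<alpha> *\<^sub>R a \<alpha>) has_sum a ?z) multi_indices"
    by (rule has_sum_finite_neutralI[of "{?z}"])
      (use monomial_at_0 in \<open>auto simp: multi_indices_def monomial_at_def\<close>)
  ultimately have az: "a ?z = f x" using has_sum_unique by blast
  have le: "(\<theta> * \<rho>) ^ multi_degree \<alpha> * norm (a \<alpha>) \<le> l * (\<rho> ^ multi_degree \<alpha> * norm (a \<alpha>))"
    if "\<alpha> \<in> multi_indices" for \<alpha>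
  proof (cases "multi_degree \<alpha> = 0 \<and> l \<noteq> 1")
    case True
    then have "a \<alpha> = 0" using az 0 that by (auto simp: multi_degree_eq_0_iff l_def split: if_splits)
    then show ?thesis by simp
  next
    case False
    have "\<theta> ^ multi_degree \<alpha> \<le> l"
      using assms(2,3) False power_decreasing[of 1 "multi_degree \<alpha>" \<theta>]
      by (auto simp: l_def power_le_one)
    then have "\<theta> ^ multi_degree \<alpha> * (\<rho> ^ multi_degree \<alpha> * norm (a \<alpha>)) \<le> l * (\<rho> ^ multi_degree \<alpha> * norm (a \<alpha>))"
      using a(1) by (intro mult_right_mono) auto
    then show ?thesis by (simp add: power_mult_distrib mult_ac)
  qed
  note n = has_sum_cmult_right[OF a(3), of l]
  have sm: "(\<lambda>\<alpha>. (\<theta> * \<rho>) ^ multi_degree \<alpha> * norm (a \<alpha>)) summable_on multi_indices"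
    by (rule summable_on_comparison_test[OF has_sum_imp_summable[OF n] le]) (use a(1) assms(2) in auto)
  have "l * s \<le> K"
    using a(2) 0 assms(2) by (auto simp: l_def)
  then have 1: "infsum (\<lambda>\<alpha>. (\<theta> * \<rho>) ^ multi_degree \<alpha> * norm (a \<alpha>)) multi_indices \<le> K"
    using has_sum_mono[OF has_sum_infsum[OF sm] n le] by linarith
  have "\<theta> * \<rho> \<le> \<rho>" using assms(3) a(1) by simp
  then have 2: "power_series_sum a (y - x) (f y)"
    if "\<forall>b\<in>Basis. \<bar>(y - x) \<bullet> b\<bar> \<le> \<theta> * \<rho>" for y
    using that by (intro a(4)) force
  show ?thesis
    unfolding expansion_def using 1 2 has_sum_infsum[OF sm] a(1) assms(2) by auto
qed

text \<open>The n-th power of \<open>h\<close> has norm at most (1/2)^n, so the double series over n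
  and multi-indices converges absolutely. Summed over multi-indices first it is the geometric series
  of \<open>h y\<close>; regrouped by monomials it is a power series.\<close>

lemma expansion_inverse_one_minus:
  assumes h: "expansion h x \<rho> (1 / 2)"
  shows "\<exists>N. expansion (\<lambda>y. 1 / (1 - h y)) x \<rho> N"
proof -
  have \<rho>: "\<rho> > 0" using h by (simp add: expansion_def)
  have one: "expansion (\<lambda>y. 1) x \<rho> 1"
    by (rule expansion_family[where I = "{()}" and m = "\<lambda>_. \<lambda>b\<in>Basis. 0" and c = "\<lambda>_. 1" and s = 1])
      (use \<rho> in \<open>auto simp: multi_indices_def multi_degree_def monomial_at_def intro: has_sum_finiteI\<close>)
  have "expansion (\<lambda>y. h y ^ n) x \<rho> ((1 / 2) ^ n)" for n
    by (induction n) (use one expansion_mult[OF h] in auto)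
  then have ex: "\<exists>a s. s \<le> (1 / 2) ^ n \<and>
      power_series_norm a \<rho> s \<and>
      (\<forall>y. (in_cube (y - x) \<rho>) \<longrightarrow>
        power_series_sum a (y - x) (h y ^ n))"
    (is "\<exists>a s. ?P n a s") for n
    unfolding expansion_def by blast
  define P where "P n a s \<longleftrightarrow> ?P n a s" for n a s
  have "\<forall>n. \<exists>a s. P n a s" using ex unfolding P_def by blast
  then obtain a s where P: "P n (a n) (s n)" for n by metis
  have s: "s n \<le> (1 / 2) ^ n"
    and a: "power_series_norm (a n) \<rho> (s n)"
    and f: "in_cube (y - x) \<rho> \<Longrightarrow>
        power_series_sum (a n) (y - x) (h y ^ n)" for n y
    using P[of n] unfolding P_def by auto
  have s0: "s n \<ge> 0" for n using \<rho> by (intro has_sum_nonneg[OF a]) auto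
  have "(\<lambda>n. (1 / 2 :: real) ^ n) summable_on UNIV"
    by (rule norm_summable_imp_summable_on) (simp add: summable_geometric)
  then have ssm: "s summable_on UNIV"
    by (rule summable_on_comparison_test) (use s s0 in auto)
  have sm: "(\<lambda>(n, \<alpha>). \<rho> ^ multi_degree \<alpha> * norm (a n \<alpha>)) summable_on (UNIV \<times> multi_indices)"
    by (rule summable_on_SigmaI[OF _ ssm]) (use a \<rho> in auto)
  show ?thesis
  proof (intro exI, rule expansion_family[where m = snd and c = "\<lambda>(n, \<alpha>). a n \<alpha>"])
    show "((\<lambda>i. \<rho> ^ multi_degree (snd i) * norm (case i of (n, \<alpha>) \<Rightarrow> a n \<alpha>)) has_sum
        infsum (\<lambda>(n, \<alpha>). \<rho> ^ multi_degree \<alpha> * norm (a n \<alpha>)) (UNIV \<times> multi_indices))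
        (UNIV \<times> multi_indices)"
      using has_sum_infsum[OF sm] by (simp add: case_prod_unfold)
    fix y assume y: "in_cube (y - x) \<rho>"
    \<comment> \<open>The weighted norm bounds the values on the cube, so exponent 1 gives a modulus
      of at most 1/2 and the geometric series converges to the reciprocal.\<close>
    have "norm (h y ^ 1) \<le> s 1"
      by (rule norm_infsum_le[OF f[OF y] a]) (use abs_monomial_at_le[OF y] in \<open>auto intro: mult_right_mono\<close>)
    then have "norm (h y) < 1" using s[of 1] by simp
    then have "((\<lambda>n. h y ^ n) has_sum (1 / (1 - h y))) UNIV"
      by (intro norm_summable_imp_has_sum geometric_sums)
        (simp_all add: norm_power summable_geometric)
    then show "((\<lambda>i. monomial_at (y - x) (snd i) *\<^sub>R (case i of (n, \<alpha>) \<Rightarrow> a n \<alpha>)) has_sum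
        (1 / (1 - h y))) (UNIV \<times> multi_indices)"
    proof (rule has_sum_SigmaI[rotated])
      show "(\<lambda>i. monomial_at (y - x) (snd i) *\<^sub>R (case i of (n, \<alpha>) \<Rightarrow> a n \<alpha>)) summable_on
          (UNIV \<times> multi_indices)"
        by (rule abs_summable_summable, rule summable_on_comparison_test[OF sm])
          (use abs_monomial_at_le[OF y] in \<open>auto intro: mult_right_mono\<close>)
    qed (use f[OF y] in auto)
  qed (use \<rho> in \<open>auto simp: multi_indices_def\<close>)
qed

section \<open>Algebra of functions that have a power series expansion at a point\<close>

definition expandable ::
  "('a::euclidean_space \<Rightarrow> 'b::{real_normed_field,banach}) \<Rightarrow> 'a \<Rightarrow> bool" where
  "expandable f x \<longleftrightarrow> (\<exists>\<rho> N. expansion f x \<rho> N)"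

lemma expandable_imp_real_analytic_at: "expandable f x \<Longrightarrow> real_analytic_at f x"
  using expansion_imp_real_analytic_at unfolding expandable_def by blast

lemma expandable_common_radius:
  assumes "expandable f x" "expandable g x"
  obtains \<rho> N N' where "expansion f x \<rho> N" "expansion g x \<rho> N'"
proof -
  obtain r s N N' where f: "expansion f x r N" and g: "expansion g x s N'"
    using assms unfolding expandable_def by blast
  have rs: "r > 0" "s > 0" using f g by (auto simp: expansion_def)
  define \<rho> where "\<rho> = min r s"
  have "expansion f x (\<rho> / r * r) N" "expansion g x (\<rho> / s * s) N'"
    using rs by (auto intro!: expansion_shrink[OF f] expansion_shrink[OF g] simp del: times_divide_eq_left simp: \<rho>_def)
  then show ?thesis using rs that by simp
qed

lemma expandable_linear: "linear L \<Longrightarrow> expandable L x"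
  using expansion_affine[of L 0 x] unfolding expandable_def by auto

lemma expandable_const: "expandable (\<lambda>y. k) x"
  using expansion_affine[OF linear_zero, of k x] unfolding expandable_def by auto

lemma expandable_add: "\<lbrakk>expandable f x; expandable g x\<rbrakk> \<Longrightarrow> expandable (\<lambda>y. f y + g y) x"
  by (erule (1) expandable_common_radius) (auto simp: expandable_def dest: expansion_add)

lemma expandable_mult: "\<lbrakk>expandable f x; expandable g x\<rbrakk> \<Longrightarrow> expandable (\<lambda>y. f y * g y) x"
  by (erule (1) expandable_common_radius) (auto simp: expandable_def dest: expansion_mult)

lemma expandable_minus: "expandable f x \<Longrightarrow> expandable (\<lambda>y. - f y) x"
  using expandable_mult[OF expandable_const[of "-1" x], of f] by simp

lemma expandable_diff: "\<lbrakk>expandable f x; expandable g x\<rbrakk> \<Longrightarrow> expandable (\<lambda>y. f y - g y) x"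
  using expandable_add[OF _ expandable_minus, of f x g] by simp

text \<open>Write g = g(x) * (1 - h) with \<open>h\<close> vanishing at \<open>x\<close>. Shrinking
  the radius then makes the norm of \<open>h\<close> at most 1/2, and the geometric series gives the
  reciprocal.\<close>

lemma expandable_divide:
  assumes "expandable f x" "expandable g x" "g x \<noteq> 0"
  shows "expandable (\<lambda>y. f y / g y) x"
proof -
  let ?h = "\<lambda>y. 1 - (1 / g x) * g y"
  have "expandable ?h x"
    by (rule expandable_diff[OF expandable_const expandable_mult[OF expandable_const assms(2)]])
  then obtain \<rho> N where h: "expansion ?h x \<rho> N" unfolding expandable_def by blast
  have N: "N \<ge> 0"
    by (rule expansionE[OF h]) (force intro: order_trans[OF has_sum_nonneg])
  \<comment> \<open>The maximum with 1 keeps the scaling factor 1 / (2 * M) defined and at most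
    1.\<close>
  define M where "M = max N 1"
  have h': "expansion ?h x \<rho> M"
    using expansion_mono[OF h] by (simp add: M_def)
  have "expansion ?h x (1 / (2 * M) * \<rho>) (1 / (2 * M) * M)"
    by (rule expansion_shrink[OF h']) (use assms(3) in \<open>auto simp: M_def field_simps\<close>)
  then have "expansion ?h x (1 / (2 * M) * \<rho>) (1 / 2)"
    by (simp add: M_def)
  then have "expandable (\<lambda>y. 1 / (1 - ?h y)) x"
    using expansion_inverse_one_minus unfolding expandable_def by blast
  then have "expandable (\<lambda>y. f y * (1 / g x) * (1 / (1 - ?h y))) x"
    by (rule expandable_mult[OF expandable_mult[OF assms(1) expandable_const]])
  then show ?thesis using assms(3) by simp
qed

section \<open>Uniqueness of conformal parametrizations of the sphere\<close>

lemma holomorphic_zero_on_circle: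
  assumes "continuous_on (cball 0 1) f" "f holomorphic_on ball 0 1"
    and "\<And>z. cmod z = 1 \<Longrightarrow> f z = 0" and "cmod w \<le> 1"
  shows "f w = 0"
proof -
  have "cmod (f w) \<le> 0"
    by (rule maximum_modulus_frontier[of f "cball 0 1"]) (use assms in auto)
  then show ?thesis by simp
qed

lemma inner_complex_mult: "(k * v) \<bullet> (k * v') = (cmod k)\<^sup>2 * (v \<bullet> v')" for k v v' :: complex
  unfolding inner_complex_def cmod_power2 by (simp add: power2_eq_square algebra_simps)

text \<open>A conformal map is holomorphic or antiholomorphic; the second case is excluded because
  \<open>cnj (G w) * w\<close> would be holomorphic and equal to 1 on the circle, but 0 at the centre.\<close>

lemma conformal_disk_identity:
  assumes G: "\<And>w. cmod w \<le> 1 \<Longrightarrow> (G has_derivative G' w) (at w)"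
    and cont: "\<And>v. continuous_on (cball 0 1) (\<lambda>w. G' w v)"
    and conf: "\<And>w. cmod w \<le> 1 \<Longrightarrow> \<exists>\<nu>>0. \<forall>v v'. G' w v \<bullet> G' w v' = \<nu> * (v \<bullet> v')"
    and bd: "\<And>w. cmod w = 1 \<Longrightarrow> G w = w"
    and w: "cmod w \<le> 1"
  shows "G w = (w::complex)"
proof -
  define a where "a w = G' w 1" for w
  define b where "b w = G' w \<i>" for w
  \<comment> \<open>\<open>a\<close> and \<open>b\<close> are the columns of the Jacobian matrix of
    \<open>G\<close>, and \<open>d\<close> is its determinant.\<close>
  define d where "d w = Re (a w) * Im (b w) - Im (a w) * Re (b w)" for w
  have lin: "G' w v = Re v *\<^sub>R a w + Im v *\<^sub>R b w" if "cmod w \<le> 1" for w v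
  proof -
    interpret linear "G' w" using G[OF that] has_derivative_linear by blast
    have "v = Re v *\<^sub>R 1 + Im v *\<^sub>R \<i>" by (simp add: complex_eq_iff)
    then have "G' w v = G' w (Re v *\<^sub>R 1 + Im v *\<^sub>R \<i>)" by simp
    then show ?thesis unfolding a_def b_def by (simp only: add scale)
  qed
  have ab: "a w \<bullet> b w = 0 \<and> a w \<bullet> a w = b w \<bullet> b w \<and> a w \<bullet> a w > 0" if "cmod w \<le> 1" for w
    using conf[OF that] unfolding a_def b_def by (auto simp: inner_complex_def)
  have d2: "b w = \<i> * a w \<and> d w > 0 \<or> b w = - \<i> * a w \<and> d w < 0" if "cmod w \<le> 1" for w
  proof -
    obtain p q r s where pq: "a w = Complex p q" "b w = Complex r s"
      by (metis complex.exhaust)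
    have e: "p * r + q * s = 0" "p * p + q * q = r * r + s * s" "p * p + q * q > 0"
      using ab[OF that] by (auto simp: pq inner_complex_def)
    have "p * r = - (q * s)" using e(1) by simp
    then have k: "(p * r) * (p * r) = (q * s) * (q * s)" by simp
    \<comment> \<open>Multiplied by the squared length of \<open>a w\<close>, the differences r^2 -
      q^2 and s^2 - p^2 become combinations of the two relations in \<open>e\<close>. This fixes the
      entries of \<open>b w\<close> up to sign, and orthogonality then couples the two
      signs.\<close>
    have "(r + q) * (r - q) * (p * p + q * q) =
        (p * r) * (p * r) - (q * s) * (q * s) + q * q * ((r * r + s * s) - (p * p + q * q))"
      "(s - p) * (s + p) * (p * p + q * q) =
        (q * s) * (q * s) - (p * r) * (p * r) + p * p * ((r * r + s * s) - (p * p + q * q))"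
      by (simp_all add: algebra_simps)
    then have "(r + q) * (r - q) * (p * p + q * q) = 0" "(s - p) * (s + p) * (p * p + q * q) = 0"
      unfolding k e(2) by simp_all
    then have "(r + q) * (r - q) = 0" "(s - p) * (s + p) = 0" using e(3) by auto
    then have "(r = - q \<or> r = q) \<and> (s = p \<or> s = - p)" by auto
    then have "r = - q \<and> s = p \<or> r = q \<and> s = - p"
      using e by (auto simp: mult_eq_0_iff)
    then show ?thesis
      using e(3) by (auto simp: d_def pq complex_eq_iff)
  qed
  have contd: "continuous_on (cball 0 1) d"
    unfolding d_def a_def b_def by (intro continuous_intros cont)
  have conn: "is_interval (d ` cball 0 1)"
    by (simp add: is_interval_connected_1 connected_continuous_image[OF contd] convex_connected)
  \<comment> \<open>The determinant is continuous and never zero on the connected disk, so the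
    choice between holomorphic and antiholomorphic is global.\<close>
  have sign: "(\<forall>w\<in>cball 0 1. d w > 0) \<or> (\<forall>w\<in>cball 0 1. d w < 0)"
  proof (rule ccontr)
    assume "\<not> ?thesis"
    then obtain w1 w2 where "w1 \<in> cball 0 1" "w2 \<in> cball 0 1" "d w1 \<le> 0" "0 \<le> d w2"
      by (meson not_le)
    then have "0 \<in> d ` cball 0 1" using mem_is_interval_1_I[OF conn] by blast
    then show False using d2 by fastforce
  qed
  have contG: "continuous_on (cball 0 1) G"
    by (rule continuous_at_imp_continuous_on) (use G has_derivative_continuous in fastforce)
  from sign show ?thesis
  proof
    assume pos: "\<forall>w\<in>cball 0 1. d w > 0"
    have H: "(G has_field_derivative a w) (at w)" if "cmod w \<le> 1" for w
    proof -
      have "b w = \<i> * a w" using d2[OF that] bspec[OF pos, of w] that by auto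
      then have "G' w = (*) (a w)"
        using lin[OF that] by (auto simp: fun_eq_iff complex_eq_iff)
      then show ?thesis using G[OF that] by (simp add: has_field_derivative_def)
    qed
    have "G holomorphic_on ball 0 1"
      by (rule holomorphic_onI, rule field_differentiable_at_within)
        (use H in \<open>force simp: field_differentiable_def intro: less_imp_le\<close>)
    then have hol: "(\<lambda>w. G w - w) holomorphic_on ball 0 1"
      by (intro holomorphic_on_diff holomorphic_on_ident)
    have "continuous_on (cball 0 1) (\<lambda>w. G w - w)"
      by (intro continuous_on_diff contG continuous_on_id)
    from holomorphic_zero_on_circle[OF this hol _ w] have "G w - w = 0"
      by (simp add: bd)
    then show ?thesis by simp
  next
    assume neg: "\<forall>w\<in>cball 0 1. d w < 0"
    have H: "((\<lambda>w. cnj (G w)) has_field_derivative cnj (a w)) (at w)" if "cmod w \<le> 1" for w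
    proof -
      have "b w = - \<i> * a w" using d2[OF that] bspec[OF neg, of w] that by auto
      then have "(\<lambda>v. cnj (G' w v)) = (*) (cnj (a w))"
        using lin[OF that] by (auto simp: fun_eq_iff complex_eq_iff)
      then show ?thesis
        using has_derivative_cnj[OF G[OF that]] by (simp add: has_field_derivative_def)
    qed
    have "(\<lambda>w. cnj (G w)) holomorphic_on ball 0 1"
      by (rule holomorphic_onI, rule field_differentiable_at_within)
        (use H in \<open>force simp: field_differentiable_def intro: less_imp_le\<close>)
    then have hol: "(\<lambda>w. cnj (G w) * w - 1) holomorphic_on ball 0 1"
      by (intro holomorphic_on_diff holomorphic_on_mult holomorphic_on_ident holomorphic_on_const)
    have "continuous_on (cball 0 1) (\<lambda>w. cnj (G w) * w - 1)"
      by (intro continuous_on_diff continuous_on_mult continuous_on_cnj contG continuous_on_id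
          continuous_on_const)
    from holomorphic_zero_on_circle[OF this hol, of 0] have "cnj (G 0) * 0 - 1 = 0"
      by (simp add: bd complex_norm_square[symmetric] mult.commute[of "cnj _"])
    then show ?thesis by simp
  qed
qed

section \<open>Transition maps between conformal parametrizations\<close>

lemma sphere_param_eq_Some_iff:
  "sphere_param b u = Some w \<longleftrightarrow> (if b then u = w else w \<noteq> 0 \<and> u = inverse w)"
  by (auto simp: sphere_param_def sphere_frac_def divide_inverse)

abbreviation conformal_chart ::
  "('a::euclidean_space \<Rightarrow> 'a \<Rightarrow> real) \<Rightarrow> 'a set \<Rightarrow> ('a \<Rightarrow> riemann_sphere) \<Rightarrow> 'a \<Rightarrow> 'a set \<Rightarrow> ('a \<Rightarrow> complex) \<Rightarrow> bool" where
  "conformal_chart g M f Z U F \<equiv> local_expr M f Z U F \<and> smooth_on U F \<and>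
     (\<exists>\<mu>>0. \<forall>W W'. g Z W = 0 \<and> g Z W' = 0 \<longrightarrow>
        differential F Z W \<bullet> differential F Z W' = \<mu> * g W W')"

lemma conformal_diffeo_localE:
  assumes "conformal_diffeo_to_sphere g f" "g Z Z = 1"
  obtains U b F \<mu> where "open U" "Z \<in> U" "\<And>q. \<lbrakk>g q q = 1; q \<in> U\<rbrakk> \<Longrightarrow> f q = sphere_param b (F q)"
    "smooth_on U F" "\<mu> > 0"
    "\<And>W W'. \<lbrakk>g Z W = 0; g Z W' = 0\<rbrakk> \<Longrightarrow>
       differential F Z W \<bullet> differential F Z W' = \<mu> * g W W'"
proof -
  have "\<exists>U F. conformal_chart g {Z. g Z Z = 1} f Z U F"
    using assms by (simp add: conformal_diffeo_to_sphere_def)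
  then obtain U F \<mu> where l: "local_expr {Z. g Z Z = 1} f Z U F" and F: "smooth_on U F" "\<mu> > 0"
    "\<And>W W'. \<lbrakk>g Z W = 0; g Z W' = 0\<rbrakk> \<Longrightarrow>
       differential F Z W \<bullet> differential F Z W' = \<mu> * g W W'"
    by blast
  from l obtain b where "open U" "Z \<in> U" "\<And>q. \<lbrakk>g q q = 1; q \<in> U\<rbrakk> \<Longrightarrow> f q = sphere_param b (F q)"
    by (auto simp: local_expr_def)
  then show ?thesis using F by (rule that)
qed

text \<open>\<open>G\<close> is the transition map from \<open>f1\<close> to \<open>f2\<close> in
  the affine chart. The inverse \<open>R\<close> of \<open>f1\<close> takes values in the unit
  sphere, so its derivative is tangent; it scales inner products because a local extension of
  \<open>f1\<close> composed with \<open>R\<close> is the identity or the inversion. Following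
  \<open>R\<close> by a local extension of \<open>f2\<close> scales them again. The factors are
  obtained at \<open>w0\<close> only, as the definition controls a local extension only at its own
  base point.\<close>

lemma conformal_transition:
  fixes g :: "'a::euclidean_space \<Rightarrow> 'a \<Rightarrow> real"
  assumes g: "bounded_bilinear g" and sym: "\<And>x y. g x y = g y x"
    and f1: "conformal_diffeo_to_sphere g f1" and f2: "conformal_diffeo_to_sphere g f2"
  defines "R \<equiv> \<lambda>w. inv_into {Z. g Z Z = 1} f1 (Some w)"
  defines "G \<equiv> \<lambda>w. the (f2 (R w))"
  assumes w0: "f2 (R w0) \<noteq> None"
  shows "G differentiable (at w0)"
    and "isCont (\<lambda>w. differential G w v) w0"
    and "\<exists>\<nu>>0. \<forall>v v'. differential G w0 v \<bullet> differential G w0 v' = \<nu> * (v \<bullet> v')"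
proof -
  interpret g: bounded_bilinear g by (rule g)
  let ?M = "{Z. g Z Z = 1}"
  have bij1: "bij_betw f1 ?M UNIV" using f1 by (simp add: conformal_diffeo_to_sphere_def)
  have RM: "g (R w) (R w) = 1" for w
    using bij_betw_inv_into[OF bij1] unfolding R_def bij_betw_def by blast
  have f1R: "f1 (R w) = Some w" for w
    unfolding R_def using bij_betw_inv_into_right[OF bij1] by simp
  have "smooth_on UNIV (\<lambda>w. inv_into ?M f1 (sphere_param True w))"
    using f1 by (simp add: conformal_diffeo_to_sphere_def)
  then have Rs: "smooth_on UNIV R" by (simp add: R_def sphere_param_def)
  define R' where "R' w = differential R w" for w
  have R': "(R has_derivative R' w) (at w)" for w
    using smooth_on_has_derivative[OF Rs] by (simp add: R'_def)
  have R'c: "continuous_on S (\<lambda>w. R' w v)" for S v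
    using smooth_on_continuous_derivative[OF Rs] continuous_on_subset unfolding R'_def by blast
  have Rc: "continuous_on S R" for S
    using smooth_on_continuous_on[OF Rs] continuous_on_subset by blast
  \<comment> \<open>Differentiate the constant function \<open>g (R w) (R w)\<close>.\<close>
  have tang: "g (R w) (R' w v) = 0" for w v
  proof -
    have "((\<lambda>w. g (R w) (R w)) has_derivative (\<lambda>v. g (R w) (R' w v) + g (R' w v) (R w))) (at w)"
      by (rule g.FDERIV[OF R' R'])
    moreover have "((\<lambda>w. g (R w) (R w)) has_derivative (\<lambda>v. 0)) (at w)"
      by (simp add: RM)
    ultimately have "(\<lambda>v. g (R w) (R' w v) + g (R' w v) (R w)) = (\<lambda>v. 0)"
      by (rule has_derivative_unique)
    then show ?thesis using sym by (metis add_cancel_right_right double_zero)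
  qed
  have R'conf: "\<exists>l>0. \<forall>v v'. g (R' w0 v) (R' w0 v') = l * (v \<bullet> v')"
  proof -
    obtain U b F \<mu> where U: "open U" "R w0 \<in> U" and b: "\<And>q. \<lbrakk>g q q = 1; q \<in> U\<rbrakk> \<Longrightarrow> f1 q = sphere_param b (F q)"
      and F: "smooth_on U F" and \<mu>: "\<mu> > 0" and conf: "\<And>W W'. \<lbrakk>g (R w0) W = 0; g (R w0) W' = 0\<rbrakk> \<Longrightarrow>
           differential F (R w0) W \<bullet> differential F (R w0) W' = \<mu> * g W W'"
      by (rule conformal_diffeo_localE[OF f1 RM[of w0]]) (rule that)
    let ?F' = "differential F (R w0)"
    have comp: "((\<lambda>w. F (R w)) has_derivative (\<lambda>v. ?F' (R' w0 v))) (at w0)"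
      using diff_chain_at[OF R' smooth_on_has_derivative[OF F U(2)]] by (simp add: o_def)
    have V: "open (R -` U)" using Rc[of UNIV] U(1) by (simp add: continuous_on_open_vimage)
    have eq: "Some w = sphere_param b (F (R w))" if "w \<in> R -` U" for w
      using b[of "R w"] RM f1R that by simp
    \<comment> \<open>According to the chart, \<open>F (R w)\<close> is \<open>w\<close> or its
      reciprocal near \<open>w0\<close>; in both cases the derivative is multiplication by a nonzero
      complex number.\<close>
    obtain k where k: "k \<noteq> 0" and Fk: "?F' (R' w0 v) = k * v" for v
    proof (cases b)
      case True
      then have FR: "F (R w) = w" if "w \<in> R -` U" for w
        using eq[OF that] by (simp add: sphere_param_def)
      have "((\<lambda>w. F (R w)) has_derivative (\<lambda>v. v)) (at w0)"
        using has_derivative_transform_within_open[OF has_derivative_ident V _ FR[symmetric]] U(2) by simp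
      from has_derivative_unique[OF comp this] show ?thesis
        using that[of 1] by (simp add: fun_eq_iff)
    next
      case False
      have nz: "w \<noteq> 0 \<and> F (R w) = inverse w" if "w \<in> R -` U" for w
        using eq[OF that, symmetric] False by (simp add: sphere_param_eq_Some_iff)
      then have w0: "w0 \<noteq> 0" using U(2) by blast
      have "((\<lambda>w. F (R w)) has_derivative (\<lambda>v. - (inverse w0 * v * inverse w0))) (at w0)"
        using has_derivative_transform_within_open[OF
            Deriv.has_derivative_inverse[OF w0 has_derivative_ident] V, of "\<lambda>w. F (R w)"] U(2) nz by simp
      from has_derivative_unique[OF comp this] show ?thesis
        using that[of "- (inverse w0 * inverse w0)"] w0 by (simp add: fun_eq_iff)
    qed
    have "g (R' w0 v) (R' w0 v') = ((cmod k)\<^sup>2 / \<mu>) * (v \<bullet> v')" for v v'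
      using conf[OF tang tang, of v v'] \<mu> by (simp add: Fk inner_complex_mult field_simps)
    then show ?thesis using k \<mu> by (intro exI[of _ "(cmod k)\<^sup>2 / \<mu>"]) auto
  qed
  obtain U b F \<mu> where U: "open U" "R w0 \<in> U" and b: "\<And>q. \<lbrakk>g q q = 1; q \<in> U\<rbrakk> \<Longrightarrow> f2 q = sphere_param b (F q)"
    and F: "smooth_on U F" and \<mu>: "\<mu> > 0" and conf: "\<And>W W'. \<lbrakk>g (R w0) W = 0; g (R w0) W' = 0\<rbrakk> \<Longrightarrow>
         differential F (R w0) W \<bullet> differential F (R w0) W' = \<mu> * g W W'"
    by (rule conformal_diffeo_localE[OF f2 RM[of w0]]) (rule that)
  let ?F' = "\<lambda>w. differential F (R w)"
  have comp: "((\<lambda>w. F (R w)) has_derivative (\<lambda>v. ?F' w (R' w v))) (at w)" if "w \<in> R -` U" for w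
    using diff_chain_at[OF R' smooth_on_has_derivative[OF F]] that by (simp add: o_def)
  have openV0: "open (R -` U)" using Rc[of UNIV] U(1) by (simp add: continuous_on_open_vimage)
  have FRc: "continuous_on (R -` U) (\<lambda>w. F (R w))"
    by (rule continuous_on_compose2[OF smooth_on_continuous_on[OF F] Rc]) auto
  have compc: "continuous_on (R -` U) (\<lambda>w. ?F' w (R' w v))" for v
  proof -
    \<comment> \<open>Smoothness gives continuity of the derivative along fixed vectors only, so the
      moving vector \<open>R' w v\<close> is expanded in the basis.\<close>
    have eq: "?F' w (R' w v) = (\<Sum>e\<in>Basis. (R' w v \<bullet> e) *\<^sub>R ?F' w e)" if "w \<in> R -` U" for w
    proof -
      have lin: "linear (?F' w)"
        using smooth_on_has_derivative[OF F] that has_derivative_linear by blast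
      show ?thesis
        using linear_sum[OF lin, of "\<lambda>e. (R' w v \<bullet> e) *\<^sub>R e" Basis]
        by (simp add: euclidean_representation linear_scale[OF lin])
    qed
    have c: "continuous_on (R -` U) (\<lambda>w. \<Sum>e\<in>Basis. (R' w v \<bullet> e) *\<^sub>R ?F' w e)"
      by (intro continuous_intros R'c continuous_on_compose2[OF smooth_on_continuous_derivative[OF F] Rc]) auto
    show ?thesis by (rule continuous_on_eq[OF c]) (rule eq[symmetric])
  qed
  have f2R: "f2 (R w) = sphere_param b (F (R w))" if "w \<in> R -` U" for w
    using b[of "R w"] RM that by simp
  obtain V D k where V: "open V" "w0 \<in> V" and D: "\<And>w. w \<in> V \<Longrightarrow> (G has_derivative D w) (at w)"
    and Dc: "\<And>v. continuous_on V (\<lambda>w. D w v)" and k: "k \<noteq> 0" "\<And>v. D w0 v = k * ?F' w0 (R' w0 v)"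
  proof (cases b)
    case True
    have G: "F (R w) = G w" if "w \<in> R -` U" for w
      using f2R[OF that] True by (simp add: G_def sphere_param_def)
    show ?thesis
    proof (rule that[of "R -` U" "\<lambda>w v. ?F' w (R' w v)" 1])
      show "(G has_derivative (\<lambda>v. ?F' w (R' w v))) (at w)" if "w \<in> R -` U" for w
        by (rule has_derivative_transform_within_open[OF comp[OF that] openV0 that G])
    qed (use compc U(2) openV0 in auto)
  next
    case False
    \<comment> \<open>In the chart at infinity the affine value is the reciprocal of
      \<open>F (R w)\<close>; it is finite at \<open>w0\<close> by assumption, hence on the open set
      \<open>V\<close>.\<close>
    define V where "V = {w \<in> R -` U. F (R w) \<noteq> 0}"
    have VU: "V \<subseteq> R -` U" by (auto simp: V_def)
    have "V = (R -` U) \<inter> (\<lambda>w. F (R w)) -` (- {0})" by (auto simp: V_def)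
    then have openV: "open V"
      using continuous_open_preimage[OF FRc openV0, of "- {0}"] by auto
    have G: "inverse (F (R w)) = G w" if "w \<in> V" for w
      using f2R[of w] that False by (simp add: V_def G_def sphere_param_def sphere_frac_def divide_inverse)
    have w0V: "w0 \<in> V"
      using f2R[of w0] U(2) w0 False by (auto simp: V_def sphere_param_def sphere_frac_def split: if_splits)
    have FRcV: "continuous_on V (\<lambda>w. F (R w))" "continuous_on V (\<lambda>w. ?F' w (R' w v))" for v
      using FRc compc VU by (meson continuous_on_subset)+
    let ?D = "\<lambda>w v. - (inverse (F (R w)) * ?F' w (R' w v) * inverse (F (R w)))"
    show ?thesis
    proof (rule that[of V ?D "- (inverse (F (R w0)) * inverse (F (R w0)))"])
      show "(G has_derivative ?D w) (at w)" if "w \<in> V" for w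
      proof (rule has_derivative_transform_within_open[OF _ openV that G])
        show "((\<lambda>w. inverse (F (R w))) has_derivative ?D w) (at w)"
          by (rule Deriv.has_derivative_inverse[OF _ comp]) (use that in \<open>auto simp: V_def\<close>)
      qed
      show "continuous_on V (\<lambda>w. ?D w v)" for v
        by (intro continuous_intros FRcV) (auto simp: V_def)
      show "- (inverse (F (R w0)) * inverse (F (R w0))) \<noteq> 0" using w0V by (simp add: V_def)
    qed (use openV w0V in \<open>auto simp: mult_ac\<close>)
  qed
  have GD: "differential G w = D w" if "w \<in> V" for w
    using frechet_derivative_at[OF D[OF that]] by simp
  show "G differentiable (at w0)" using D[OF V(2)] by (auto simp: differentiable_def)
  have "isCont (\<lambda>w. D w v) w0" using Dc V continuous_on_eq_continuous_at by blast
  moreover have "\<forall>\<^sub>F w in nhds w0. differential G w v = D w v"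
    using V GD by (auto simp: eventually_nhds)
  ultimately show "isCont (\<lambda>w. differential G w v) w0"
    using isCont_cong[of "\<lambda>w. differential G w v" "\<lambda>w. D w v" w0] by simp
  obtain l where l: "l > 0" "\<And>v v'. g (R' w0 v) (R' w0 v') = l * (v \<bullet> v')" using R'conf by blast
  have "D w0 v \<bullet> D w0 v' = ((cmod k)\<^sup>2 * \<mu> * l) * (v \<bullet> v')" for v v'
    using conf[OF tang tang, of v v'] by (simp add: k inner_complex_mult l)
  then show "\<exists>\<nu>>0. \<forall>v v'. differential G w0 v \<bullet> differential G w0 v' = \<nu> * (v \<bullet> v')"
    using k(1) \<mu> l(1) GD[OF V(2)] by (intro exI[of _ "(cmod k)\<^sup>2 * \<mu> * l"]) auto
qed

text \<open>In the affine chart of \<open>f1\<close> the closed northern hemisphere is the closed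
  unit disk. The assumption on the north keeps \<open>f2\<close> finite there, the one on the
  equator makes the transition map the identity on the circle, and
  \<open>conformal_disk_identity\<close> applies.\<close>

lemma conformal_diffeo_eq_on_closed_north:
  assumes g: "bounded_bilinear g" and sym: "\<And>x y. g x y = g y x"
    and f1: "conformal_diffeo_to_sphere g f1" and f2: "conformal_diffeo_to_sphere g f2"
    and eq: "\<And>Z. \<lbrakk>g Z Z = 1; f1 Z \<in> equator\<rbrakk> \<Longrightarrow> f2 Z = f1 Z"
    and north: "\<And>Z. \<lbrakk>g Z Z = 1; f1 Z \<in> north\<rbrakk> \<Longrightarrow> f2 Z \<in> north"
    and Z: "g Z Z = 1" "f1 Z \<in> equator \<union> north"
  shows "f2 Z = f1 Z"
proof -
  let ?M = "{Z. g Z Z = 1}"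
  define R where "R = (\<lambda>w. inv_into ?M f1 (Some w))"
  define G where "G = (\<lambda>w. the (f2 (R w)))"
  have bij1: "bij_betw f1 ?M UNIV" using f1 by (simp add: conformal_diffeo_to_sphere_def)
  have RM: "g (R w) (R w) = 1" for w
    using bij_betw_inv_into[OF bij1] unfolding R_def bij_betw_def by blast
  have f1R: "f1 (R w) = Some w" for w
    unfolding R_def using bij_betw_inv_into_right[OF bij1] by simp
  have f2e: "f2 (R w) = Some w" if "cmod w = 1" for w
    using eq[OF RM, of w] that by (auto simp: f1R equator_def)
  have f2n: "f2 (R w) \<noteq> None" if "cmod w \<le> 1" for w
    using f2e[of w] north[OF RM, of w] that by (cases "cmod w = 1") (auto simp: f1R north_def)
  have T: "G differentiable (at w)" "isCont (\<lambda>w. differential G w v) w"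
    "\<exists>\<nu>>0. \<forall>v v'. differential G w v \<bullet> differential G w v' = \<nu> * (v \<bullet> v')"
    if "cmod w \<le> 1" for w v
    using conformal_transition[OF g sym f1 f2, of w] f2n[OF that] unfolding R_def G_def by blast+
  have Gw: "G w = w" if "cmod w \<le> 1" for w
  proof (rule conformal_disk_identity[of G "\<lambda>w. differential G w", OF _ _ _ _ that])
    show "continuous_on (cball 0 1) (\<lambda>w. differential G w v)" for v
      by (rule continuous_at_imp_continuous_on) (use T(2) in auto)
  qed (use T(1,3) f2e in \<open>auto simp: frechet_derivative_works G_def\<close>)
  obtain w where w: "f1 Z = Some w" "cmod w \<le> 1"
    using Z(2) by (auto simp: equator_def north_def)
  have "R w = Z" using w(1) bij_betw_inv_into_left[OF bij1, of Z] Z(1) by (simp add: R_def)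
  then have "f2 Z = Some (G w)" using f2n[OF w(2)] by (auto simp: G_def)
  then show ?thesis using Gw w by simp
qed

text \<open>The map z -> 1 / z. It exchanges the hemispheres and maps the equator to itself, so the
  southern hemisphere can be treated as a northern one.\<close>

fun sphere_inversion :: "riemann_sphere \<Rightarrow> riemann_sphere" where
  "sphere_inversion None = Some 0"
| "sphere_inversion (Some z) = sphere_frac 1 z"

lemma sphere_inversion_inversion [simp]: "sphere_inversion (sphere_inversion p) = p"
  by (cases p) (auto simp: sphere_frac_def)

lemma sphere_inversion_param: "sphere_inversion (sphere_param b w) = sphere_param (\<not> b) w"
  by (auto simp: sphere_param_def sphere_frac_def)

lemma sphere_inversion_south: "p \<in> south \<longleftrightarrow> sphere_inversion p \<in> north"
  by (cases p) (auto simp: south_def north_def sphere_frac_def norm_divide image_iff)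

lemma sphere_inversion_equator: "p \<in> equator \<longleftrightarrow> sphere_inversion p \<in> equator"
  by (cases p) (auto simp: equator_def sphere_frac_def norm_divide image_iff)

text \<open>Inversion only exchanges the two charts, so every local extension serves unchanged with
  the other chart.\<close>

lemma conformal_diffeo_sphere_inversion:
  assumes "conformal_diffeo_to_sphere g f"
  shows "conformal_diffeo_to_sphere g (\<lambda>Z. sphere_inversion (f Z))"
proof -
  let ?M = "{Z. g Z Z = 1}" and ?h = "\<lambda>Z. sphere_inversion (f Z)"
  have bij: "bij_betw f ?M UNIV" using assms by (simp add: conformal_diffeo_to_sphere_def)
  have "bij sphere_inversion" by (rule involuntory_imp_bij) simp
  then have bijh: "bij_betw ?h ?M UNIV" using bij_betw_trans[OF bij] by (simp add: o_def)
  have inv: "inv_into ?M ?h p = inv_into ?M f (sphere_inversion p)" for p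
  proof (rule inv_into_f_eq)
    show "inj_on ?h ?M" using bijh by (simp add: bij_betw_def)
    show "inv_into ?M f (sphere_inversion p) \<in> ?M"
      using bij_betw_inv_into[OF bij] unfolding bij_betw_def by blast
    show "?h (inv_into ?M f (sphere_inversion p)) = p"
      using bij_betw_inv_into_right[OF bij] by simp
  qed
  have loc: "local_expr ?M ?h Z U F" if "local_expr ?M f Z U F" for Z U F
  proof -
    from that obtain b where "open U" "Z \<in> U" "\<And>q. q \<in> ?M \<inter> U \<Longrightarrow> f q = sphere_param b (F q)"
      unfolding local_expr_def by blast
    then show ?thesis unfolding local_expr_def by (auto simp: sphere_inversion_param)
  qed
  have f: "\<forall>Z. g Z Z = 1 \<longrightarrow> (\<exists>U F. conformal_chart g ?M f Z U F)"
    and sm: "\<forall>b. smooth_on UNIV (\<lambda>w. inv_into ?M f (sphere_param b w))"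
    using assms by (simp_all add: conformal_diffeo_to_sphere_def)
  show ?thesis
    unfolding conformal_diffeo_to_sphere_def
  proof (intro conjI allI impI)
    fix Z assume "g Z Z = 1"
    with f obtain U F where "local_expr ?M f Z U F" "smooth_on U F"
      "\<exists>\<mu>>0. \<forall>W W'. g Z W = 0 \<and> g Z W' = 0 \<longrightarrow>
           differential F Z W \<bullet> differential F Z W' = \<mu> * g W W'"
      by blast
    then show "\<exists>U F. conformal_chart g ?M ?h Z U F"
      by (intro exI[of _ U] exI[of _ F] conjI loc)
  next
    show "smooth_on UNIV (\<lambda>w. inv_into ?M ?h (sphere_param b w))" for b
      using sm by (simp add: inv sphere_inversion_param)
  qed (rule bijh)
qed

theorem conformal_diffeo_to_sphere_unique:
  assumes g: "bounded_bilinear g" and sym: "\<And>x y. g x y = g y x"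
    and f1: "conformal_diffeo_to_sphere g f1" and f2: "conformal_diffeo_to_sphere g f2"
    and eq: "\<And>Z. \<lbrakk>g Z Z = 1; f1 Z \<in> equator\<rbrakk> \<Longrightarrow> f2 Z = f1 Z"
    and north: "\<And>Z. \<lbrakk>g Z Z = 1; f1 Z \<in> north\<rbrakk> \<Longrightarrow> f2 Z \<in> north"
    and south: "\<And>Z. \<lbrakk>g Z Z = 1; f1 Z \<in> south\<rbrakk> \<Longrightarrow> f2 Z \<in> south"
    and Z: "g Z Z = 1"
  shows "f2 Z = f1 Z"
proof (cases "f1 Z \<in> south")
  case False
  then have "f1 Z \<in> equator \<union> north"
    by (cases "f1 Z") (auto simp: equator_def north_def south_def image_iff)
  then show ?thesis
    using conformal_diffeo_eq_on_closed_north[OF g sym f1 f2 eq north Z] by blast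
next
  case True
  have "sphere_inversion (f2 Z) = sphere_inversion (f1 Z)"
    by (rule conformal_diffeo_eq_on_closed_north[OF g sym
          conformal_diffeo_sphere_inversion[OF f1] conformal_diffeo_sphere_inversion[OF f2]])
      (use eq south Z True in \<open>auto simp flip: sphere_inversion_equator sphere_inversion_south\<close>)
  then show ?thesis by (metis sphere_inversion_inversion)
qed

section \<open>Degrees on the two-sphere and the compact-open topology\<close>

text \<open>The fibre coordinate comes first because the reflection of known degree in the library is the
  one that negates coordinate 0.\<close>

definition pt_of_coords :: "(nat \<Rightarrow> real) \<Rightarrow> pt" where
  "pt_of_coords x = (Complex (x 1) (x 2), x 0)"

definition coords_of_pt :: "pt \<Rightarrow> nat \<Rightarrow> real" where
  "coords_of_pt p i = (if i = 0 then snd p else if i = 1 then Re (fst p)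
     else if i = 2 then Im (fst p) else 0)"

text \<open>The degree of v -> h v / |h v| on the unit sphere of three-space, transported to the
  coordinate model \<open>nsphere 2\<close>. It carries meaning when \<open>h\<close> is continuous
  without zeros on that sphere.\<close>

definition sphere_degree :: "(pt \<Rightarrow> pt) \<Rightarrow> int" where
  "sphere_degree h = Brouwer_degree2 2 (\<lambda>x. coords_of_pt (sgn (h (pt_of_coords x))))"

definition coord_sphere :: "(nat \<Rightarrow> real) set" where
  "coord_sphere = {x. (\<Sum>i\<le>2. x i ^ 2) = 1 \<and> (\<forall>i>2. x i = 0)}"

lemma nsphere_2: "nsphere 2 = top_of_set coord_sphere"
  unfolding nsphere coord_sphere_def euclidean_product_topology[symmetric] by simp

lemma sum_le_2: "(\<Sum>i\<le>(2::nat). f i) = f 0 + f 1 + (f 2 :: real)"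
  by (simp add: numeral_2_eq_2)

lemma coords_of_pt_pt_of_coords: "x \<in> coord_sphere \<Longrightarrow> coords_of_pt (pt_of_coords x) = x"
  by (auto simp: pt_of_coords_def coords_of_pt_def coord_sphere_def fun_eq_iff)

lemma norm_pt_of_coords: "x \<in> coord_sphere \<Longrightarrow> norm (pt_of_coords x) = 1"
  by (simp add: pt_of_coords_def coord_sphere_def norm_prod_def sum_le_2 cmod_power2)

lemma coords_of_pt_sphere: "norm p = 1 \<Longrightarrow> coords_of_pt p \<in> coord_sphere"
  by (cases p) (auto simp: coords_of_pt_def coord_sphere_def norm_prod_def sum_le_2 cmod_power2
      real_sqrt_eq_1_iff)

lemma continuous_on_pt_of_coords: "continuous_on S pt_of_coords"
  unfolding pt_of_coords_def complex_eq
  by (intro continuous_intros continuous_on_product_coordinates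
      continuous_on_subset[OF continuous_on_product_coordinates]) auto

lemma continuous_on_coords_of_pt:
  assumes "continuous_on S h"
  shows "continuous_on S (\<lambda>x. coords_of_pt (h x))"
proof (rule continuous_on_coordinatewise_then_product)
  show "continuous_on S (\<lambda>x. coords_of_pt (h x) i)" for i
    unfolding coords_of_pt_def
    by (cases "i = 0"; cases "i = 1"; cases "i = 2"; simp add: assms continuous_on_fst continuous_on_snd
        continuous_on_Re continuous_on_Im)
qed

lemma sphere_degree_homotopy:
  fixes H :: "real \<Rightarrow> pt \<Rightarrow> pt"
  assumes cont: "continuous_on ({0..1} \<times> sphere 0 1) (\<lambda>(s, v). H s v)"
    and nz: "\<And>s v. \<lbrakk>0 \<le> s; s \<le> 1; norm v = 1\<rbrakk> \<Longrightarrow> H s v \<noteq> 0"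
  shows "sphere_degree (H 0) = sphere_degree (H 1)"
  unfolding sphere_degree_def
proof (rule Brouwer_degree2_homotopic)
  let ?h = "\<lambda>(s, x). coords_of_pt (sgn (H s (pt_of_coords x)))"
  have nz': "H s (pt_of_coords x) \<noteq> 0" if "0 \<le> s" "s \<le> 1" "x \<in> coord_sphere" for s x
    using nz norm_pt_of_coords that by blast
  have maps: "(\<lambda>(s, x). (s, pt_of_coords x)) ` ({0..1} \<times> coord_sphere) \<subseteq> {0..1} \<times> sphere 0 1"
    by (auto simp: norm_pt_of_coords)
  have c1: "continuous_on ({0..1} \<times> coord_sphere) (\<lambda>(s::real, x). (s, pt_of_coords x))"
    unfolding case_prod_unfold
    by (intro continuous_intros continuous_on_compose2[OF continuous_on_pt_of_coords[of UNIV]]) auto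
  have "continuous_on ({0..1} \<times> coord_sphere) ((\<lambda>(s, v). H s v) \<circ> (\<lambda>(s, x). (s, pt_of_coords x)))"
    by (rule continuous_on_compose[OF c1 continuous_on_subset[OF cont maps]])
  then have c2: "continuous_on ({0..1} \<times> coord_sphere) (\<lambda>p. H (fst p) (pt_of_coords (snd p)))"
    by (simp add: o_def case_prod_unfold)
  have "continuous_on ({0..1} \<times> coord_sphere)
      (\<lambda>p. coords_of_pt (sgn (H (fst p) (pt_of_coords (snd p)))))"
    by (intro continuous_on_coords_of_pt continuous_on_sgn c2)
      (use nz' in auto)
  moreover have "?h ` ({0..1} \<times> coord_sphere) \<subseteq> coord_sphere"
    using nz' by (auto intro!: coords_of_pt_sphere simp: norm_sgn)
  ultimately have "continuous_map (prod_topology (top_of_set {0..1}) (nsphere 2)) (nsphere 2) ?h"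
    by (simp add: nsphere_2 prod_topology_subtopology_eu case_prod_unfold image_subset_iff_funcset)
  then show "homotopic_with (\<lambda>x. True) (nsphere 2) (nsphere 2)
     (\<lambda>x. coords_of_pt (sgn (H 0 (pt_of_coords x)))) (\<lambda>x. coords_of_pt (sgn (H 1 (pt_of_coords x))))"
    unfolding homotopic_with_def by (intro exI[of _ ?h]) auto
qed

lemma sphere_degree_scale: "r > 0 \<Longrightarrow> sphere_degree (\<lambda>v. r *\<^sub>R v) = 1"
proof -
  assume r: "r > 0"
  have "sphere_degree (\<lambda>v. r *\<^sub>R v) = Brouwer_degree2 2 id"
    unfolding sphere_degree_def using r
    by (intro Brouwer_degree2_eq)
      (simp add: nsphere_2 sgn_scaleR sgn_div_norm norm_pt_of_coords coords_of_pt_pt_of_coords)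
  then show ?thesis by simp
qed

lemma sphere_degree_reflection: "sphere_degree (\<lambda>v. (fst v, - snd v)) = -1"
proof -
  have "coords_of_pt (sgn (fst p, - snd p)) = (\<lambda>i. if i = 0 then - x i else x i)"
    if "x \<in> coord_sphere" and p: "p = pt_of_coords x" for x p
  proof -
    have "norm (fst p, - snd p) = 1"
      using norm_pt_of_coords[OF that(1)] by (simp add: p norm_prod_def)
    then have sgn: "sgn (fst p, - snd p) = (fst p, - snd p)" by (simp add: sgn_div_norm)
    show ?thesis
    proof
      fix i :: nat
      consider "i = 0" | "i = 1" | "i = 2" | "i > 2" by linarith
      then show "coords_of_pt (sgn (fst p, - snd p)) i = (if i = 0 then - x i else x i)"
        unfolding sgn using that(1)
        by cases (simp_all add: p coords_of_pt_def pt_of_coords_def coord_sphere_def)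
    qed
  qed
  then have "sphere_degree (\<lambda>v. (fst v, - snd v)) = Brouwer_degree2 2 (\<lambda>x i. if i = 0 then - x i else x i)"
    unfolding sphere_degree_def by (intro Brouwer_degree2_eq) (simp add: nsphere_2)
  then show ?thesis by (simp add: Brouwer_degree2_reflection)
qed

text \<open>\<open>N\<close> is deformed into the reflection of the fibre coordinate without meeting
  0. First the height is interpolated to \<open>- snd v\<close>: a zero could occur only where
  \<open>fst v = 0\<close>, that is at the poles, and there the sign assumptions exclude it. Then
  the factor \<open>k\<close> is contracted to the constant \<open>k 0\<close>, and finally this
  constant is moved to 1.\<close>

lemma sphere_degree_fibre_reversing:
  assumes N: "continuous_on (sphere 0 1) N"
    and k: "continuous_on (cball 0 1) k" "\<And>z. cmod z \<le> 1 \<Longrightarrow> k z \<noteq> 0"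
    and fst: "\<And>v. norm v = 1 \<Longrightarrow> fst (N v) = fst v * k (fst v)"
    and snd: "snd (N (0, 1)) < 0" "snd (N (0, -1)) > 0"
  shows "sphere_degree N = -1"
proof -
  have fst_le: "cmod (fst v) \<le> 1" if "norm v = 1" for v :: pt
    using norm_fst_le[of "fst v" "snd v"] that by simp
  have scale: "cmod (of_real a * fst v) \<le> 1" if "\<bar>a\<bar> \<le> 1" "norm v = 1" for a and v :: pt
    using mult_le_one[OF that(1) norm_ge_zero fst_le[OF that(2)]] by (simp add: norm_mult)
  have pole: "v = (0, 1) \<or> v = (0, -1)" if "norm v = 1" "fst v = 0" for v :: pt
    using that by (cases v) (auto simp: abs_if split: if_splits)
  have kc: "continuous_on ({0..1} \<times> sphere 0 1) (\<lambda>p :: real \<times> pt. k (of_real (g (fst p)) * fst (snd p)))"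
    if "continuous_on {0..1} g" "\<And>s. 0 \<le> s \<Longrightarrow> s \<le> 1 \<Longrightarrow> \<bar>g s\<bar> \<le> 1" for g :: "real \<Rightarrow> real"
  proof (rule continuous_on_compose2[OF k(1)])
    show "continuous_on ({0..1} \<times> sphere 0 1) (\<lambda>p :: real \<times> pt. of_real (g (fst p)) * fst (snd p))"
      by (intro continuous_intros continuous_on_compose2[OF that(1)]) auto
    show "(\<lambda>p :: real \<times> pt. of_real (g (fst p)) * fst (snd p)) ` ({0..1} \<times> sphere 0 1) \<subseteq> cball 0 1"
      using that(2) scale by auto
  qed
  have Nc: "continuous_on ({0..1} \<times> sphere 0 1) (\<lambda>p :: real \<times> pt. N (snd p))"
    by (rule continuous_on_compose2[OF N]) (auto intro!: continuous_intros)
  define H1 where "H1 s v = (fst v * k (fst v), (1 - s) * snd (N v) - s * snd v)" for s v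
  define H2 where "H2 s v = (fst v * k (of_real (1 - s) * fst v), - snd v)" for s :: real and v :: pt
  \<comment> \<open>The exponential of a multiple of the logarithm is a path from \<open>k 0\<close>
    to 1 that avoids 0.\<close>
  define H3 where "H3 s v = (fst v * exp (of_real (1 - s) * Ln (k 0)), - snd v)" for s :: real and v :: pt
  have "sphere_degree (H1 0) = sphere_degree (H1 1)"
  proof (rule sphere_degree_homotopy)
    show "continuous_on ({0..1} \<times> sphere 0 1) (\<lambda>(s, v). H1 s v)"
      unfolding H1_def case_prod_unfold
      using kc[of "\<lambda>s. 1"] by (intro continuous_intros Nc) auto
    fix s :: real and v :: pt assume s: "0 \<le> s" "s \<le> 1" and v: "norm v = 1"
    show "H1 s v \<noteq> 0"
    proof
      assume "H1 s v = 0"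
      then have "fst v = 0" and e: "(1 - s) * snd (N v) - s * snd v = 0"
        using k(2)[OF fst_le[OF v]] by (auto simp: H1_def zero_prod_def)
      from pole[OF v \<open>fst v = 0\<close>] show False
      proof
        assume v: "v = (0, 1)"
        have "(1 - s) * snd (N v) \<le> 0" using s snd(1) by (simp add: v mult_nonneg_nonpos)
        then have "s = 0" using e s by (simp add: v)
        then show False using e snd(1) by (simp add: v)
      next
        assume v: "v = (0, -1)"
        have "(1 - s) * snd (N v) \<ge> 0" using s snd(2) by (simp add: v)
        then have "s = 0" using e s by (simp add: v)
        then show False using e snd(2) by (simp add: v)
      qed
    qed
  qed
  moreover have "sphere_degree (H2 0) = sphere_degree (H2 1)"
  proof (rule sphere_degree_homotopy)
    show "continuous_on ({0..1} \<times> sphere 0 1) (\<lambda>(s, v). H2 s v)"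
      unfolding H2_def case_prod_unfold
      by (intro continuous_intros kc) auto
    fix s :: real and v :: pt assume s: "0 \<le> s" "s \<le> 1" and v: "norm v = 1"
    have "cmod (of_real (1 - s) * fst v) \<le> 1"
      using s v by (intro scale) auto
    then show "H2 s v \<noteq> 0"
      using k(2) v by (cases v) (auto simp: H2_def zero_prod_def)
  qed
  moreover have "sphere_degree (H3 0) = sphere_degree (H3 1)"
  proof (rule sphere_degree_homotopy)
    show "continuous_on ({0..1} \<times> sphere 0 1) (\<lambda>(s, v). H3 s v)"
      unfolding H3_def case_prod_unfold by (intro continuous_intros)
    fix s :: real and v :: pt assume "norm v = 1"
    then show "H3 s v \<noteq> 0" by (cases v) (auto simp: H3_def zero_prod_def)
  qed
  moreover have "H1 1 = H2 0" "H2 1 = H3 0" "H3 1 = (\<lambda>v. (fst v, - snd v))"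
    using k(2)[of 0] by (simp_all add: H1_def H2_def H3_def fun_eq_iff exp_Ln)
  moreover have "sphere_degree N = sphere_degree (H1 0)"
    unfolding sphere_degree_def
    by (intro Brouwer_degree2_eq)
      (simp add: nsphere_2 H1_def norm_pt_of_coords fst[symmetric])
  ultimately show ?thesis by (simp add: sphere_degree_reflection)
qed

text \<open>Compactness cuts \<open>K\<close> into finitely many compact pieces on which
  \<open>g\<close> stays within \<epsilon>/2 of a value; mapping each piece into the ball of radius
  \<epsilon>/2 around that value is one generating condition of the topology.\<close>

lemma openin_compact_open_nhd:
  fixes g :: "'a::metric_space \<Rightarrow> 'b::metric_space"
  assumes g: "g \<in> F" "continuous_on A g" and K: "compact K" "K \<subseteq> A" and e: "\<epsilon> > 0"
  obtains N where "openin (compact_open A F) N" "g \<in> N"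
    "\<And>f x. \<lbrakk>f \<in> N; x \<in> K\<rbrakk> \<Longrightarrow> dist (f x) (g x) < \<epsilon>" "N \<subseteq> F"
proof -
  have "\<exists>\<delta>>0. \<forall>x\<in>K. dist x p \<le> \<delta> \<longrightarrow> dist (g x) (g p) < \<epsilon> / 2" if "p \<in> K" for p
  proof -
    have "p \<in> A" "\<epsilon> / 2 > 0" using K(2) that e by auto
    then obtain d where "d > 0" "\<forall>x\<in>A. dist x p < d \<longrightarrow> dist (g x) (g p) < \<epsilon> / 2"
      using g(2)[unfolded continuous_on_iff] by blast
    \<comment> \<open>Half of \<open>d\<close> makes the bound valid on a closed ball, whose
      intersection with \<open>K\<close> is compact.\<close>
    then show ?thesis using K(2) by (intro exI[of _ "d / 2"]) force
  qed
  then have "\<forall>p\<in>K. \<exists>\<delta>. \<delta> > 0 \<and> (\<forall>x\<in>K. dist x p \<le> \<delta> \<longrightarrow> dist (g x) (g p) < \<epsilon> / 2)" by blast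
  from bchoice[OF this] obtain \<delta> where \<delta>: "\<And>p. p \<in> K \<Longrightarrow> \<delta> p > 0"
    "\<And>p x. \<lbrakk>p \<in> K; x \<in> K; dist x p \<le> \<delta> p\<rbrakk> \<Longrightarrow> dist (g x) (g p) < \<epsilon> / 2"
    by blast
  obtain C where C: "C \<subseteq> K" "finite C" "K \<subseteq> (\<Union>p\<in>C. ball p (\<delta> p))"
  proof (rule compactE_image[OF K(1), of K "\<lambda>p. ball p (\<delta> p)"])
    show "K \<subseteq> (\<Union>p\<in>K. ball p (\<delta> p))" using \<delta>(1) by fastforce
  qed auto
  define W where "W p = {f \<in> F. f ` (K \<inter> cball p (\<delta> p)) \<subseteq> ball (g p) (\<epsilon> / 2)}" for p
  have sub: "openin (compact_open A F) {f \<in> F. f ` L \<subseteq> U}" if "compact L" "L \<subseteq> A" "open U" for L U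
    unfolding compact_open_def by (rule topology_generated_by_Basis) (use that in blast)
  have W: "openin (compact_open A F) (W p)" for p
    unfolding W_def by (intro sub) (use K in \<open>auto intro: compact_Int_closed\<close>)
  have F: "openin (compact_open A F) F"
    using sub[of "{}" UNIV] by simp
  define N where "N = F \<inter> (\<Inter>p\<in>C. W p)"
  have "openin (compact_open A F) N"
  proof (cases "C = {}")
    case False
    then show ?thesis unfolding N_def using C(2) F W by (intro openin_Int openin_INT2) auto
  qed (use F in \<open>simp add: N_def\<close>)
  moreover have "g \<in> N"
    using g(1) C(1) \<delta>(2) by (fastforce simp: N_def W_def dist_commute)
  moreover have "dist (f x) (g x) < \<epsilon>" if fx: "f \<in> N" "x \<in> K" for f x
  proof -
    obtain p where p: "p \<in> C" "x \<in> ball p (\<delta> p)" using C(3) fx(2) by blast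
    then have "f x \<in> ball (g p) (\<epsilon> / 2)" using fx by (fastforce simp: N_def W_def)
    moreover have "dist (g x) (g p) < \<epsilon> / 2"
      using \<delta>(2)[of p x] p C(1) fx(2) by (auto simp: dist_commute)
    ultimately show ?thesis
      using dist_triangle[of "f x" "g x" "g p"] by (simp add: dist_commute)
  qed
  ultimately show ?thesis using that[of N] by (auto simp: N_def)
qed

lemma continuous_on_scaled_diff:
  fixes f :: "'a::real_normed_vector \<Rightarrow> 'b::real_normed_vector"
  assumes "continuous_on A f" "cball 0 r \<subseteq> A" "r \<ge> 0"
  shows "continuous_on (sphere 0 1) (\<lambda>v. f (r *\<^sub>R v) - f 0)"
  using assms(2,3)
  by (intro continuous_intros continuous_on_compose2[OF assms(1)]) auto

text \<open>The degree around \<open>0\<close> is a \<open>C\<^sup>0\<close> invariant: it is locally constant in the compact-open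
  topology, because uniformly close maps are joined by the straight-line homotopy.\<close>

lemma sphere_degree_compact_open_component:
  fixes F :: "(pt \<Rightarrow> pt) set"
  assumes F: "\<And>f. f \<in> F \<Longrightarrow> continuous_on A f" "\<And>f. f \<in> F \<Longrightarrow> inj_on f A"
    and r: "r > 0" "cball 0 r \<subseteq> A"
    and comp: "connected_component_of (compact_open A F) f1 f2"
  shows "sphere_degree (\<lambda>v. f1 (r *\<^sub>R v) - f1 0) = sphere_degree (\<lambda>v. f2 (r *\<^sub>R v) - f2 0)"
proof -
  let ?X = "compact_open A F" and ?n = "\<lambda>f v. f (r *\<^sub>R v) - f 0"
  have inA: "r *\<^sub>R v \<in> A" "0 \<in> A" if "norm v = 1" for v :: pt
    using r that by auto
  have nz: "?n f v \<noteq> 0" if "f \<in> F" "norm v = 1" for f v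
  proof -
    have "r *\<^sub>R v \<noteq> 0" using r(1) that(2) by auto
    then show ?thesis using F(2)[OF that(1)] inA[OF that(2)] by (auto dest: inj_onD)
  qed
  have nhd: "\<exists>N. openin ?X N \<and> g \<in> N \<and> N \<subseteq> F \<and> (\<forall>f\<in>N. sphere_degree (?n f) = sphere_degree (?n g))"
    if g: "g \<in> F" for g
  proof -
    have gc: "continuous_on (sphere 0 1) (?n g)"
      using continuous_on_scaled_diff[OF F(1)[OF g] r(2)] r(1) by simp
    obtain v0 :: pt where v0: "norm v0 = 1" "\<And>v. norm v = 1 \<Longrightarrow> norm (?n g v0) \<le> norm (?n g v)"
    proof -
      have "(0, 1) \<in> sphere (0::pt) 1" by simp
      then have "sphere (0::pt) 1 \<noteq> {}" by blast
      then have "\<exists>v0\<in>sphere (0::pt) 1. \<forall>v\<in>sphere 0 1. norm (?n g v0) \<le> norm (?n g v)"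
        by (intro continuous_attains_inf continuous_on_norm gc) auto
      then obtain v0 where "v0 \<in> sphere (0::pt) 1" "\<forall>v\<in>sphere 0 1. norm (?n g v0) \<le> norm (?n g v)"
        by blast
      then show ?thesis by (intro that[of v0]) simp_all
    qed
    \<comment> \<open>The minimum of |g (r v) - g 0| on the sphere is positive by injectivity. A map
      within m/2 of \<open>g\<close> at both points changes this difference by less than m, so the
      segment between the two differences avoids 0.\<close>
    define m where "m = norm (?n g v0)"
    have m: "m > 0" using nz[OF g v0(1)] by (simp add: m_def)
    then have "m / 2 > 0" by simp
    then obtain N where N: "openin ?X N" "g \<in> N"
      "\<And>f x. \<lbrakk>f \<in> N; x \<in> cball 0 r\<rbrakk> \<Longrightarrow> dist (f x) (g x) < m / 2" "N \<subseteq> F"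
      by (rule openin_compact_open_nhd[OF g F(1)[OF g] compact_cball r(2)]) (rule that)
    have "sphere_degree (?n f) = sphere_degree (?n g)" if f: "f \<in> N" for f
    proof -
      let ?H = "\<lambda>s v. (1 - s) *\<^sub>R ?n f v + s *\<^sub>R ?n g v"
      have fc: "continuous_on (sphere 0 1) (?n f)"
        using continuous_on_scaled_diff[OF F(1) r(2)] r(1) f N(4) by auto
      have "sphere_degree (?H 0) = sphere_degree (?H 1)"
      proof (rule sphere_degree_homotopy)
        show "continuous_on ({0..1} \<times> sphere 0 1) (\<lambda>(s, v). ?H s v)"
          unfolding case_prod_unfold
          by (intro continuous_on_add continuous_on_scaleR continuous_on_compose2[OF fc]
              continuous_on_compose2[OF gc] continuous_intros) auto
        fix s :: real and v :: pt assume s: "0 \<le> s" "s \<le> 1" and v: "norm v = 1"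
        have "norm (f (r *\<^sub>R v) - g (r *\<^sub>R v)) < m / 2" "norm (f 0 - g 0) < m / 2"
          using N(3)[OF f, of "r *\<^sub>R v"] N(3)[OF f, of 0] r(1) v by (auto simp: dist_norm)
        moreover have "norm (?n f v - ?n g v) \<le> norm (f (r *\<^sub>R v) - g (r *\<^sub>R v)) + norm (f 0 - g 0)"
          using norm_triangle_ineq4[of "f (r *\<^sub>R v) - g (r *\<^sub>R v)" "f 0 - g 0"]
          by (simp add: algebra_simps)
        ultimately have fg: "norm (?n f v - ?n g v) < m" by linarith
        have "norm ((1 - s) *\<^sub>R (?n f v - ?n g v)) \<le> norm (?n f v - ?n g v)"
          using s by (simp add: mult_left_le_one_le)
        then have "norm ((1 - s) *\<^sub>R (?n f v - ?n g v)) < norm (?n g v)"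
          using fg v0(2)[OF v] by (simp add: m_def)
        moreover have "?n g v = ?H s v - (1 - s) *\<^sub>R (?n f v - ?n g v)"
          by (simp add: algebra_simps)
        ultimately show "?H s v \<noteq> 0"
          by (metis diff_0 norm_minus_cancel order_less_irrefl)
      qed
      then show ?thesis by simp
    qed
    then show ?thesis using N by blast
  qed
  \<comment> \<open>With an arbitrary predicate this covers both \<open>E1\<close> and
    \<open>E2\<close> below: a fixed degree and its complement are open, so a connected set cannot
    meet both.\<close>
  have op: "openin ?X {f \<in> F. Q (sphere_degree (?n f))}" for Q
  proof (subst openin_subopen, clarify)
    fix f assume f: "f \<in> F" "Q (sphere_degree (?n f))"
    obtain N where N: "openin ?X N" "f \<in> N" "N \<subseteq> F" "\<forall>h\<in>N. sphere_degree (?n h) = sphere_degree (?n f)"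
      using nhd[OF f(1)] by blast
    have sub: "N \<subseteq> {f \<in> F. Q (sphere_degree (?n f))}"
    proof
      fix h assume "h \<in> N"
      then have "h \<in> F" "sphere_degree (?n h) = sphere_degree (?n f)" using N(3,4) by blast+
      then show "h \<in> {f \<in> F. Q (sphere_degree (?n f))}" using f(2) by (simp del: scaleR_Pair)
    qed
    show "\<exists>T. openin ?X T \<and> f \<in> T \<and> T \<subseteq> {f \<in> F. Q (sphere_degree (?n f))}"
      by (intro exI[of _ N] conjI N(1,2) sub)
  qed
  obtain T where T: "connectedin ?X T" "f1 \<in> T" "f2 \<in> T"
    using comp unfolding connected_component_of_def by blast
  have TF: "T \<subseteq> F"
    using connectedin_subset_topspace[OF T(1)] unfolding compact_open_def by auto
  show ?thesis
  proof (rule ccontr)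
    define d where "d = sphere_degree (?n f1)"
    define E1 where "E1 = {f \<in> F. sphere_degree (?n f) = d}"
    define E2 where "E2 = {f \<in> F. sphere_degree (?n f) \<noteq> d}"
    assume "\<not> ?thesis"
    then have ne: "E1 \<inter> T \<noteq> {}" "E2 \<inter> T \<noteq> {}"
      using T(2,3) TF by (auto simp: E1_def E2_def d_def)
    have op12: "openin ?X E1" "openin ?X E2"
      unfolding E1_def E2_def by (rule op)+
    have cover: "T \<subseteq> E1 \<union> E2" "E1 \<inter> E2 \<inter> T = {}"
      using TF by (auto simp: E1_def E2_def)
    show False by (rule connectedinD[OF T(1) op12 cover ne])
  qed
qed

section \<open>Geodesics of the hyperbolic plane\<close>

lemma cpar_pos: "\<kappa> < 0 \<Longrightarrow> cpar \<kappa> > 0"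
  by (simp add: cpar_def)

lemma H2_iff: "\<kappa> < 0 \<Longrightarrow> \<zeta> \<in> H2 \<kappa> \<longleftrightarrow> cpar \<kappa> * cmod \<zeta> < 1"
  using cpar_pos[of \<kappa>] by (simp add: H2_def field_simps)

lemma H2_denom_pos:
  assumes "\<kappa> < 0" "\<zeta> \<in> H2 \<kappa>"
  shows "1 - (cpar \<kappa>)\<^sup>2 * (cmod \<zeta>)\<^sup>2 > 0"
proof -
  have "(cpar \<kappa> * cmod \<zeta>)\<^sup>2 < 1"
    using assms cpar_pos[of \<kappa>] by (simp add: H2_iff power_less_one_iff abs_square_less_1)
  then show ?thesis by (simp add: power_mult_distrib)
qed

lemma H2_iff_denom_pos:
  assumes "\<kappa> < 0"
  shows "\<zeta> \<in> H2 \<kappa> \<longleftrightarrow> 1 - (cpar \<kappa>)\<^sup>2 * (cmod \<zeta>)\<^sup>2 > 0"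
proof
  assume "1 - (cpar \<kappa>)\<^sup>2 * (cmod \<zeta>)\<^sup>2 > 0"
  then have "(cpar \<kappa> * cmod \<zeta>)\<^sup>2 < 1" by (simp add: power_mult_distrib)
  then show "\<zeta> \<in> H2 \<kappa>"
    using cpar_pos[OF assms] by (simp add: H2_iff[OF assms] abs_square_less_1)
qed (use H2_denom_pos assms in blast)

lemma Lam_pos: "\<lbrakk>\<kappa> < 0; \<zeta> \<in> H2 \<kappa>\<rbrakk> \<Longrightarrow> Lam \<kappa> \<zeta> > 0"
  using H2_denom_pos by (simp add: Lam_def)

lemma mult_cnj_cmod: "z * cnj z = complex_of_real ((cmod z)\<^sup>2)"
  by (rule complex_norm_square[symmetric])

lemma H2_metric_has_derivative:
  assumes "\<kappa> < 0" "p \<in> H2 \<kappa>"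
  shows "((\<lambda>q. H2_metric \<kappa> q v w) has_derivative
    (\<lambda>u. 4 * (cpar \<kappa>)\<^sup>2 * (Lam \<kappa> p)^3 * (p \<bullet> u) * (v \<bullet> w))) (at p)"
proof -
  let ?N = "\<lambda>q. 1 - (cpar \<kappa>)\<^sup>2 * (q \<bullet> q)"
  have N: "?N p > 0" using H2_denom_pos[OF assms] by (simp add: power2_norm_eq_inner)
  have "((\<lambda>q. inverse (?N q) * inverse (?N q) * (v \<bullet> w)) has_derivative
     (\<lambda>u. 4 * (cpar \<kappa>)\<^sup>2 * (inverse (?N p))^3 * (p \<bullet> u) * (v \<bullet> w))) (at p)"
    using N by (auto intro!: derivative_eq_intros simp: fun_eq_iff inner_commute power3_eq_cube algebra_simps)
  then show ?thesis
    by (simp add: H2_metric_def Lam_def power2_norm_eq_inner inner_complex_def[of v w]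
        power2_eq_square[of "inverse _"] divide_inverse)
qed

text \<open>For a conformal metric the quadratic term is proportional to 2 (p . v) v - |v|^2 p,
  which in complex notation is \<open>cnj p\<close> times the square of \<open>v\<close>.\<close>

lemma christoffel_H2:
  assumes "\<kappa> < 0" "p \<in> H2 \<kappa>"
  shows "christoffel (H2_metric \<kappa>) p v v w =
    2 * (cpar \<kappa>)\<^sup>2 * (Lam \<kappa> p)^3 * (((cnj p * v\<^sup>2) :: complex) \<bullet> w)"
proof -
  have D: "differential (\<lambda>q. H2_metric \<kappa> q v w) p =
     (\<lambda>u. 4 * (cpar \<kappa>)\<^sup>2 * (Lam \<kappa> p)^3 * (p \<bullet> u) * (v \<bullet> w))" for v w
    using frechet_derivative_at[OF H2_metric_has_derivative[OF assms]] by metis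
  show ?thesis
    unfolding christoffel_def D
    by (simp add: inner_complex_def power2_eq_square field_simps)
qed

text \<open>The second derivative that the geodesic equation forces, kept complex throughout so that
  a Moebius substitution reduces to rational identities.\<close>

definition H2_acceleration :: "real \<Rightarrow> complex \<Rightarrow> complex \<Rightarrow> complex" where
  "H2_acceleration \<kappa> p v =
     - 2 * (of_real (cpar \<kappa>))\<^sup>2 * cnj p * v\<^sup>2 / (1 - (of_real (cpar \<kappa>))\<^sup>2 * p * cnj p)"

definition H2_geodesic :: "real \<Rightarrow> (real \<Rightarrow> complex) \<Rightarrow> (real \<Rightarrow> complex) \<Rightarrow> bool" where
  "H2_geodesic \<kappa> z z' \<longleftrightarrow> (\<forall>t. z t \<in> H2 \<kappa> \<and> (z has_vector_derivative z' t) (at t) \<and>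
     (z' has_vector_derivative H2_acceleration \<kappa> (z t) (z' t)) (at t))"

lemma geodesic_equation_H2_iff:
  assumes "\<kappa> < 0" "p \<in> H2 \<kappa>"
  shows "(\<forall>w. H2_metric \<kappa> p a w + christoffel (H2_metric \<kappa>) p v v w = 0) \<longleftrightarrow>
    a = H2_acceleration \<kappa> p v"
proof -
  define n where "n = 1 - (cpar \<kappa>)\<^sup>2 * (cmod p)\<^sup>2"
  have N: "n > 0" unfolding n_def by (rule H2_denom_pos[OF assms])
  have L: "Lam \<kappa> p = 1 / n" by (simp add: Lam_def n_def)
  have Nc: "1 - (of_real (cpar \<kappa>))\<^sup>2 * p * cnj p = complex_of_real n"
    by (simp add: n_def mult_cnj_cmod mult.assoc)
  let ?b = "a + (2 * (cpar \<kappa>)\<^sup>2 / n) *\<^sub>R (cnj p * v\<^sup>2)"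
  have "H2_metric \<kappa> p a w + christoffel (H2_metric \<kappa>) p v v w = (1 / n\<^sup>2) * (?b \<bullet> w)" for w
    using N by (simp add: christoffel_H2[OF assms] H2_metric_def L inner_complex_def[of a w]
        inner_add_left power2_eq_square power3_eq_cube field_simps)
  then have "(\<forall>w. H2_metric \<kappa> p a w + christoffel (H2_metric \<kappa>) p v v w = 0) \<longleftrightarrow> (\<forall>w. ?b \<bullet> w = 0)"
    using N by simp
  also have "\<dots> \<longleftrightarrow> ?b = 0" by (metis inner_eq_zero_iff inner_zero_left)
  also have "\<dots> \<longleftrightarrow> a = - ((2 * (cpar \<kappa>)\<^sup>2 / n) *\<^sub>R (cnj p * v\<^sup>2))"
    by (simp add: eq_neg_iff_add_eq_0)
  also have "- ((2 * (cpar \<kappa>)\<^sup>2 / n) *\<^sub>R (cnj p * v\<^sup>2)) = H2_acceleration \<kappa> p v"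
    unfolding H2_acceleration_def Nc by (simp add: scaleR_conv_of_real)
  finally show ?thesis .
qed

lemma is_geodesic_H2_iff:
  assumes "\<kappa> < 0"
  shows "is_geodesic (H2_metric \<kappa>) (H2 \<kappa>) z z' \<longleftrightarrow> H2_geodesic \<kappa> z z'"
proof
  assume "is_geodesic (H2_metric \<kappa>) (H2 \<kappa>) z z'"
  then show "H2_geodesic \<kappa> z z'"
    unfolding is_geodesic_def H2_geodesic_def using geodesic_equation_H2_iff[OF assms] by metis
next
  assume "H2_geodesic \<kappa> z z'"
  then show "is_geodesic (H2_metric \<kappa>) (H2 \<kappa>) z z'"
    unfolding is_geodesic_def H2_geodesic_def
    by (intro conjI exI[of _ "\<lambda>t. H2_acceleration \<kappa> (z t) (z' t)"])
      (simp_all add: geodesic_equation_H2_iff[OF assms])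
qed

section \<open>Moving geodesics by disk isometries\<close>

lemma has_vector_derivative_chain:
  "\<lbrakk>(f has_vector_derivative f') (at x); (g has_field_derivative g') (at (f x))\<rbrakk> \<Longrightarrow>
   ((\<lambda>t. g (f t)) has_vector_derivative f' * g') (at x)"
  using field_vector_diff_chain_at[of f f' x g g'] by (simp add: o_def)

lemma DERIV_const_over_square:
  fixes D :: "complex \<Rightarrow> complex"
  assumes "(D has_field_derivative d) (at x)" "D x \<noteq> 0"
  shows "((\<lambda>z. k / (D z)\<^sup>2) has_field_derivative - 2 * d * k / (D x)^3) (at x)"
  using assms by (auto intro!: derivative_eq_intros simp: power2_eq_square power3_eq_cube field_simps)

lemma disk_denom_nonzero:
  assumes "\<kappa> < 0" "z0 \<in> H2 \<kappa>" "cpar \<kappa> * cmod z \<le> 1"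
  shows "1 - (complex_of_real (cpar \<kappa>))\<^sup>2 * cnj z0 * z \<noteq> 0"
proof
  assume "1 - (complex_of_real (cpar \<kappa>))\<^sup>2 * cnj z0 * z = 0"
  then have "cmod ((complex_of_real (cpar \<kappa>))\<^sup>2 * cnj z0 * z) = 1" by simp
  then have "(cpar \<kappa> * cmod z0) * (cpar \<kappa> * cmod z) = 1"
    using cpar_pos[OF assms(1)] by (simp add: norm_mult norm_power power2_eq_square mult_ac)
  moreover have "(cpar \<kappa> * cmod z0) * (cpar \<kappa> * cmod z) \<le> cpar \<kappa> * cmod z0"
    using assms cpar_pos[OF assms(1)] by (intro mult_left_le) auto
  ultimately show False using assms by (simp add: H2_iff)
qed

text \<open>The Moebius map taking \<open>z0\<close> to the centre is an isometry of the disk; that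
  it respects geodesics is verified by substitution into the explicit second-order equation. Applied
  to \<open>- z0\<close> it gives the inverse map.\<close>

lemma H2_geodesic_moebius:
  assumes \<kappa>: "\<kappa> < 0" and geod: "H2_geodesic \<kappa> z z'" and z0: "z0 \<in> H2 \<kappa>"
  defines "c \<equiv> complex_of_real (cpar \<kappa>)"
  shows "H2_geodesic \<kappa> (\<lambda>t. (z t - z0) / (1 - c\<^sup>2 * cnj z0 * z t))
    (\<lambda>t. z' t * ((1 - c\<^sup>2 * z0 * cnj z0) / (1 - c\<^sup>2 * cnj z0 * z t)\<^sup>2))"
  unfolding H2_geodesic_def
proof (intro allI conjI)
  fix t
  let ?k = "1 - c\<^sup>2 * z0 * cnj z0"
  let ?D = "1 - c\<^sup>2 * cnj z0 * z t" and ?N = "1 - c\<^sup>2 * z t * cnj (z t)"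
  let ?u = "(z t - z0) / ?D"
  have zt: "z t \<in> H2 \<kappa>" and z1: "(z has_vector_derivative z' t) (at t)"
    and z2: "(z' has_vector_derivative - 2 * c\<^sup>2 * cnj (z t) * (z' t)\<^sup>2 / ?N) (at t)"
    using geod by (auto simp: H2_geodesic_def H2_acceleration_def c_def)
  have cc: "cnj c = c" by (simp add: c_def)
  have D: "?D \<noteq> 0"
    using disk_denom_nonzero[OF \<kappa> z0, of "z t"] zt by (simp add: H2_iff[OF \<kappa>] c_def)
  then have D': "1 - c\<^sup>2 * z0 * cnj (z t) \<noteq> 0"
    using complex_cnj_zero_iff[of ?D] by (simp add: cc)
  have nsq: "1 - c\<^sup>2 * y * cnj y = complex_of_real (1 - (cpar \<kappa>)\<^sup>2 * (cmod y)\<^sup>2)" for y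
    by (simp add: c_def mult_cnj_cmod mult.assoc)
  have N: "?N \<noteq> 0" and k: "?k \<noteq> 0"
    using H2_denom_pos[OF \<kappa> zt] H2_denom_pos[OF \<kappa> z0] unfolding nsq of_real_eq_0_iff by simp_all
  \<comment> \<open>This identity relates the conformal factors at a point and its image. It shows
    that the image stays in the disk and supplies the denominator of its acceleration.\<close>
  have Nu: "1 - c\<^sup>2 * ?u * cnj ?u = ?k * ?N / (?D * cnj ?D)"
  proof -
    have "1 - s * (A / d) * (B / e) = (d * e - s * A * B) / (d * e)"
      if "d \<noteq> 0" "e \<noteq> 0" for s A B d e :: complex
      using that by (simp add: field_simps)
    from this[OF D, of "cnj ?D" "c\<^sup>2" "z t - z0" "cnj (z t - z0)"] D'
    have "1 - c\<^sup>2 * ?u * cnj ?u = (?D * cnj ?D - c\<^sup>2 * (z t - z0) * cnj (z t - z0)) / (?D * cnj ?D)"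
      by (simp add: cc)
    also have "?D * cnj ?D - c\<^sup>2 * (z t - z0) * cnj (z t - z0) = ?k * ?N"
      by (simp add: cc algebra_simps)
    finally show ?thesis .
  qed
  show "?u \<in> H2 \<kappa>"
  proof -
    have "complex_of_real (1 - (cpar \<kappa>)\<^sup>2 * (cmod ?u)\<^sup>2) =
       of_real ((1 - (cpar \<kappa>)\<^sup>2 * (cmod z0)\<^sup>2) * (1 - (cpar \<kappa>)\<^sup>2 * (cmod (z t))\<^sup>2) / (cmod ?D)\<^sup>2)"
      using Nu unfolding nsq complex_norm_square[symmetric] by simp
    then have "1 - (cpar \<kappa>)\<^sup>2 * (cmod ?u)\<^sup>2 =
       (1 - (cpar \<kappa>)\<^sup>2 * (cmod z0)\<^sup>2) * (1 - (cpar \<kappa>)\<^sup>2 * (cmod (z t))\<^sup>2) / (cmod ?D)\<^sup>2"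
      unfolding of_real_eq_iff .
    also have "\<dots> > 0"
      using H2_denom_pos[OF \<kappa> zt] H2_denom_pos[OF \<kappa> z0] D by simp
    finally show ?thesis by (simp add: H2_iff_denom_pos[OF \<kappa>])
  qed
  have "((\<lambda>z. (z - z0) / (1 - c\<^sup>2 * cnj z0 * z)) has_field_derivative ?k / ?D\<^sup>2) (at (z t))"
    using D by (auto intro!: derivative_eq_intros simp: power2_eq_square field_simps)
  from has_vector_derivative_chain[OF z1 this]
  show "((\<lambda>t. (z t - z0) / (1 - c\<^sup>2 * cnj z0 * z t)) has_vector_derivative z' t * (?k / ?D\<^sup>2)) (at t)" .
  have "((\<lambda>z. ?k / (1 - c\<^sup>2 * cnj z0 * z)\<^sup>2) has_field_derivative 2 * c\<^sup>2 * cnj z0 * ?k / ?D^3) (at (z t))"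
  proof -
    have "((\<lambda>z. 1 - c\<^sup>2 * cnj z0 * z) has_field_derivative - (c\<^sup>2 * cnj z0)) (at (z t))"
      by (auto intro!: derivative_eq_intros)
    from DERIV_const_over_square[OF this D, of ?k] show ?thesis by (simp add: mult.assoc)
  qed
  from has_vector_derivative_mult[OF z2 has_vector_derivative_chain[OF z1 this]]
  have *: "((\<lambda>t. z' t * (?k / (1 - c\<^sup>2 * cnj z0 * z t)\<^sup>2)) has_vector_derivative
     z' t * (z' t * (2 * c\<^sup>2 * cnj z0 * ?k / ?D^3)) +
     - 2 * c\<^sup>2 * cnj (z t) * (z' t)\<^sup>2 / ?N * (?k / ?D\<^sup>2)) (at t)" .
  have "- 2 * c\<^sup>2 * cnj ?u * (z' t * (?k / ?D\<^sup>2))\<^sup>2 / (1 - c\<^sup>2 * ?u * cnj ?u) =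
     - 2 * c\<^sup>2 * (cnj (z t) - cnj z0) * (z' t)\<^sup>2 * ?k / (?D^3 * ?N)"
  proof -
    \<comment> \<open>The identity is rational in the quantities and their conjugates, so the
      conjugates enter as independent variables.\<close>
    have "- 2 * s * (A / e) * (v * (q / d\<^sup>2))\<^sup>2 / (q * n / (d * e)) = - 2 * s * A * v\<^sup>2 * q / (d^3 * n)"
      if "d \<noteq> 0" "e \<noteq> 0" "q \<noteq> 0" "n \<noteq> 0" for s A v d e q n :: complex
      using that by (simp add: field_simps power2_eq_square power3_eq_cube)
    from this[OF D _ k N, of "cnj ?D" "c\<^sup>2" "cnj (z t) - cnj z0" "z' t"] D
    show ?thesis
      unfolding Nu unfolding complex_cnj_divide complex_cnj_diff[of "z t" z0] complex_cnj_zero_iff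
      by blast
  qed
  also have "\<dots> = z' t * (z' t * (2 * c\<^sup>2 * cnj z0 * ?k / ?D^3)) +
     - 2 * c\<^sup>2 * cnj (z t) * (z' t)\<^sup>2 / ?N * (?k / ?D\<^sup>2)"
  proof -
    \<comment> \<open>Over the common denominator the product rule produces exactly this
      difference.\<close>
    have eq: "- (cnj (z t) - cnj z0) = cnj z0 * ?N - cnj (z t) * ?D" by (simp add: algebra_simps)
    have "- 2 * c\<^sup>2 * (cnj (z t) - cnj z0) * (z' t)\<^sup>2 * ?k / (?D^3 * ?N) =
      2 * c\<^sup>2 * (z' t)\<^sup>2 * ?k * (cnj z0 * ?N - cnj (z t) * ?D) / (?D^3 * ?N)"
    proof -
      have "- 2 * s * X * w * q / M = 2 * s * w * q * (- X) / M" for s X w q M :: complex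
        by (simp add: mult_ac)
      from this[of "c\<^sup>2" "cnj (z t) - cnj z0"] show ?thesis unfolding eq .
    qed
    also have "\<dots> = z' t * (z' t * (2 * c\<^sup>2 * cnj z0 * ?k / ?D^3)) +
       - 2 * c\<^sup>2 * cnj (z t) * (z' t)\<^sup>2 / ?N * (?k / ?D\<^sup>2)"
    proof -
      have "2 * s * v\<^sup>2 * q * (a * n - b * d) / (d^3 * n) =
          v * (v * (2 * s * a * q / d^3)) + - 2 * s * b * v\<^sup>2 / n * (q / d\<^sup>2)"
        if "d \<noteq> 0" "n \<noteq> 0" for s v q a n b d :: complex
        using that by (simp add: field_simps power2_eq_square power3_eq_cube)
      then show ?thesis using D N by blast
    qed
    finally show ?thesis .
  qed
  finally show "((\<lambda>t. z' t * (?k / (1 - c\<^sup>2 * cnj z0 * z t)\<^sup>2)) has_vector_derivative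
     H2_acceleration \<kappa> ?u (z' t * (?k / ?D\<^sup>2))) (at t)"
    using * by (simp only: H2_acceleration_def c_def)
qed

lemma tanh_artanh_real:
  fixes x :: real
  assumes "\<bar>x\<bar> < 1"
  shows "tanh (artanh x) = x"
proof -
  have "exp (- 2 * artanh x) = (1 - x) / (1 + x)"
    using assms by (simp add: artanh_def exp_minus)
  then have "tanh (artanh x) = (1 - (1 - x) / (1 + x)) / (1 + (1 - x) / (1 + x))"
    by (simp add: tanh_real_altdef)
  moreover have "1 - (1 - x) / (1 + x) = 2 * x / (1 + x)" "1 + (1 - x) / (1 + x) = 2 / (1 + x)"
    using assms by (simp_all add: field_simps)
  ultimately show ?thesis using assms by simp
qed

lemma has_vector_derivative_zero_imp_const:
  fixes f :: "real \<Rightarrow> 'a::real_normed_vector"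
  assumes "\<And>t. (f has_vector_derivative 0) (at t)"
  shows "f t = f 0"
proof -
  obtain k where "\<And>x. x \<in> UNIV \<Longrightarrow> f x = k"
    using has_vector_derivative_zero_constant[of UNIV f] assms by auto
  then show ?thesis by simp
qed

text \<open>Through the centre, the angular momentum \<open>u' * cnj u - cnj u' * u\<close> (up to the factor \<open>N\<^sup>2\<close>)
  is conserved, hence zero, and then \<open>u' / N\<close> is conserved too.\<close>

lemma H2_geodesic_from_centre:
  assumes \<kappa>: "\<kappa> < 0" and geod: "H2_geodesic \<kappa> u u'" and u0: "u 0 = 0" "u' 0 = v" and v: "cmod v = 1"
  shows "u t = v * of_real (tanh (cpar \<kappa> * t) / cpar \<kappa>)"
proof -
  define c where "c = complex_of_real (cpar \<kappa>)"
  define N where "N t = 1 - c\<^sup>2 * u t * cnj (u t)" for t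
  have cc: "cnj c = c" by (simp add: c_def)
  have Nr: "N t = complex_of_real (1 - (cpar \<kappa>)\<^sup>2 * (cmod (u t))\<^sup>2)" for t
    by (simp add: N_def c_def mult_cnj_cmod mult.assoc)
  have uH: "u t \<in> H2 \<kappa>" and u1: "(u has_vector_derivative u' t) (at t)"
    and u2: "(u' has_vector_derivative - 2 * c\<^sup>2 * cnj (u t) * (u' t)\<^sup>2 / N t) (at t)" for t
    using geod by (auto simp: H2_geodesic_def H2_acceleration_def c_def N_def)
  have N0: "N t \<noteq> 0" for t
    using H2_denom_pos[OF \<kappa> uH[of t]] unfolding Nr of_real_eq_0_iff by simp
  have cN: "cnj (N t) = N t" for t unfolding Nr by simp
  have N1: "(N has_vector_derivative - (c\<^sup>2 * (u' t * cnj (u t) + u t * cnj (u' t)))) (at t)" for t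
    unfolding N_def
    by (rule derivative_eq_intros u1 refl | simp add: algebra_simps)+
  have iN: "((\<lambda>t. inverse (N t)) has_vector_derivative
      c\<^sup>2 * (u' t * cnj (u t) + u t * cnj (u' t)) / (N t)\<^sup>2) (at t)" for t
  proof -
    have "(inverse has_field_derivative - (inverse (N t) ^ Suc (Suc 0))) (at (N t))"
      by (rule DERIV_inverse) (rule N0)
    from has_vector_derivative_chain[OF N1 this]
    show ?thesis by (simp add: divide_inverse power2_eq_square mult_ac)
  qed
  have cu1: "((\<lambda>t. cnj (u t)) has_vector_derivative cnj (u' t)) (at t)" for t
    by (rule has_vector_derivative_cnj[OF u1])
  have cu2: "((\<lambda>t. cnj (u' t)) has_vector_derivative - 2 * c\<^sup>2 * u t * (cnj (u' t))\<^sup>2 / N t) (at t)" for t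
    using has_vector_derivative_cnj[OF u2] by (simp add: cc cN)
  define J where "J t = (u' t * cnj (u t) - cnj (u' t) * u t) * (inverse (N t) * inverse (N t))" for t
  have "(J has_vector_derivative 0) (at t)" for t
  proof -
    have J: "(J has_vector_derivative
      (u' t * cnj (u t) - cnj (u' t) * u t) *
        (inverse (N t) * (c\<^sup>2 * (u' t * cnj (u t) + u t * cnj (u' t)) / (N t)\<^sup>2) +
         c\<^sup>2 * (u' t * cnj (u t) + u t * cnj (u' t)) / (N t)\<^sup>2 * inverse (N t)) +
      ((u' t * cnj (u' t) + - 2 * c\<^sup>2 * cnj (u t) * (u' t)\<^sup>2 / N t * cnj (u t)) -
       (cnj (u' t) * u' t + - 2 * c\<^sup>2 * u t * (cnj (u' t))\<^sup>2 / N t * u t)) *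
        (inverse (N t) * inverse (N t))) (at t)"
      unfolding J_def
      by (intro has_vector_derivative_mult has_vector_derivative_diff iN cu1 cu2 u1 u2)
    have "(p * y - q * x) * (inverse n * (s * (p * y + x * q) / n\<^sup>2) +
         s * (p * y + x * q) / n\<^sup>2 * inverse n) +
      ((p * q + - 2 * s * y * p\<^sup>2 / n * y) - (q * p + - 2 * s * x * q\<^sup>2 / n * x)) *
        (inverse n * inverse n) = 0" if "n \<noteq> 0" for n x y p q s :: complex
      using that by (simp add: field_simps power2_eq_square)
    from this[OF N0] show ?thesis using J by (simp only:)
  qed
  then have "J t = 0" for t using has_vector_derivative_zero_imp_const[of J] by (simp add: J_def u0)
  then have par: "u' t * cnj (u t) = cnj (u' t) * u t" for t
    using N0 by (simp add: J_def)
  define X where "X t = u' t * inverse (N t)" for t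
  have "(X has_vector_derivative 0) (at t)" for t
  proof -
    have "(X has_vector_derivative
      u' t * (c\<^sup>2 * (u' t * cnj (u t) + u t * cnj (u' t)) / (N t)\<^sup>2) +
      - 2 * c\<^sup>2 * cnj (u t) * (u' t)\<^sup>2 / N t * inverse (N t)) (at t)"
      unfolding X_def by (intro has_vector_derivative_mult iN u2)
    moreover have "u' t * (c\<^sup>2 * (u' t * cnj (u t) + u t * cnj (u' t)) / (N t)\<^sup>2) +
      - 2 * c\<^sup>2 * cnj (u t) * (u' t)\<^sup>2 / N t * inverse (N t) = 0"
    proof -
      \<comment> \<open>Zero angular momentum makes the two halves of the derivative of
        \<open>N\<close> equal, so they cancel the acceleration term.\<close>
      have "u t * cnj (u' t) = u' t * cnj (u t)" using par[of t] by (simp add: mult.commute)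
      then show ?thesis by (simp add: divide_inverse power2_eq_square)
    qed
    ultimately show ?thesis by simp
  qed
  then have "X t = X 0" for t using has_vector_derivative_zero_imp_const by blast
  then have Xv: "u' t * inverse (N t) = v" for t by (simp add: X_def u0 N_def[of 0])
  have uN: "u' t = v * N t" for t
    using N0[of t] unfolding Xv[of t, symmetric] by simp
  have vv: "cnj v * v = 1" using v by (simp add: mult.commute[of "cnj v"] mult_cnj_cmod)
  \<comment> \<open>After rotation by \<open>cnj v\<close> the velocity is real, so the curve stays
    on a diameter and the problem becomes one-dimensional.\<close>
  define y where "y t = cnj v * u t" for t
  have y1: "(y has_vector_derivative of_real (1 - (cpar \<kappa>)\<^sup>2 * (cmod (u t))\<^sup>2)) (at t)" for t
    using has_vector_derivative_mult_right[OF u1[of t], of "cnj v"] vv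
    unfolding y_def uN Nr by (simp add: mult.assoc[symmetric])
  have yR: "((\<lambda>t. Re (y t)) has_real_derivative (1 - (cpar \<kappa>)\<^sup>2 * (cmod (u t))\<^sup>2)) (at t)"
    and yI: "((\<lambda>t. Im (y t)) has_vector_derivative 0) (at t)" for t
    using y1[of t] unfolding has_vector_derivative_complex_iff
    by (simp_all add: has_real_derivative_iff_has_vector_derivative)
  have Im0: "Im (y t) = 0" for t
    using has_vector_derivative_zero_imp_const[OF yI] by (simp add: y_def u0)
  define q where "q t = cpar \<kappa> * Re (y t)" for t
  have cp: "cpar \<kappa> > 0" by (rule cpar_pos[OF \<kappa>])
  have yu: "cmod (u t) = \<bar>Re (y t)\<bar>" for t
  proof -
    have "cmod (u t) = cmod (y t)" using v by (simp add: y_def norm_mult)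
    also have "\<dots> = \<bar>Re (y t)\<bar>" using Im0[of t] by (simp add: cmod_def)
    finally show ?thesis .
  qed
  have q_less: "\<bar>q t\<bar> < 1" for t
    using uH[of t] cp unfolding H2_iff[OF \<kappa>] yu by (simp add: q_def abs_mult)
  have q1: "(q has_real_derivative cpar \<kappa> * (1 - (q t)\<^sup>2)) (at t)" for t
    using DERIV_cmult[OF yR[of t], of "cpar \<kappa>"] unfolding q_def yu by (simp add: power_mult_distrib)
  \<comment> \<open>Separation of variables: \<open>artanh (q t)\<close> has constant slope
    \<open>cpar \<kappa>\<close>.\<close>
  have "((\<lambda>t. artanh (q t) - cpar \<kappa> * t) has_real_derivative 0) (at t)" for t
  proof -
    have "(q t)\<^sup>2 < 1" using q_less[of t] by (simp add: abs_square_less_1)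
    then have nz: "1 - (q t)\<^sup>2 \<noteq> 0" by simp
    have "((\<lambda>t. artanh (q t)) has_real_derivative (1 / (1 - (q t)\<^sup>2) * (cpar \<kappa> * (1 - (q t)\<^sup>2)))) (at t)"
      by (rule DERIV_chain2[OF artanh_real_has_field_derivative[OF q_less] q1])
    then show ?thesis using nz by (auto intro!: derivative_eq_intros)
  qed
  then have "artanh (q t) - cpar \<kappa> * t = artanh (q 0) - cpar \<kappa> * 0" for t
    by (intro has_vector_derivative_zero_imp_const)
      (simp add: has_real_derivative_iff_has_vector_derivative[symmetric])
  then have "artanh (q t) = cpar \<kappa> * t" by (simp add: q_def y_def u0)
  then have "q t = tanh (cpar \<kappa> * t)" using tanh_artanh_real[OF q_less] by metis
  then have "Re (y t) = tanh (cpar \<kappa> * t) / cpar \<kappa>" using cp by (simp add: q_def field_simps)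
  then have "y t = of_real (tanh (cpar \<kappa> * t) / cpar \<kappa>)" using Im0[of t] by (simp add: complex_eq_iff)
  moreover have "u t = v * y t" using vv by (simp add: y_def mult.commute[of v] mult.assoc)
  ultimately show ?thesis by simp
qed

text \<open>\<open>geodesic_endpoint\<close> is a definite description, so a geodesic with the given
  initial data must be exhibited as well as shown unique.\<close>

lemma H2_geodesic_through_centre:
  assumes \<kappa>: "\<kappa> < 0" and v: "cmod v = 1"
  shows "H2_geodesic \<kappa> (\<lambda>t. v * of_real (tanh (cpar \<kappa> * t) / cpar \<kappa>))
    (\<lambda>t. v * of_real (1 - (tanh (cpar \<kappa> * t))\<^sup>2))"
  unfolding H2_geodesic_def
proof (intro allI conjI)
  fix t
  have cp: "cpar \<kappa> > 0" by (rule cpar_pos[OF \<kappa>])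
  let ?T = "tanh (cpar \<kappa> * t)"
  have T: "\<bar>?T\<bar> < 1" by (simp add: abs_less_iff tanh_real_lt_1 tanh_real_gt_neg1 minus_less_iff)
  show "v * of_real (?T / cpar \<kappa>) \<in> H2 \<kappa>"
    using T v cp by (simp add: H2_iff[OF \<kappa>] norm_mult norm_divide)
  have "((\<lambda>t. tanh (cpar \<kappa> * t)) has_real_derivative cpar \<kappa> * (1 - ?T\<^sup>2)) (at t)"
    by (auto intro!: derivative_eq_intros simp: cosh_real_nonzero)
  note T1 = this
  have "((\<lambda>t. tanh (cpar \<kappa> * t) / cpar \<kappa>) has_real_derivative (1 - ?T\<^sup>2)) (at t)"
    using DERIV_cdivide[OF T1, of "cpar \<kappa>"] cp by simp
  from has_vector_derivative_mult_right[OF has_vector_derivative_of_real[OF this]]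
  show "((\<lambda>t. v * of_real (tanh (cpar \<kappa> * t) / cpar \<kappa>)) has_vector_derivative
      v * of_real (1 - ?T\<^sup>2)) (at t)" .
  have "((\<lambda>t. 1 - (tanh (cpar \<kappa> * t))\<^sup>2) has_real_derivative - (2 * ?T * (cpar \<kappa> * (1 - ?T\<^sup>2)))) (at t)"
    by (rule derivative_eq_intros T1 refl | simp)+
  from has_vector_derivative_mult_right[OF has_vector_derivative_of_real[OF this]]
  have *: "((\<lambda>t. v * of_real (1 - (tanh (cpar \<kappa> * t))\<^sup>2)) has_vector_derivative
      v * of_real (- (2 * ?T * (cpar \<kappa> * (1 - ?T\<^sup>2))))) (at t)" .
  have vv: "v * cnj v = 1" using v by (simp add: mult_cnj_cmod)
  have "1 - (of_real (cpar \<kappa>))\<^sup>2 * (v * of_real (?T / cpar \<kappa>)) * cnj (v * of_real (?T / cpar \<kappa>)) =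
      1 - (of_real (cpar \<kappa>))\<^sup>2 * (of_real (?T / cpar \<kappa>))\<^sup>2 * (v * cnj v)"
    by (simp add: power2_eq_square mult_ac)
  also have "\<dots> = of_real (1 - ?T\<^sup>2)" using cp by (simp add: vv power_divide)
  finally have N: "1 - (of_real (cpar \<kappa>))\<^sup>2 * (v * of_real (?T / cpar \<kappa>)) * cnj (v * of_real (?T / cpar \<kappa>)) =
      complex_of_real (1 - ?T\<^sup>2)" .
  have "?T\<^sup>2 < 1" using T by (simp add: abs_square_less_1)
  then have nz: "complex_of_real (1 - ?T\<^sup>2) \<noteq> 0" unfolding of_real_eq_0_iff by simp
  have "- 2 * c\<^sup>2 * (w * (s / c)) * (v * m)\<^sup>2 / m = v * (- (2 * s * (c * m)))"
    if "m \<noteq> 0" "c \<noteq> 0" "v * w = 1" for c s m w :: complex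
    using that by (simp add: field_simps power2_eq_square)
  from this[OF nz _ vv, of "of_real (cpar \<kappa>)" "of_real ?T"] cp
  have "- 2 * (of_real (cpar \<kappa>))\<^sup>2 * cnj (v * of_real (?T / cpar \<kappa>)) * (v * of_real (1 - ?T\<^sup>2))\<^sup>2 /
      of_real (1 - ?T\<^sup>2) = v * of_real (- (2 * ?T * (cpar \<kappa> * (1 - ?T\<^sup>2))))" by simp
  then show "((\<lambda>t. v * of_real (1 - (tanh (cpar \<kappa> * t))\<^sup>2)) has_vector_derivative
     H2_acceleration \<kappa> (v * of_real (?T / cpar \<kappa>)) (v * of_real (1 - ?T\<^sup>2))) (at t)"
    using * unfolding H2_acceleration_def N by simp
qed

lemma uminus_in_H2: "\<zeta> \<in> H2 \<kappa> \<Longrightarrow> - \<zeta> \<in> H2 \<kappa>"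
  by (simp add: H2_def)

text \<open>Moving \<open>z0\<close> to the centre turns the velocity \<open>V\<close> into the unit
  vector \<open>v\<close>. The diameter in direction \<open>v\<close>, moved back, is the curve
  \<open>Z\<close>; its limit is read off by replacing tanh with 1.\<close>

lemma geodesic_endpoint_eq:
  assumes \<kappa>: "\<kappa> < 0" and z0: "z0 \<in> H2 \<kappa>"
    and v: "v = of_real (Lam \<kappa> z0) * V" "cmod v = 1"
  defines "c \<equiv> complex_of_real (cpar \<kappa>)"
  shows "geodesic_endpoint \<kappa> z0 V = (v + c * z0) / (1 + c * cnj z0 * v) / c"
proof -
  let ?p = "(v + c * z0) / (1 + c * cnj z0 * v) / c"
  define U where "U t = v * of_real (tanh (cpar \<kappa> * t) / cpar \<kappa>)" for t
  define Z where "Z t = (U t + z0) / (1 + c\<^sup>2 * cnj z0 * U t)" for t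
  have cp: "cpar \<kappa> > 0" by (rule cpar_pos[OF \<kappa>])
  have c0: "c \<noteq> 0" using cp by (simp add: c_def)
  have cc: "cnj c = c" by (simp add: c_def)
  let ?k = "1 - c\<^sup>2 * z0 * cnj z0"
  have kr: "?k = complex_of_real (1 - (cpar \<kappa>)\<^sup>2 * (cmod z0)\<^sup>2)"
    by (simp add: c_def mult_cnj_cmod mult.assoc)
  have k: "?k \<noteq> 0" using H2_denom_pos[OF \<kappa> z0] unfolding kr of_real_eq_0_iff by simp
  have vk: "v = V / ?k" unfolding kr by (simp add: v(1) Lam_def)
  have Dv: "1 + c * cnj z0 * v \<noteq> 0"
  proof -
    have "1 - c\<^sup>2 * cnj z0 * (- v / c) \<noteq> 0"
      unfolding c_def by (rule disk_denom_nonzero[OF \<kappa> z0]) (use v(2) cp in \<open>simp add: norm_divide\<close>)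
    then show ?thesis using c0 by (simp add: power2_eq_square mult_ac)
  qed
  have T: "((\<lambda>t. complex_of_real (tanh (cpar \<kappa> * t))) \<longlongrightarrow> of_real 1) at_top"
    by (intro tendsto_of_real filterlim_compose[OF tanh_real_at_top]
        filterlim_tendsto_pos_mult_at_top[OF tendsto_const cp filterlim_ident])
  have Uc: "U t = v / c * of_real (tanh (cpar \<kappa> * t))" for t by (simp add: U_def c_def)
  have "(Z \<longlongrightarrow> (v / c * of_real 1 + z0) / (1 + c\<^sup>2 * cnj z0 * (v / c * of_real 1))) at_top"
    unfolding Z_def Uc
    by (intro tendsto_intros T) (use Dv c0 in \<open>simp add: power2_eq_square mult_ac\<close>)
  moreover have "(v / c * of_real 1 + z0) / (1 + c\<^sup>2 * cnj z0 * (v / c * of_real 1)) = ?p"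
    using c0 Dv by (simp add: field_simps power2_eq_square)
  ultimately have Zlim: "(Z \<longlongrightarrow> ?p) at_top" by simp
  \<comment> \<open>As \<open>v\<close> has modulus 1, the numerator is \<open>v\<close> times the
    conjugate of the denominator.\<close>
  have bd: "?p \<in> H2_boundary \<kappa>"
  proof -
    have "v + c * z0 = v * cnj (1 + c * cnj z0 * v)"
      using v(2) by (simp add: cc algebra_simps mult_cnj_cmod)
    then have "cmod (v + c * z0) = cmod (1 + c * cnj z0 * v)"
      using v(2) by (simp only: norm_mult complex_mod_cnj mult_1)
    then show ?thesis using Dv cp by (simp add: H2_boundary_def norm_divide norm_mult c_def)
  qed
  have geodZ: "\<exists>\<gamma>'. is_geodesic (H2_metric \<kappa>) (H2 \<kappa>) Z \<gamma>' \<and> Z 0 = z0 \<and> \<gamma>' 0 = V"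
  proof -
    let ?U' = "\<lambda>t. v * of_real (1 - (tanh (cpar \<kappa> * t))\<^sup>2)"
    have "H2_geodesic \<kappa> U ?U'" unfolding U_def by (rule H2_geodesic_through_centre[OF \<kappa> v(2)])
    from H2_geodesic_moebius[OF \<kappa> this uminus_in_H2[OF z0]]
    have "H2_geodesic \<kappa> Z (\<lambda>t. ?U' t * (?k / (1 + c\<^sup>2 * cnj z0 * U t)\<^sup>2))"
      by (simp add: Z_def[abs_def] c_def)
    moreover have "Z 0 = z0" by (simp add: Z_def U_def)
    moreover have "?U' 0 * (?k / (1 + c\<^sup>2 * cnj z0 * U 0)\<^sup>2) = V"
      using k by (simp add: U_def vk)
    ultimately show ?thesis by (auto simp: is_geodesic_H2_iff[OF \<kappa>])
  qed
  \<comment> \<open>Any competitor, moved to the centre, starts there with velocity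
    \<open>v\<close>, so it is the diameter \<open>U\<close>; solving for the original curve gives
    \<open>Z\<close>.\<close>
  have uniq: "\<gamma> t = Z t" if "is_geodesic (H2_metric \<kappa>) (H2 \<kappa>) \<gamma> \<gamma>'" "\<gamma> 0 = z0" "\<gamma>' 0 = V" for \<gamma> \<gamma>' t
  proof -
    have g: "H2_geodesic \<kappa> \<gamma> \<gamma>'" using that(1) by (simp add: is_geodesic_H2_iff[OF \<kappa>])
    have k': "1 - c\<^sup>2 * cnj z0 * z0 = ?k" by (simp add: mult_ac)
    define W where "W t = (\<gamma> t - z0) / (1 - c\<^sup>2 * cnj z0 * \<gamma> t)" for t
    define W' where "W' t = \<gamma>' t * (?k / (1 - c\<^sup>2 * cnj z0 * \<gamma> t)\<^sup>2)" for t
    have "H2_geodesic \<kappa> W W'"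
      unfolding W_def W'_def c_def by (rule H2_geodesic_moebius[OF \<kappa> g z0])
    moreover have "W 0 = 0" by (simp add: W_def that(2))
    moreover have "W' 0 = v"
      unfolding W'_def that(2,3) k' vk using k by (simp add: power2_eq_square)
    ultimately have WU: "W t = U t"
      unfolding U_def using H2_geodesic_from_centre[OF \<kappa> _ _ _ v(2)] by blast
    have D: "1 - c\<^sup>2 * cnj z0 * \<gamma> t \<noteq> 0"
      unfolding c_def using g by (intro disk_denom_nonzero[OF \<kappa> z0])
        (auto simp: H2_geodesic_def H2_iff[OF \<kappa>] intro: less_imp_le)
    have "\<gamma> t = (W t + z0) / (1 + c\<^sup>2 * cnj z0 * W t)"
    proof -
      have "W t + z0 = \<gamma> t * ?k / (1 - c\<^sup>2 * cnj z0 * \<gamma> t)"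
        using D by (simp add: W_def divide_simps) (simp add: algebra_simps)
      moreover have "1 + c\<^sup>2 * cnj z0 * W t = ?k / (1 - c\<^sup>2 * cnj z0 * \<gamma> t)"
        using D by (simp add: W_def divide_simps) (simp add: algebra_simps)
      ultimately show ?thesis using D k by simp
    qed
    then show ?thesis by (simp add: Z_def WU)
  qed
  show ?thesis
    unfolding geodesic_endpoint_def
  proof (rule the_equality)
    show "?p \<in> H2_boundary \<kappa> \<and> (\<exists>\<gamma> \<gamma>'. is_geodesic (H2_metric \<kappa>) (H2 \<kappa>) \<gamma> \<gamma>' \<and> \<gamma> 0 = z0 \<and>
        \<gamma>' 0 = V \<and> (\<gamma> \<longlongrightarrow> ?p) at_top)"
      using bd geodZ Zlim by blast
  next
    fix p
    assume "p \<in> H2_boundary \<kappa> \<and> (\<exists>\<gamma> \<gamma>'. is_geodesic (H2_metric \<kappa>) (H2 \<kappa>) \<gamma> \<gamma>' \<and> \<gamma> 0 = z0 \<and>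
        \<gamma>' 0 = V \<and> (\<gamma> \<longlongrightarrow> p) at_top)"
    then obtain \<gamma> \<gamma>' where \<gamma>: "is_geodesic (H2_metric \<kappa>) (H2 \<kappa>) \<gamma> \<gamma>'" "\<gamma> 0 = z0" "\<gamma>' 0 = V"
      "(\<gamma> \<longlongrightarrow> p) at_top" by blast
    have "\<gamma> = Z" using uniq[OF \<gamma>(1-3)] by blast
    then show "p = ?p" using \<gamma>(4) Zlim tendsto_unique[of at_top] by (metis trivial_limit_at_top_linorder)
  qed
qed

section \<open>The Gauss map in one fibre\<close>

lemma sphere_frac_cong:
  assumes "p * q' = p' * q" "p \<noteq> 0 \<or> q \<noteq> 0" "p' \<noteq> 0 \<or> q' \<noteq> 0"
  shows "sphere_frac p q = sphere_frac p' q'"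
  using assms by (auto simp: sphere_frac_def frac_eq_eq)

lemma one_plus_of_real_eq_0: "1 + complex_of_real s = 0 \<longleftrightarrow> s = -1"
  and one_minus_of_real_eq_0: "1 - complex_of_real s = 0 \<longleftrightarrow> s = 1"
  by (auto simp: complex_eq_iff)

lemma sphere_frac_scale: "l \<noteq> 0 \<Longrightarrow> sphere_frac (l * p) (l * q) = sphere_frac p q"
  by (simp add: sphere_frac_def)

lemma sphere_frac_eq_param:
  "q \<noteq> 0 \<Longrightarrow> sphere_frac p q = sphere_param True (p / q)"
  "p \<noteq> 0 \<Longrightarrow> sphere_frac p q = sphere_param False (q / p)"
  by (simp_all add: sphere_frac_def sphere_param_def)

lemma Some_hemispheres:
  "Some z \<in> north \<longleftrightarrow> cmod z < 1" "Some z \<in> equator \<longleftrightarrow> cmod z = 1" "Some z \<in> south \<longleftrightarrow> cmod z > 1"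
  by (auto simp: north_def equator_def south_def)

lemma None_hemispheres: "None \<notin> north" "None \<notin> equator" "None \<in> south"
  by (auto simp: north_def equator_def south_def)

lemma sphere_frac_hemispheres:
  assumes "p \<noteq> 0 \<or> q \<noteq> 0"
  shows "sphere_frac p q \<in> north \<longleftrightarrow> (cmod p)\<^sup>2 < (cmod q)\<^sup>2"
    and "sphere_frac p q \<in> equator \<longleftrightarrow> (cmod p)\<^sup>2 = (cmod q)\<^sup>2"
    and "sphere_frac p q \<in> south \<longleftrightarrow> (cmod p)\<^sup>2 > (cmod q)\<^sup>2"
proof -
  have sq: "x\<^sup>2 < y\<^sup>2 \<longleftrightarrow> x < y" if "x \<ge> 0" "y \<ge> 0" for x y :: real
    using power_mono_iff[OF that(2,1), of 2] by (simp add: not_le[symmetric])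
  show "sphere_frac p q \<in> north \<longleftrightarrow> (cmod p)\<^sup>2 < (cmod q)\<^sup>2"
    "sphere_frac p q \<in> equator \<longleftrightarrow> (cmod p)\<^sup>2 = (cmod q)\<^sup>2"
    "sphere_frac p q \<in> south \<longleftrightarrow> (cmod p)\<^sup>2 > (cmod q)\<^sup>2"
    using assms by (auto simp: sphere_frac_def Some_hemispheres None_hemispheres norm_divide
        divide_less_eq less_divide_eq sq)
qed

text \<open>Stereographic projection from \<open>- \<xi>\<close>, in homogeneous coordinates \<open>[w : 1 + s] = [1 - s : cnj w]\<close>,
  followed by the Moebius transformation \<open>z \<mapsto> (z + a) / (cnj a * z + 1)\<close>.\<close>

definition north_num :: "complex \<Rightarrow> complex \<Rightarrow> complex \<Rightarrow> complex" where
  "north_num a w s = w + a * (1 + s)"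

definition north_den :: "complex \<Rightarrow> complex \<Rightarrow> complex \<Rightarrow> complex" where
  "north_den a w s = cnj a * w + (1 + s)"

definition south_num :: "complex \<Rightarrow> complex \<Rightarrow> complex \<Rightarrow> complex" where
  "south_num a w s = (1 - s) + a * cnj w"

definition south_den :: "complex \<Rightarrow> complex \<Rightarrow> complex \<Rightarrow> complex" where
  "south_den a w s = cnj a * (1 - s) + cnj w"

text \<open>At s = -1, hence w = 0, the first form reads [0 : 0]. The value chosen is that of the
  second form, [2 : 2 * cnj a], which is the Moebius image of infinity.\<close>

definition gauss_map :: "complex \<Rightarrow> complex \<Rightarrow> real \<Rightarrow> riemann_sphere" where
  "gauss_map a w s = (if s \<noteq> -1 then sphere_frac (north_num a w s) (north_den a w s)
     else sphere_frac 1 (cnj a))"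

text \<open>With n = p - a * q and d = q - cnj a * p, which undo the Moebius map, inverse
  stereographic projection is w = 2 n cnj d / (|n|^2 + |d|^2) and s = (|d|^2 - |n|^2) / (|n|^2 +
  |d|^2). Homogeneous arguments let [z : 1] and [1 : z] treat both charts at once.\<close>

definition gauss_inv_num :: "complex \<Rightarrow> complex \<Rightarrow> complex \<Rightarrow> complex" where
  "gauss_inv_num a p q = 2 * (p - a * q) * cnj (q - cnj a * p)"

definition gauss_inv_ht :: "complex \<Rightarrow> complex \<Rightarrow> complex \<Rightarrow> complex" where
  "gauss_inv_ht a p q = (q - cnj a * p) * cnj (q - cnj a * p) - (p - a * q) * cnj (p - a * q)"

definition gauss_inv_den :: "complex \<Rightarrow> complex \<Rightarrow> complex \<Rightarrow> complex" where
  "gauss_inv_den a p q = (p - a * q) * cnj (p - a * q) + (q - cnj a * p) * cnj (q - cnj a * p)"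

definition gauss_inv_w :: "complex \<Rightarrow> complex \<Rightarrow> complex \<Rightarrow> complex" where
  "gauss_inv_w a p q = gauss_inv_num a p q / gauss_inv_den a p q"

definition gauss_inv_s :: "complex \<Rightarrow> complex \<Rightarrow> complex \<Rightarrow> real" where
  "gauss_inv_s a p q = Re (gauss_inv_ht a p q / gauss_inv_den a p q)"

context
  fixes a :: complex
  assumes a: "cmod a < 1"
begin

lemma one_minus_norm_nonzero: "1 - a * cnj a \<noteq> 0"
proof -
  have "(cmod a)\<^sup>2 < 1" using a by (simp add: abs_square_less_1)
  then have "complex_of_real (1 - (cmod a)\<^sup>2) \<noteq> 0" unfolding of_real_eq_0_iff by simp
  then show ?thesis by (simp add: mult_cnj_cmod)
qed

lemma sphere_eq:
  assumes "(cmod w)\<^sup>2 + s\<^sup>2 = 1"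
  shows "w * cnj w = (1 + complex_of_real s) * (1 - complex_of_real s)"
proof -
  have "(cmod w)\<^sup>2 = (1 + s) * (1 - s)" using assms by (simp add: algebra_simps power2_eq_square)
  then show ?thesis unfolding mult_cnj_cmod by simp
qed

text \<open>The inverse Moebius matrix recovers the stereographic coordinates up to its determinant.
  Hence numerator and denominator do not vanish together, and the inverse formulas can be
  evaluated.\<close>

lemma north_unmoebius:
  "north_num a w s - a * north_den a w s = (1 - a * cnj a) * w"
  "north_den a w s - cnj a * north_num a w s = (1 - a * cnj a) * (1 + s)"
  by (simp_all add: north_num_def north_den_def algebra_simps)

lemma south_unmoebius:
  "south_num a w s - a * south_den a w s = (1 - a * cnj a) * (1 - s)"
  "south_den a w s - cnj a * south_num a w s = (1 - a * cnj a) * cnj w"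
  by (simp_all add: south_num_def south_den_def algebra_simps)

lemma north_nonzero:
  assumes "1 + s \<noteq> 0" shows "north_num a w s \<noteq> 0 \<or> north_den a w s \<noteq> 0"
  using north_unmoebius(2)[of w s] one_minus_norm_nonzero assms by auto

lemma south_nonzero:
  assumes "1 - s \<noteq> 0" shows "south_num a w s \<noteq> 0 \<or> south_den a w s \<noteq> 0"
  using south_unmoebius(1)[of w s] one_minus_norm_nonzero assms by auto

text \<open>The cross difference of the two representations is a multiple of w * cnj w - (1 + s) *
  (1 - s), which vanishes on the sphere.\<close>

lemma gauss_map_south:
  assumes "(cmod w)\<^sup>2 + s\<^sup>2 = 1" "s \<noteq> 1"
  shows "gauss_map a w s = sphere_frac (south_num a w s) (south_den a w s)"
proof (cases "s = -1")
  case True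
  then have "w = 0" using assms(1) by simp
  then show ?thesis
    using True sphere_frac_scale[of 2 1 "cnj a"]
    by (simp add: gauss_map_def south_num_def south_den_def mult.commute)
next
  case False
  let ?s = "complex_of_real s"
  have s: "1 + ?s \<noteq> 0" "1 - ?s \<noteq> 0"
    using False assms(2) by (simp_all add: one_plus_of_real_eq_0 one_minus_of_real_eq_0)
  have eq: "north_num a w s * south_den a w s = south_num a w s * north_den a w s"
  proof -
    have "north_num a w s * south_den a w s - south_num a w s * north_den a w s =
        (1 - a * cnj a) * (w * cnj w - (1 + ?s) * (1 - ?s))"
      unfolding north_num_def south_den_def south_num_def north_den_def by (simp add: algebra_simps)
    then show ?thesis using sphere_eq[OF assms(1)] by simp
  qed
  have "gauss_map a w s = sphere_frac (north_num a w s) (north_den a w s)"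
    using False by (simp add: gauss_map_def)
  also have "\<dots> = sphere_frac (south_num a w s) (south_den a w s)"
    by (rule sphere_frac_cong[OF eq north_nonzero[OF s(1)] south_nonzero[OF s(2)]])
  finally show ?thesis .
qed

lemma gauss_inv_den_eq:
  "gauss_inv_den a p q = complex_of_real ((cmod (p - a * q))\<^sup>2 + (cmod (q - cnj a * p))\<^sup>2)"
  by (simp add: gauss_inv_den_def mult_cnj_cmod del: complex_cnj_diff complex_cnj_mult)

lemma gauss_inv_den_nonzero:
  assumes "p \<noteq> 0 \<or> q \<noteq> 0"
  shows "gauss_inv_den a p q \<noteq> 0"
proof
  assume "gauss_inv_den a p q = 0"
  then have "p - a * q = 0 \<and> q - cnj a * p = 0"
    unfolding gauss_inv_den_eq of_real_eq_0_iff sum_power2_eq_zero_iff norm_eq_zero .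
  then have n0: "p - a * q = 0" "q - cnj a * p = 0" by blast+
  have "(1 - a * cnj a) * p = (p - a * q) + a * (q - cnj a * p)"
    "(1 - a * cnj a) * q = cnj a * (p - a * q) + (q - cnj a * p)"
    by (simp_all add: algebra_simps)
  then have "(1 - a * cnj a) * p = 0" "(1 - a * cnj a) * q = 0" unfolding n0 by simp_all
  then show False using one_minus_norm_nonzero assms by auto
qed

lemma of_real_gauss_inv_s:
  "complex_of_real (gauss_inv_s a p q) = gauss_inv_ht a p q / gauss_inv_den a p q"
proof -
  have "gauss_inv_ht a p q / gauss_inv_den a p q = complex_of_real
     (((cmod (q - cnj a * p))\<^sup>2 - (cmod (p - a * q))\<^sup>2) / ((cmod (p - a * q))\<^sup>2 + (cmod (q - cnj a * p))\<^sup>2))"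
    unfolding gauss_inv_den_eq
    by (simp add: gauss_inv_ht_def mult_cnj_cmod del: complex_cnj_diff complex_cnj_mult)
  then show ?thesis unfolding gauss_inv_s_def by (simp only: Re_complex_of_real)
qed

lemma gauss_inv_scale:
  assumes "l \<noteq> 0"
  shows "gauss_inv_w a (l * p) (l * q) = gauss_inv_w a p q"
    and "gauss_inv_s a (l * p) (l * q) = gauss_inv_s a p q"
proof -
  have n: "l * p - a * (l * q) = l * (p - a * q)" "l * q - cnj a * (l * p) = l * (q - cnj a * p)"
    by (simp_all add: algebra_simps)
  have "gauss_inv_num a (l * p) (l * q) = (l * cnj l) * gauss_inv_num a p q"
    "gauss_inv_ht a (l * p) (l * q) = (l * cnj l) * gauss_inv_ht a p q"
    "gauss_inv_den a (l * p) (l * q) = (l * cnj l) * gauss_inv_den a p q"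
    unfolding gauss_inv_num_def gauss_inv_ht_def gauss_inv_den_def n complex_cnj_mult[of l]
    by (simp_all add: algebra_simps)
  then show "gauss_inv_w a (l * p) (l * q) = gauss_inv_w a p q"
    "gauss_inv_s a (l * p) (l * q) = gauss_inv_s a p q"
    using assms by (simp_all add: gauss_inv_w_def gauss_inv_s_def)
qed

lemma gauss_inv_sphere_frac:
  assumes "p \<noteq> 0 \<or> q \<noteq> 0" "p' \<noteq> 0 \<or> q' \<noteq> 0" "sphere_frac p q = sphere_frac p' q'"
  shows "gauss_inv_w a p q = gauss_inv_w a p' q'" "gauss_inv_s a p q = gauss_inv_s a p' q'"
proof -
  have "\<exists>l. l \<noteq> 0 \<and> p' = l * p \<and> q' = l * q"
  proof (cases "q = 0")
    case True
    then show ?thesis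
      using assms by (intro exI[of _ "p' / p"]) (auto simp: sphere_frac_def split: if_splits)
  next
    case False
    then show ?thesis
      using assms by (intro exI[of _ "q' / q"]) (auto simp: sphere_frac_def field_simps split: if_splits)
  qed
  then obtain l where "l \<noteq> 0" "p' = l * p" "q' = l * q" by blast
  then show "gauss_inv_w a p q = gauss_inv_w a p' q'" "gauss_inv_s a p q = gauss_inv_s a p' q'"
    by (simp_all add: gauss_inv_scale)
qed

lemma gauss_inv_gauss_map:
  assumes on: "(cmod w)\<^sup>2 + s\<^sup>2 = 1" and pq: "gauss_map a w s = sphere_frac p q" "p \<noteq> 0 \<or> q \<noteq> 0"
  shows "gauss_inv_w a p q = w" "gauss_inv_s a p q = s"
proof -
  let ?s = "complex_of_real s" and ?e = "1 - a * cnj a"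
  note e = one_minus_norm_nonzero
  have ce: "cnj ?e = ?e" by (simp add: mult.commute)
  note ww = sphere_eq[OF on]
  have "gauss_inv_w a p q = w \<and> complex_of_real (gauss_inv_s a p q) = ?s"
  proof (cases "s = -1")
    case False
    have s: "1 + ?s \<noteq> 0"
      using False by (simp add: one_plus_of_real_eq_0)
    let ?p = "north_num a w s" and ?q = "north_den a w s"
    have "sphere_frac ?p ?q = sphere_frac p q" using pq(1) False by (simp add: gauss_map_def)
    from gauss_inv_sphere_frac[OF north_nonzero[OF s] pq(2) this]
    have eq: "gauss_inv_w a p q = gauss_inv_w a ?p ?q" "gauss_inv_s a p q = gauss_inv_s a ?p ?q"
      by simp_all
    \<comment> \<open>The common nonzero factor of \<open>gauss_inv_num\<close>,
      \<open>gauss_inv_ht\<close> and \<open>gauss_inv_den\<close> at the north form; it cancels in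
      both quotients.\<close>
    define K where "K = ?e * ?e * (2 * (1 + ?s))"
    have K: "K \<noteq> 0" unfolding K_def using e s by (simp del: distrib_left_numeral)
    have ww': "w * cnj w + (1 + ?s) * (1 + ?s) = 2 * (1 + ?s)"
      "(1 + ?s) * (1 + ?s) - w * cnj w = 2 * (1 + ?s) * ?s"
      unfolding ww by (simp_all add: algebra_simps)
    have "gauss_inv_den a ?p ?q = ?e * ?e * (w * cnj w + (1 + ?s) * (1 + ?s))"
      "gauss_inv_num a ?p ?q = ?e * ?e * (2 * w * (1 + ?s))"
      "gauss_inv_ht a ?p ?q = ?e * ?e * ((1 + ?s) * (1 + ?s) - w * cnj w)"
      unfolding gauss_inv_den_def gauss_inv_num_def gauss_inv_ht_def north_unmoebius complex_cnj_mult[of ?e] ce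
      by (simp_all add: algebra_simps)
    then have "gauss_inv_den a ?p ?q = K" "gauss_inv_num a ?p ?q = K * w" "gauss_inv_ht a ?p ?q = K * ?s"
      unfolding ww' K_def by (simp_all only: mult_ac)
    then show ?thesis
      unfolding eq of_real_gauss_inv_s using K by (simp add: gauss_inv_w_def)
  next
    case True
    then have w: "w = 0" using on by simp
    have "sphere_frac 1 (cnj a) = sphere_frac p q" using pq(1) True by (simp add: gauss_map_def)
    from gauss_inv_sphere_frac[OF _ pq(2) this]
    have eq: "gauss_inv_w a p q = gauss_inv_w a 1 (cnj a)" "gauss_inv_s a p q = gauss_inv_s a 1 (cnj a)"
      by simp_all
    have "gauss_inv_den a 1 (cnj a) = ?e * ?e" "gauss_inv_num a 1 (cnj a) = 0"
      "gauss_inv_ht a 1 (cnj a) = - (?e * ?e)"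
      unfolding gauss_inv_den_def gauss_inv_num_def gauss_inv_ht_def by (simp_all add: algebra_simps)
    then show ?thesis
      unfolding eq of_real_gauss_inv_s using e True w ce by (simp add: gauss_inv_w_def)
  qed
  then show "gauss_inv_w a p q = w" "gauss_inv_s a p q = s" by simp_all
qed

text \<open>This is the identity 4 |n|^2 |d|^2 + (|d|^2 - |n|^2)^2 = (|n|^2 + |d|^2)^2.\<close>

lemma gauss_inv_on_sphere:
  assumes "p \<noteq> 0 \<or> q \<noteq> 0"
  shows "(cmod (gauss_inv_w a p q))\<^sup>2 + (gauss_inv_s a p q)\<^sup>2 = 1"
proof -
  let ?n = "p - a * q" and ?d = "q - cnj a * p"
  note S = gauss_inv_den_nonzero[OF assms]
  have cS: "cnj (gauss_inv_den a p q) = gauss_inv_den a p q"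
    unfolding gauss_inv_den_eq by simp
  have "complex_of_real ((cmod (gauss_inv_w a p q))\<^sup>2 + (gauss_inv_s a p q)\<^sup>2) =
     gauss_inv_w a p q * cnj (gauss_inv_w a p q) + (complex_of_real (gauss_inv_s a p q))\<^sup>2"
    by (simp add: mult_cnj_cmod)
  also have "\<dots> = (gauss_inv_num a p q * cnj (gauss_inv_num a p q) + (gauss_inv_ht a p q)\<^sup>2) / (gauss_inv_den a p q)\<^sup>2"
    unfolding of_real_gauss_inv_s gauss_inv_w_def complex_cnj_divide cS
    by (simp add: power2_eq_square add_divide_distrib)
  also have "gauss_inv_num a p q * cnj (gauss_inv_num a p q) + (gauss_inv_ht a p q)\<^sup>2 = (gauss_inv_den a p q)\<^sup>2"
  proof -
    have "(2 * n * dc) * (2 * nc * d) + (d * dc - n * nc)\<^sup>2 = (n * nc + d * dc)\<^sup>2" for n nc d dc :: complex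
      by (simp add: power2_eq_square algebra_simps)
    from this[of ?n "cnj ?d" "cnj ?n" ?d] show ?thesis
      unfolding gauss_inv_num_def gauss_inv_ht_def gauss_inv_den_def complex_cnj_mult[of "2 * _"]
        complex_cnj_mult[of 2] complex_cnj_cnj by simp
  qed
  also have "(gauss_inv_den a p q)\<^sup>2 / (gauss_inv_den a p q)\<^sup>2 = of_real 1" using S by simp
  finally show ?thesis unfolding of_real_eq_iff .
qed

lemma gauss_map_gauss_inv:
  assumes pq: "p \<noteq> 0 \<or> q \<noteq> 0"
  shows "gauss_map a (gauss_inv_w a p q) (gauss_inv_s a p q) = sphere_frac p q"
proof -
  let ?n = "p - a * q" and ?d = "q - cnj a * p" and ?e = "1 - a * cnj a"
  let ?S = "gauss_inv_den a p q" and ?w = "gauss_inv_w a p q" and ?s = "gauss_inv_s a p q"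
  note S = gauss_inv_den_nonzero[OF pq] and e = one_minus_norm_nonzero
  have cS: "cnj ?S = ?S" unfolding gauss_inv_den_eq by simp
  have ed: "?n + a * ?d = ?e * p" "cnj a * ?n + ?d = ?e * q" by (simp_all add: algebra_simps)
  have fac: "l * x + b * (l * y) = l * (x + b * y)" "b * (l * x) + l * y = l * (b * x + y)" for l b x y :: complex
    by (simp_all only: distrib_left mult.left_commute)
  have ps: "1 + complex_of_real ?s = 2 * cnj ?d / ?S * ?d"
  proof -
    have "(n * nc + d * dc) + (d * dc - n * nc) = 2 * dc * d" for n nc d dc :: complex
      by (simp add: algebra_simps)
    then have "?S + gauss_inv_ht a p q = 2 * cnj ?d * ?d"
      unfolding gauss_inv_den_def gauss_inv_ht_def by blast
    then have "(?S + gauss_inv_ht a p q) / ?S = 2 * cnj ?d / ?S * ?d" by simp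
    then show ?thesis unfolding of_real_gauss_inv_s using S by (simp only: add_divide_distrib divide_self_if if_False)
  qed
  have ms: "1 - complex_of_real ?s = 2 * cnj ?n / ?S * ?n"
  proof -
    have "(n * nc + d * dc) - (d * dc - n * nc) = 2 * nc * n" for n nc d dc :: complex
      by (simp add: algebra_simps)
    then have "?S - gauss_inv_ht a p q = 2 * cnj ?n * ?n"
      unfolding gauss_inv_den_def gauss_inv_ht_def by blast
    then have "(?S - gauss_inv_ht a p q) / ?S = 2 * cnj ?n / ?S * ?n" by simp
    then show ?thesis unfolding of_real_gauss_inv_s using S by (simp only: diff_divide_distrib divide_self_if if_False)
  qed
  have w: "?w = 2 * cnj ?d / ?S * ?n" "cnj ?w = 2 * cnj ?n / ?S * ?d"
  proof -
    have "2 * x * y / r = 2 * y / r * x" "2 * x * y / r = 2 * x / r * y" for x y r :: complex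
      by simp_all
    then show "?w = 2 * cnj ?d / ?S * ?n" "cnj ?w = 2 * cnj ?n / ?S * ?d"
      unfolding gauss_inv_w_def gauss_inv_num_def complex_cnj_divide cS complex_cnj_mult[of "2 * _"]
        complex_cnj_mult[of 2] complex_cnj_cnj complex_cnj_numeral by blast+
  qed
  show ?thesis
  \<comment> \<open>When \<open>?d\<close> vanishes the point lies over s = -1, where the north form
    degenerates; then \<open>?n\<close> is nonzero and the south form takes over.\<close>
  proof (cases "?d = 0")
    case False
    let ?l = "2 * cnj ?d / ?S * ?e"
    have l: "?l \<noteq> 0" using False S e complex_cnj_zero_iff[of ?d] by (simp del: complex_cnj_diff)
    have "?s \<noteq> -1"
    proof
      assume "?s = -1"
      then have "2 * cnj ?d / ?S * ?d = 0" using ps by simp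
      then show False using False S complex_cnj_zero_iff[of ?d] by (simp del: complex_cnj_diff)
    qed
    then have "gauss_map a ?w ?s = sphere_frac (north_num a ?w ?s) (north_den a ?w ?s)"
      by (simp add: gauss_map_def)
    also have "north_num a ?w ?s = 2 * cnj ?d / ?S * (?n + a * ?d)"
      unfolding north_num_def ps w(1) by (rule fac)
    also have "\<dots> = ?l * p" unfolding ed by (simp only: mult.assoc)
    also have "north_den a ?w ?s = 2 * cnj ?d / ?S * (cnj a * ?n + ?d)"
      unfolding north_den_def ps w(1) by (rule fac)
    also have "\<dots> = ?l * q" unfolding ed by (simp only: mult.assoc)
    finally show ?thesis unfolding sphere_frac_scale[OF l] .
  next
    case True
    have n: "?n \<noteq> 0"
      using True S unfolding gauss_inv_den_def by force
    let ?l = "2 * cnj ?n / ?S * ?e"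
    have l: "?l \<noteq> 0" using n S e complex_cnj_zero_iff[of ?n] by (simp del: complex_cnj_diff)
    have "?s \<noteq> 1"
    proof
      assume "?s = 1"
      then have "2 * cnj ?n / ?S * ?n = 0" using ms by simp
      then show False using n S complex_cnj_zero_iff[of ?n] by (simp del: complex_cnj_diff)
    qed
    then have "gauss_map a ?w ?s = sphere_frac (south_num a ?w ?s) (south_den a ?w ?s)"
      by (rule gauss_map_south[OF gauss_inv_on_sphere[OF pq]])
    also have "south_num a ?w ?s = 2 * cnj ?n / ?S * (?n + a * ?d)"
      unfolding south_num_def ms w(2) by (rule fac)
    also have "\<dots> = ?l * p" unfolding ed by (simp only: mult.assoc)
    also have "south_den a ?w ?s = 2 * cnj ?n / ?S * (cnj a * ?n + ?d)"
      unfolding south_den_def ms w(2) by (rule fac)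
    also have "\<dots> = ?l * q" unfolding ed by (simp only: mult.assoc)
    finally show ?thesis unfolding sphere_frac_scale[OF l] .
  qed
qed

text \<open>Squared modulus of the denominator minus that of the numerator equals (1 - |a|^2) * 2 (1
  + s) * s, so its sign is that of s.\<close>

lemma gauss_map_hemispheres:
  assumes on: "(cmod w)\<^sup>2 + s\<^sup>2 = 1"
  shows "gauss_map a w s \<in> equator \<longleftrightarrow> s = 0"
    and "gauss_map a w s \<in> north \<longleftrightarrow> s > 0"
    and "gauss_map a w s \<in> south \<longleftrightarrow> s < 0"
proof -
  have a1: "1 - (cmod a)\<^sup>2 > 0" using a by (simp add: abs_square_less_1)
  have "(gauss_map a w s \<in> equator \<longleftrightarrow> s = 0) \<and> (gauss_map a w s \<in> north \<longleftrightarrow> s > 0) \<and>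
      (gauss_map a w s \<in> south \<longleftrightarrow> s < 0)"
  proof (cases "s = -1")
    case True
    then show ?thesis
      using a1 sphere_frac_hemispheres[of 1 "cnj a"] by (simp add: gauss_map_def)
  next
    case False
    let ?p = "north_num a w s" and ?q = "north_den a w s" and ?s = "complex_of_real s"
    have s: "1 + ?s \<noteq> 0" using False by (simp add: one_plus_of_real_eq_0)
    have "s\<^sup>2 \<le> 1" using on zero_le_power2[of "cmod w"] by linarith
    then have "s > -1" using False by (simp add: abs_square_le_1 abs_le_iff)
    then have fac: "(1 - (cmod a)\<^sup>2) * (2 * (1 + s)) > 0" using a1 by simp
    have sgn: "(K * r > 0 \<longleftrightarrow> r > 0) \<and> (K * r < 0 \<longleftrightarrow> r < 0) \<and> (K * r = 0 \<longleftrightarrow> r = 0)" if "K > 0" for K r :: real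
      using that by (simp add: zero_less_mult_iff mult_less_0_iff)
    have "complex_of_real ((cmod ?q)\<^sup>2 - (cmod ?p)\<^sup>2) = ?q * cnj ?q - ?p * cnj ?p"
      by (simp add: mult_cnj_cmod)
    also have "\<dots> = (1 - a * cnj a) * ((1 + ?s) * (1 + ?s) - w * cnj w)"
      unfolding north_num_def north_den_def by (simp add: algebra_simps)
    also have "\<dots> = (1 - a * cnj a) * (2 * (1 + ?s)) * ?s"
      unfolding sphere_eq[OF on] by (simp add: algebra_simps)
    also have "\<dots> = complex_of_real ((1 - (cmod a)\<^sup>2) * (2 * (1 + s)) * s)"
      by (simp add: mult_cnj_cmod)
    finally have eq: "(cmod ?q)\<^sup>2 - (cmod ?p)\<^sup>2 = (1 - (cmod a)\<^sup>2) * (2 * (1 + s)) * s"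
      unfolding of_real_eq_iff .
    have *: "(cmod ?q)\<^sup>2 - (cmod ?p)\<^sup>2 > 0 \<longleftrightarrow> s > 0" "(cmod ?q)\<^sup>2 - (cmod ?p)\<^sup>2 < 0 \<longleftrightarrow> s < 0"
      "(cmod ?q)\<^sup>2 - (cmod ?p)\<^sup>2 = 0 \<longleftrightarrow> s = 0"
      unfolding eq using sgn[OF fac, of s] by blast+
    show ?thesis
      using False * sphere_frac_hemispheres[OF north_nonzero[OF s], of w] by (auto simp: gauss_map_def)
  qed
  then show "gauss_map a w s \<in> equator \<longleftrightarrow> s = 0" "gauss_map a w s \<in> north \<longleftrightarrow> s > 0"
    "gauss_map a w s \<in> south \<longleftrightarrow> s < 0" by blast+
qed

end

section \<open>The Gauss map on the unit tangent bundle\<close>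

text \<open>The derivative of a quotient of affine functions is LA W * B Z - A Z * LB W divided by
  the square of B Z. Multiplication by a complex number scales inner products, so conformality need
  only be checked on that numerator.\<close>

lemma conformal_quotient_chart:
  fixes g :: "pt \<Rightarrow> pt \<Rightarrow> real"
  assumes lin: "bounded_linear LA" "bounded_linear LB" and A: "\<And>Z. A Z = a0 + LA Z" and B: "\<And>Z. B Z = b0 + LB Z"
    and U0: "open U0" "Z \<in> U0" and B0: "B Z \<noteq> 0"
    and f: "\<And>q. \<lbrakk>q \<in> M; q \<in> U0; B q \<noteq> 0\<rbrakk> \<Longrightarrow> f q = sphere_param b (A q / B q)"
    and K: "K > 0" and conf: "\<And>W W'. \<lbrakk>g Z W = 0; g Z W' = 0\<rbrakk> \<Longrightarrow>
      (LA W * B Z - A Z * LB W) \<bullet> (LA W' * B Z - A Z * LB W') = K * g W W'"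
  shows "\<exists>U F. conformal_chart g M f Z U F"
proof -
  have A': "A = (\<lambda>Z. a0 + LA Z)" and B': "B = (\<lambda>Z. b0 + LB Z)" using A B by auto
  have contB: "continuous_on UNIV B"
    unfolding B' by (intro continuous_intros linear_continuous_on lin)
  define U where "U = U0 \<inter> {q. B q \<noteq> 0}"
  define F where "F = (\<lambda>q. A q / B q)"
  have openU: "open U"
    unfolding U_def using contB by (intro open_Int U0 open_Collect_neq continuous_on_const)
  have "smooth_on U A" "smooth_on U B"
    unfolding A' B'
    by (rule smooth_on_add[OF openU smooth_on_const[OF openU] smooth_on_bounded_linear[OF lin(1) openU]]
        smooth_on_add[OF openU smooth_on_const[OF openU] smooth_on_bounded_linear[OF lin(2) openU]])+
  then have sm: "smooth_on U F"
    unfolding F_def by (rule smooth_on_divide[OF openU]) (simp add: U_def)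
  have ZU: "Z \<in> U" using U0 B0 by (simp add: U_def)
  have loc: "local_expr M f Z U F"
    unfolding local_expr_def using openU ZU f by (auto simp: U_def F_def)
  have dA: "(A has_derivative LA) (at Z)" and dB: "(B has_derivative LB) (at Z)"
    unfolding A' B' using lin by (auto intro!: derivative_eq_intros bounded_linear_imp_has_derivative)
  have "(F has_derivative (\<lambda>W. (LA W * B Z - A Z * LB W) / (B Z * B Z))) (at Z)"
    unfolding F_def by (rule has_derivative_divide'[OF dA dB B0])
  then have dF: "differential F Z = (\<lambda>W. (1 / (B Z * B Z)) * (LA W * B Z - A Z * LB W))"
    using frechet_derivative_at by fastforce
  have "differential F Z W \<bullet> differential F Z W' =
      ((cmod (1 / (B Z * B Z)))\<^sup>2 * K) * g W W'" if "g Z W = 0" "g Z W' = 0" for W W'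
    unfolding dF inner_complex_mult conf[OF that] by simp
  moreover have "(cmod (1 / (B Z * B Z)))\<^sup>2 * K > 0" using K B0 by simp
  ultimately show ?thesis using loc sm by blast
qed

text \<open>Exchanging A and B, that is passing to the chart at infinity, only changes the sign of
  the numerator of the derivative; one hypothesis serves both charts.\<close>

lemma conformal_sphere_frac_chart:
  fixes g :: "pt \<Rightarrow> pt \<Rightarrow> real"
  assumes lin: "bounded_linear LA" "bounded_linear LB" and A: "\<And>Z. A Z = a0 + LA Z" and B: "\<And>Z. B Z = b0 + LB Z"
    and U0: "open U0" "Z \<in> U0" and nz: "A Z \<noteq> 0 \<or> B Z \<noteq> 0"
    and f: "\<And>q. \<lbrakk>q \<in> M; q \<in> U0\<rbrakk> \<Longrightarrow> f q = sphere_frac (A q) (B q)"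
    and K: "K > 0" and conf: "\<And>W W'. \<lbrakk>g Z W = 0; g Z W' = 0\<rbrakk> \<Longrightarrow>
      (LA W * B Z - A Z * LB W) \<bullet> (LA W' * B Z - A Z * LB W') = K * g W W'"
  shows "\<exists>U F. conformal_chart g M f Z U F"
proof (cases "B Z = 0")
  case False
  show ?thesis
    by (rule conformal_quotient_chart[OF lin A B U0 False _ K conf, where b = True])
      (use f sphere_frac_eq_param in auto)
next
  case True
  then have AZ: "A Z \<noteq> 0" using nz by simp
  have "(LB W * A Z - B Z * LA W) \<bullet> (LB W' * A Z - B Z * LA W') = K * g W W'"
    if "g Z W = 0" "g Z W' = 0" for W W'
  proof -
    have "LB W * A Z - B Z * LA W = - (LA W * B Z - A Z * LB W)" for W by (simp add: mult.commute)
    then show ?thesis using conf[OF that] by (simp only: inner_minus_left inner_minus_right minus_minus)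
  qed
  then show ?thesis
    by (intro conformal_quotient_chart[OF lin(2,1) B A U0 AZ _ K, where b = False])
      (use f sphere_frac_eq_param in auto)
qed

text \<open>\<open>H\<close> cuts out the open region where the homogeneous form [A : B] represents
  the map; the chart depends on which of A and B is nonzero at \<open>p\<close>.\<close>

lemma analytic_sphere_frac_chart:
  assumes exp: "\<And>q. expandable A q" "\<And>q. expandable B q"
    and cont: "continuous_on UNIV A" "continuous_on UNIV B" "continuous_on UNIV H"
    and p: "H p \<noteq> (0::complex)" "A p \<noteq> 0 \<or> B p \<noteq> 0"
    and f: "\<And>q. \<lbrakk>q \<in> M; H q \<noteq> 0\<rbrakk> \<Longrightarrow> f q = sphere_frac (A q) (B q)"
  shows "\<exists>U F. local_expr M f p U F \<and> real_analytic_on U F"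
proof -
  have *: "\<exists>U F. local_expr M f p U F \<and> real_analytic_on U F"
    if "\<And>q. expandable A q" "\<And>q. expandable B q" "continuous_on UNIV B" "B p \<noteq> 0"
      "\<And>q. \<lbrakk>q \<in> M; H q \<noteq> 0; B q \<noteq> 0\<rbrakk> \<Longrightarrow> f q = sphere_param b (A q / B q)" for A B b
  proof (intro exI conjI)
    let ?U = "{q. H q \<noteq> 0} \<inter> {q. B q \<noteq> 0}"
    show "local_expr M f p ?U (\<lambda>q. A q / B q)"
      unfolding local_expr_def
    proof (intro conjI exI[of _ b] ballI)
      show "open ?U" by (intro open_Int open_Collect_neq cont(3) that(3) continuous_on_const)
    qed (use that(4,5) p(1) in auto)
    show "real_analytic_on ?U (\<lambda>q. A q / B q)"
      unfolding real_analytic_on_def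
      by (intro ballI expandable_imp_real_analytic_at expandable_divide that(1,2)) simp
  qed
  show ?thesis
  proof (cases "B p = 0")
    case False
    show ?thesis
      by (rule *[OF exp cont(2) False, of True]) (use f sphere_frac_eq_param(1) in auto)
  next
    case True
    then have "A p \<noteq> 0" using p(2) by simp
    from *[OF exp(2,1) cont(1) this, of False] show ?thesis
      using f sphere_frac_eq_param(2) by auto
  qed
qed

text \<open>The frame coordinate Z1 + i Z2 of a tangent vector, while \<open>E3_form\<close> gives
  Z3; together they identify the unit tangent sphere with the round one.\<close>

definition E3_coord :: "real \<Rightarrow> pt \<Rightarrow> pt \<Rightarrow> complex" where
  "E3_coord \<kappa> x Z = of_real (Lam \<kappa> (fst x)) * fst Z"

definition E3_lift :: "real \<Rightarrow> real \<Rightarrow> pt \<Rightarrow> complex \<Rightarrow> real \<Rightarrow> pt" where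
  "E3_lift \<kappa> \<tau> x w s = (of_real (1 / Lam \<kappa> (fst x)) * w,
     s - \<tau> * (Im (fst x) * Re w - Re (fst x) * Im w))"

lemma E3_metric_coord:
  "E3_metric \<kappa> \<tau> x Z W = E3_coord \<kappa> x Z \<bullet> E3_coord \<kappa> x W + E3_form \<kappa> \<tau> x Z * E3_form \<kappa> \<tau> x W"
  by (simp add: E3_metric_def E3_coord_def inner_complex_def power2_eq_square algebra_simps)

lemma bounded_linear_E3_coord: "bounded_linear (E3_coord \<kappa> x)"
  unfolding E3_coord_def by (intro bounded_linear_intros)

lemma bounded_linear_E3_form: "bounded_linear (E3_form \<kappa> \<tau> x)"
  unfolding E3_form_def
  by (intro bounded_linear_add bounded_linear_sub bounded_linear_const_mult bounded_linear_snd
      bounded_linear_compose[OF bounded_linear_Re bounded_linear_fst]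
      bounded_linear_compose[OF bounded_linear_Im bounded_linear_fst])

lemma bounded_bilinear_E3_metric: "bounded_bilinear (E3_metric \<kappa> \<tau> x)"
proof -
  have "bounded_linear (\<lambda>Z. (E3_coord \<kappa> x Z, E3_form \<kappa> \<tau> x Z))"
    by (intro bounded_linear_Pair bounded_linear_E3_coord bounded_linear_E3_form)
  from bounded_bilinear.comp[OF bounded_bilinear_inner this this]
  show ?thesis by (simp add: E3_metric_coord[abs_def] inner_Pair)
qed

lemma E3_metric_sym: "E3_metric \<kappa> \<tau> x Z W = E3_metric \<kappa> \<tau> x W Z"
  by (simp add: E3_metric_coord inner_commute)

lemma E3_metric_unit_iff:
  "E3_metric \<kappa> \<tau> x Z Z = 1 \<longleftrightarrow> (cmod (E3_coord \<kappa> x Z))\<^sup>2 + (E3_form \<kappa> \<tau> x Z)\<^sup>2 = 1"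
  by (simp add: E3_metric_coord power2_norm_eq_inner power2_eq_square[of "E3_form _ _ _ _"])

lemma E3_lift_coords:
  assumes "Lam \<kappa> (fst x) \<noteq> 0"
  shows "E3_coord \<kappa> x (E3_lift \<kappa> \<tau> x w s) = w" "E3_form \<kappa> \<tau> x (E3_lift \<kappa> \<tau> x w s) = s"
    "E3_lift \<kappa> \<tau> x (E3_coord \<kappa> x Z) (E3_form \<kappa> \<tau> x Z) = Z"
proof -
  show "E3_coord \<kappa> x (E3_lift \<kappa> \<tau> x w s) = w" "E3_lift \<kappa> \<tau> x (E3_coord \<kappa> x Z) (E3_form \<kappa> \<tau> x Z) = Z"
    using assms by (simp_all add: E3_coord_def E3_lift_def E3_form_def prod_eq_iff algebra_simps)
  have "Lam \<kappa> (fst x) * (Im (fst x) * (Re w / Lam \<kappa> (fst x)) - Re (fst x) * (Im w / Lam \<kappa> (fst x))) =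
      Im (fst x) * Re w - Re (fst x) * Im w"
    using assms by (simp add: right_diff_distrib)
  then show "E3_form \<kappa> \<tau> x (E3_lift \<kappa> \<tau> x w s) = s"
    by (simp add: E3_form_def E3_lift_def mult.assoc)
qed

lemma smooth_on_E3_lift:
  assumes "open S" "smooth_on S w" "smooth_on S s"
  shows "smooth_on S (\<lambda>z. E3_lift \<kappa> \<tau> x (w z) (s z))"
proof -
  let ?L = "\<lambda>w. (of_real (1 / Lam \<kappa> (fst x)) * w, - (\<tau> * (Im (fst x) * Re w - Re (fst x) * Im w)))"
  have L1: "bounded_linear ?L"
    by (intro bounded_linear_Pair bounded_linear_minus bounded_linear_sub bounded_linear_const_mult
        bounded_linear_ident bounded_linear_Re bounded_linear_Im)
  have L2: "bounded_linear (\<lambda>s :: real. (0 :: complex, s))"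
    by (intro bounded_linear_Pair bounded_linear_zero bounded_linear_ident)
  have "smooth_on S (\<lambda>z. ?L (w z) + (0, s z))"
    by (rule smooth_on_add[OF assms(1) smooth_on_linear_compose[OF assms(1) L1 assms(2)]
          smooth_on_linear_compose[OF assms(1) L2 assms(3)]])
  then show ?thesis by (simp add: E3_lift_def[abs_def])
qed

lemma smooth_on_gauss_inv:
  assumes a: "cmod a < 1" and S: "open S" and p: "smooth_on S p" and q: "smooth_on S q"
    and nz: "\<And>z. z \<in> S \<Longrightarrow> p z \<noteq> 0 \<or> q z \<noteq> 0"
  shows "smooth_on S (\<lambda>z. gauss_inv_w a (p z) (q z))" "smooth_on S (\<lambda>z. gauss_inv_s a (p z) (q z))"
proof -
  have n: "smooth_on S (\<lambda>z. p z - a * q z)" and d: "smooth_on S (\<lambda>z. q z - cnj a * p z)"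
    using smooth_on_add[OF S p smooth_on_mult[OF S smooth_on_const[OF S, of "- a"] q]]
      smooth_on_add[OF S q smooth_on_mult[OF S smooth_on_const[OF S, of "- cnj a"] p]] by simp_all
  note cn = smooth_on_linear_compose[OF S bounded_linear_cnj n]
    and cd = smooth_on_linear_compose[OF S bounded_linear_cnj d]
  have num: "smooth_on S (\<lambda>z. gauss_inv_num a (p z) (q z))"
    unfolding gauss_inv_num_def by (intro smooth_on_mult smooth_on_const S n cd)
  have den: "smooth_on S (\<lambda>z. gauss_inv_den a (p z) (q z))"
    unfolding gauss_inv_den_def by (intro smooth_on_add smooth_on_mult S n cn d cd)
  have "smooth_on S (\<lambda>z. (q z - cnj a * p z) * cnj (q z - cnj a * p z) +
      (- 1) * ((p z - a * q z) * cnj (p z - a * q z)))"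
    by (intro smooth_on_add smooth_on_mult smooth_on_const S n cn d cd)
  then have ht: "smooth_on S (\<lambda>z. gauss_inv_ht a (p z) (q z))"
    unfolding gauss_inv_ht_def by simp
  show "smooth_on S (\<lambda>z. gauss_inv_w a (p z) (q z))"
    unfolding gauss_inv_w_def
    by (rule smooth_on_divide[OF S num den]) (rule gauss_inv_den_nonzero[OF a nz])
  show "smooth_on S (\<lambda>z. gauss_inv_s a (p z) (q z))"
    unfolding gauss_inv_s_def
    by (intro smooth_on_linear_compose[OF S bounded_linear_Re] smooth_on_divide[OF S ht den])
      (rule gauss_inv_den_nonzero[OF a nz])
qed

definition E3_gauss :: "real \<Rightarrow> real \<Rightarrow> pt \<Rightarrow> pt \<Rightarrow> riemann_sphere" where
  "E3_gauss \<kappa> \<tau> x Z = gauss_map (of_real (cpar \<kappa>) * fst x) (E3_coord \<kappa> x Z) (E3_form \<kappa> \<tau> x Z)"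

text \<open>Conformality of stereographic projection: for tangent vectors these are the numerators
  of the derivative of w / (1 + \<epsilon> s). The sign \<epsilon> = 1 projects from the south pole
  and \<epsilon> = -1 from the north pole.\<close>

lemma inner_stereographic:
  fixes w \<omega> \<omega>' :: "'a::real_inner" and s \<sigma> \<sigma>' \<epsilon> :: real
  assumes "w \<bullet> w + s * s = 1" "w \<bullet> \<omega> + s * \<sigma> = 0" "w \<bullet> \<omega>' + s * \<sigma>' = 0" "\<epsilon> * \<epsilon> = 1"
  shows "((1 + \<epsilon> * s) *\<^sub>R \<omega> - (\<epsilon> * \<sigma>) *\<^sub>R w) \<bullet> ((1 + \<epsilon> * s) *\<^sub>R \<omega>' - (\<epsilon> * \<sigma>') *\<^sub>R w) =
    (1 + \<epsilon> * s)\<^sup>2 * (\<omega> \<bullet> \<omega>' + \<sigma> * \<sigma>')"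
proof -
  have e: "w \<bullet> w = 1 - s * s" "w \<bullet> \<omega> = - (s * \<sigma>)" "w \<bullet> \<omega>' = - (s * \<sigma>')" "\<omega> \<bullet> w = - (s * \<sigma>)"
    using assms by (auto simp: inner_commute[of \<omega>])
  have "((1 + \<epsilon> * s) *\<^sub>R \<omega> - (\<epsilon> * \<sigma>) *\<^sub>R w) \<bullet> ((1 + \<epsilon> * s) *\<^sub>R \<omega>' - (\<epsilon> * \<sigma>') *\<^sub>R w) =
     (1 + \<epsilon> * s)\<^sup>2 * (\<omega> \<bullet> \<omega>') + (1 + \<epsilon> * s) * (\<epsilon> * s) * \<sigma> * \<sigma>' * 2 + (\<epsilon> * \<epsilon>) * \<sigma> * \<sigma>' * (1 - s * s)"
    by (simp add: inner_diff_left inner_diff_right e power2_eq_square algebra_simps)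
  also have "\<dots> = (1 + \<epsilon> * s)\<^sup>2 * (\<omega> \<bullet> \<omega>') + \<sigma> * \<sigma>' * ((1 + \<epsilon> * s) * (\<epsilon> * s) * 2 + (1 - (\<epsilon> * s) * (\<epsilon> * s)))"
  proof -
    have "(\<epsilon> * s) * (\<epsilon> * s) = (\<epsilon> * \<epsilon>) * (s * s)" by simp
    then show ?thesis using assms(4) by (simp add: algebra_simps)
  qed
  also have "\<dots> = (1 + \<epsilon> * s)\<^sup>2 * (\<omega> \<bullet> \<omega>' + \<sigma> * \<sigma>')"
    by (simp add: power2_eq_square algebra_simps)
  finally show ?thesis .
qed

lemma cpar_mult_less_1:
  assumes "\<kappa> < 0" "x \<in> E3 \<kappa>"
  shows "cmod (of_real (cpar \<kappa>) * fst x) < 1"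
  using assms cpar_pos[OF assms(1)] by (auto simp: E3_def H2_iff norm_mult)

lemma E3_Lam_nonzero: "\<lbrakk>\<kappa> < 0; x \<in> E3 \<kappa>\<rbrakk> \<Longrightarrow> Lam \<kappa> (fst x) \<noteq> 0"
  using Lam_pos[of \<kappa> "fst x"] by (auto simp: E3_def)

lemma E3_gauss_chart:
  assumes \<kappa>: "\<kappa> < 0" and x: "x \<in> E3 \<kappa>" and Z: "E3_metric \<kappa> \<tau> x Z Z = 1"
  shows "\<exists>U F. conformal_chart (E3_metric \<kappa> \<tau> x) {Z. E3_metric \<kappa> \<tau> x Z Z = 1} (E3_gauss \<kappa> \<tau> x) Z U F"
proof -
  define a where "a = of_real (cpar \<kappa>) * fst x"
  have a: "cmod a < 1" unfolding a_def by (rule cpar_mult_less_1[OF \<kappa> x])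
  define e where "e = 1 - a * cnj a"
  have e: "e \<noteq> 0" unfolding e_def by (rule one_minus_norm_nonzero[OF a])
  let ?w = "E3_coord \<kappa> x" and ?s = "E3_form \<kappa> \<tau> x"
  let ?M = "{Z. E3_metric \<kappa> \<tau> x Z Z = 1}"
  note blw = bounded_linear_E3_coord[of \<kappa> x] and bls = bounded_linear_E3_form[of \<kappa> \<tau> x]
  have blc: "bounded_linear (\<lambda>Z. complex_of_real (?s Z))"
    by (rule bounded_linear_compose[OF bounded_linear_of_real bls])
  have blcw: "bounded_linear (\<lambda>Z. cnj (?w Z))"
    by (rule bounded_linear_compose[OF bounded_linear_cnj blw])
  have conts: "continuous_on UNIV ?s" by (rule linear_continuous_on[OF bls])
  have Zs: "?w Z \<bullet> ?w Z + ?s Z * ?s Z = 1" using Z by (simp add: E3_metric_coord)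
  show ?thesis
  proof (cases "?s Z = -1")
    case False
    let ?LA = "\<lambda>W. ?w W + a * of_real (?s W)" and ?LB = "\<lambda>W. cnj a * ?w W + of_real (?s W)"
    let ?A = "\<lambda>W. north_num a (?w W) (?s W)" and ?B = "\<lambda>W. north_den a (?w W) (?s W)"
    have lin: "bounded_linear ?LA" "bounded_linear ?LB"
      by (intro bounded_linear_add bounded_linear_const_mult blw blc)+
    have A: "?A W = a + ?LA W" and B: "?B W = 1 + ?LB W" for W
      by (simp_all add: north_num_def north_den_def algebra_simps)
    have nz: "?A Z \<noteq> 0 \<or> ?B Z \<noteq> 0"
      by (rule north_nonzero[OF a]) (use False in \<open>simp add: one_plus_of_real_eq_0\<close>)
    \<comment> \<open>The determinant \<open>e\<close> of the Moebius matrix splits off and leaves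
      the numerator for stereographic projection alone.\<close>
    have det: "?LA W * ?B Z - ?A Z * ?LB W = e * ((1 + 1 * ?s Z) *\<^sub>R ?w W - (1 * ?s W) *\<^sub>R ?w Z)" for W
      unfolding north_num_def north_den_def e_def scaleR_conv_of_real by (simp add: algebra_simps)
    have K: "(cmod e)\<^sup>2 * (1 + 1 * ?s Z)\<^sup>2 > 0" using e False by (simp add: add_eq_0_iff)
    show ?thesis
    proof (rule conformal_sphere_frac_chart[OF lin A B _ _ nz _ K])
      show "open {q. ?s q \<noteq> -1}" by (intro open_Collect_neq conts continuous_on_const)
      show "Z \<in> {q. ?s q \<noteq> -1}" using False by simp
      show "E3_gauss \<kappa> \<tau> x q = sphere_frac (?A q) (?B q)" if "q \<in> {q. ?s q \<noteq> -1}" for q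
        using that by (simp add: E3_gauss_def gauss_map_def a_def)
      fix W W' assume "E3_metric \<kappa> \<tau> x Z W = 0" "E3_metric \<kappa> \<tau> x Z W' = 0"
      then have "?w Z \<bullet> ?w W + ?s Z * ?s W = 0" "?w Z \<bullet> ?w W' + ?s Z * ?s W' = 0"
        by (simp_all add: E3_metric_coord)
      from inner_stereographic[OF Zs this, of 1]
      show "(?LA W * ?B Z - ?A Z * ?LB W) \<bullet> (?LA W' * ?B Z - ?A Z * ?LB W') =
          (cmod e)\<^sup>2 * (1 + 1 * ?s Z)\<^sup>2 * E3_metric \<kappa> \<tau> x W W'"
        unfolding det inner_complex_mult E3_metric_coord by simp
    qed
  next
    case True
    then have s1: "?s Z \<noteq> 1" by simp
    let ?LA = "\<lambda>W. a * cnj (?w W) - of_real (?s W)" and ?LB = "\<lambda>W. cnj (?w W) - cnj a * of_real (?s W)"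
    let ?A = "\<lambda>W. south_num a (?w W) (?s W)" and ?B = "\<lambda>W. south_den a (?w W) (?s W)"
    have lin: "bounded_linear ?LA" "bounded_linear ?LB"
      by (intro bounded_linear_sub bounded_linear_const_mult blcw blc)+
    have A: "?A W = 1 + ?LA W" and B: "?B W = cnj a + ?LB W" for W
      by (simp_all add: south_num_def south_den_def algebra_simps)
    have nz: "?A Z \<noteq> 0 \<or> ?B Z \<noteq> 0"
      by (rule south_nonzero[OF a]) (use s1 in \<open>simp add: one_minus_of_real_eq_0\<close>)
    \<comment> \<open>Near \<open>- xi\<close> the projection is from the opposite pole and
      conjugated; neither the conjugation nor the sign affects inner products.\<close>
    have det: "?LA W * ?B Z - ?A Z * ?LB W =
        - e * cnj ((1 + (-1) * ?s Z) *\<^sub>R ?w W - ((-1) * ?s W) *\<^sub>R ?w Z)" for W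
      unfolding south_num_def south_den_def e_def scaleR_conv_of_real by (simp add: algebra_simps)
    have K: "(cmod (- e))\<^sup>2 * (1 + (-1) * ?s Z)\<^sup>2 > 0" using e s1 by simp
    have inner_cnj: "cnj u \<bullet> cnj v = u \<bullet> v" for u v by (simp add: inner_complex_def)
    show ?thesis
    proof (rule conformal_sphere_frac_chart[OF lin A B _ _ nz _ K])
      show "open {q. ?s q \<noteq> 1}" by (intro open_Collect_neq conts continuous_on_const)
      show "Z \<in> {q. ?s q \<noteq> 1}" using s1 by simp
      show "E3_gauss \<kappa> \<tau> x q = sphere_frac (?A q) (?B q)" if "q \<in> ?M" "q \<in> {q. ?s q \<noteq> 1}" for q
        using gauss_map_south[OF a, of "?w q" "?s q"] that
        by (simp add: E3_gauss_def a_def E3_metric_unit_iff)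
      fix W W' assume "E3_metric \<kappa> \<tau> x Z W = 0" "E3_metric \<kappa> \<tau> x Z W' = 0"
      then have "?w Z \<bullet> ?w W + ?s Z * ?s W = 0" "?w Z \<bullet> ?w W' + ?s Z * ?s W' = 0"
        by (simp_all add: E3_metric_coord)
      from inner_stereographic[OF Zs this, of "-1"]
      show "(?LA W * ?B Z - ?A Z * ?LB W) \<bullet> (?LA W' * ?B Z - ?A Z * ?LB W') =
          (cmod (- e))\<^sup>2 * (1 + (-1) * ?s Z)\<^sup>2 * E3_metric \<kappa> \<tau> x W W'"
        unfolding det inner_complex_mult inner_cnj E3_metric_coord by simp
    qed
  qed
qed

definition sphere_rep_num :: "riemann_sphere \<Rightarrow> complex" where
  "sphere_rep_num p = (case p of None \<Rightarrow> 1 | Some z \<Rightarrow> z)"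

definition sphere_rep_den :: "riemann_sphere \<Rightarrow> complex" where
  "sphere_rep_den p = (case p of None \<Rightarrow> 0 | Some z \<Rightarrow> 1)"

lemma sphere_rep:
  "sphere_frac (sphere_rep_num p) (sphere_rep_den p) = p" "sphere_rep_num p \<noteq> 0 \<or> sphere_rep_den p \<noteq> 0"
  by (cases p; simp add: sphere_frac_def sphere_rep_num_def sphere_rep_den_def)+

lemma E3_gauss_conformal_diffeo:
  assumes \<kappa>: "\<kappa> < 0" and x: "x \<in> E3 \<kappa>"
  shows "conformal_diffeo_to_sphere (E3_metric \<kappa> \<tau> x) (E3_gauss \<kappa> \<tau> x)"
proof -
  define a where "a = of_real (cpar \<kappa>) * fst x"
  have a: "cmod a < 1" unfolding a_def by (rule cpar_mult_less_1[OF \<kappa> x])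
  note lift = E3_lift_coords[OF E3_Lam_nonzero[OF \<kappa> x]]
  let ?M = "{Z. E3_metric \<kappa> \<tau> x Z Z = 1}" and ?f = "E3_gauss \<kappa> \<tau> x"
  define h where "h p q = E3_lift \<kappa> \<tau> x (gauss_inv_w a p q) (gauss_inv_s a p q)" for p q
  have hM: "h p q \<in> ?M" and fh: "?f (h p q) = sphere_frac p q" if "p \<noteq> 0 \<or> q \<noteq> 0" for p q
    using gauss_inv_on_sphere[OF a that] gauss_map_gauss_inv[OF a that]
    by (simp_all add: h_def E3_metric_unit_iff E3_gauss_def lift a_def[symmetric])
  have hf: "h p q = Z" if "Z \<in> ?M" "?f Z = sphere_frac p q" "p \<noteq> 0 \<or> q \<noteq> 0" for Z p q
    using gauss_inv_gauss_map[OF a, of "E3_coord \<kappa> x Z" "E3_form \<kappa> \<tau> x Z" p q] that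
    by (simp add: h_def E3_metric_unit_iff E3_gauss_def a_def[symmetric] lift)
  have bij: "bij_betw ?f ?M UNIV"
  proof (rule bij_betwI[of _ _ _ "\<lambda>p. h (sphere_rep_num p) (sphere_rep_den p)"])
    show "(\<lambda>p. h (sphere_rep_num p) (sphere_rep_den p)) \<in> UNIV \<rightarrow> ?M"
      using hM[OF sphere_rep(2)] by blast
    show "?f (h (sphere_rep_num p) (sphere_rep_den p)) = p" for p
      using fh[OF sphere_rep(2)] sphere_rep(1) by simp
    show "h (sphere_rep_num (?f Z)) (sphere_rep_den (?f Z)) = Z" if "Z \<in> ?M" for Z
      by (rule hf[OF that sphere_rep(1)[symmetric] sphere_rep(2)])
  qed auto
  \<comment> \<open>The charts are the homogeneous points [z : 1] and [1 : z], so smoothness in both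
    follows from one formula.\<close>
  have inv: "inv_into ?M ?f (sphere_param b z) = h (if b then z else 1) (if b then 1 else z)" for b z
  proof (rule inv_into_f_eq)
    show "inj_on ?f ?M" using bij by (simp add: bij_betw_def)
    have nz: "(if b then z else 1) \<noteq> 0 \<or> (if b then 1 else z) \<noteq> 0" by simp
    show "h (if b then z else 1) (if b then 1 else z) \<in> ?M" by (rule hM[OF nz])
    show "?f (h (if b then z else 1) (if b then 1 else z)) = sphere_param b z"
      unfolding fh[OF nz] by (simp add: sphere_param_def sphere_frac_def)
  qed
  have "smooth_on UNIV (\<lambda>z. h (p z) (q z))"
    if "smooth_on UNIV p" "smooth_on UNIV q" "\<And>z. p z \<noteq> 0 \<or> q z \<noteq> 0" for p q :: "complex \<Rightarrow> complex"
    unfolding h_def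
    by (rule smooth_on_E3_lift[OF open_UNIV smooth_on_gauss_inv[OF a open_UNIV that]])
  note sm = this
  have "smooth_on UNIV (\<lambda>z. inv_into ?M ?f (sphere_param b z))" for b
  proof -
    have id: "smooth_on UNIV (\<lambda>z :: complex. z)"
      by (rule smooth_on_bounded_linear[OF bounded_linear_ident open_UNIV])
    show ?thesis
    proof (cases b)
      case True
      then show ?thesis unfolding inv using sm[OF id smooth_on_const[OF open_UNIV, of 1]] by simp
    next
      case False
      then show ?thesis unfolding inv using sm[OF smooth_on_const[OF open_UNIV, of 1] id] by simp
    qed
  qed
  then show ?thesis
    unfolding conformal_diffeo_to_sphere_def using bij E3_gauss_chart[OF \<kappa> x]
    by (intro conjI allI impI)
qed

text \<open>Multiplying both homogeneous coordinates by 1 / Lam clears denominators: they become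
  polynomials in the ambient real coordinates of base point and vector, and only the final quotient
  needs the reciprocal series.\<close>

lemma E3_gauss_real_analytic:
  assumes \<kappa>: "\<kappa> < 0" and f: "\<And>x Z. (x, Z) \<in> UE \<kappa> \<tau> \<Longrightarrow> f (x, Z) = E3_gauss \<kappa> \<tau> x Z"
  shows "real_analytic_to_sphere (UE \<kappa> \<tau>) f"
proof -
  let ?\<zeta> = "\<lambda>q :: pt \<times> pt. fst (fst q)" and ?v = "\<lambda>q :: pt \<times> pt. fst (snd q)"
  let ?u = "\<lambda>q :: pt \<times> pt. complex_of_real (snd (snd q))"
  let ?c = "complex_of_real (cpar \<kappa>)"
  \<comment> \<open>This is 1 / Lam extended as a polynomial to the whole ambient space.\<close>
  define l where "l q = 1 - ?c * ?c * (?\<zeta> q * cnj (?\<zeta> q))" for q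
  \<comment> \<open>The first summand is \<tau> times Im \<zeta> Re v - Re \<zeta> Im v, so
    \<open>h\<close> is \<open>l\<close> times the fibre coordinate \<open>E3_form\<close>.\<close>
  define h where "h q = of_real \<tau> * (1 / (2 * \<i>)) * (?\<zeta> q * cnj (?v q) - cnj (?\<zeta> q) * ?v q) + l q * ?u q" for q
  define A1 where "A1 q = ?v q + ?c * ?\<zeta> q * (l q + h q)" for q
  define B1 where "B1 q = ?c * cnj (?\<zeta> q) * ?v q + (l q + h q)" for q
  define A2 where "A2 q = (l q - h q) + ?c * ?\<zeta> q * cnj (?v q)" for q
  define B2 where "B2 q = ?c * cnj (?\<zeta> q) * (l q - h q) + cnj (?v q)" for q
  have bl: "bounded_linear ?\<zeta>" "bounded_linear ?v" "bounded_linear (\<lambda>q :: pt \<times> pt. snd (snd q))"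
    by (rule bounded_linear_compose[OF bounded_linear_fst bounded_linear_fst]
        bounded_linear_compose[OF bounded_linear_fst bounded_linear_snd]
        bounded_linear_compose[OF bounded_linear_snd bounded_linear_snd])+
  have e: "expandable ?\<zeta> q" "expandable ?v q" "expandable ?u q" "expandable (\<lambda>q. cnj (?\<zeta> q)) q"
    "expandable (\<lambda>q. cnj (?v q)) q" for q
    by (rule expandable_linear, rule bounded_linear.linear, rule bl bounded_linear_compose[OF bounded_linear_cnj]
        bounded_linear_compose[OF bounded_linear_of_real], (rule bl)?)+
  have el: "expandable l q" for q
    unfolding l_def[abs_def] by (intro expandable_diff expandable_mult expandable_const e)
  have eh: "expandable h q" for q
    unfolding h_def[abs_def] by (intro expandable_add expandable_diff expandable_mult expandable_const e el)
  have E: "expandable A1 q" "expandable B1 q" "expandable A2 q" "expandable B2 q" for q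
    unfolding A1_def[abs_def] B1_def[abs_def] A2_def[abs_def] B2_def[abs_def]
    by (intro expandable_add expandable_diff expandable_mult expandable_const e el eh)+
  have cl: "continuous_on UNIV l" unfolding l_def[abs_def] by (intro continuous_intros)
  have ch: "continuous_on UNIV h" unfolding h_def[abs_def] by (intro continuous_intros cl)
  have C: "continuous_on UNIV A1" "continuous_on UNIV B1" "continuous_on UNIV A2" "continuous_on UNIV B2"
    "continuous_on UNIV (\<lambda>q. l q + h q)" "continuous_on UNIV (\<lambda>q. l q - h q)"
    unfolding A1_def[abs_def] B1_def[abs_def] A2_def[abs_def] B2_def[abs_def]
    by (intro continuous_intros cl ch)+
  have key: "\<exists>a w s. cmod a < 1 \<and> (cmod w)\<^sup>2 + s\<^sup>2 = 1 \<and> f q = gauss_map a w s \<and> l q \<noteq> 0 \<and>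
      l q + h q = l q * (1 + of_real s) \<and> l q - h q = l q * (1 - of_real s) \<and>
      A1 q = l q * north_num a w s \<and> B1 q = l q * north_den a w s \<and>
      A2 q = l q * south_num a w s \<and> B2 q = l q * south_den a w s" if q: "q \<in> UE \<kappa> \<tau>" for q
  proof -
    obtain x Z where qx: "q = (x, Z)" by (cases q)
    have x: "x \<in> E3 \<kappa>" and Z: "E3_metric \<kappa> \<tau> x Z Z = 1" using q by (auto simp: UE_def qx)
    define a where "a = ?c * fst x"
    define w where "w = E3_coord \<kappa> x Z"
    define s where "s = E3_form \<kappa> \<tau> x Z"
    have L: "Lam \<kappa> (fst x) \<noteq> 0" by (rule E3_Lam_nonzero[OF \<kappa> x])
    have lL: "l q = of_real (1 / Lam \<kappa> (fst x))"
      by (simp add: l_def qx Lam_def mult_cnj_cmod power2_eq_square)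
    have l0: "l q \<noteq> 0" using L by (simp add: lL)
    have v: "fst Z = l q * w" using L by (simp add: lL w_def E3_coord_def)
    have cl: "cnj (l q) = l q" by (simp add: lL)
    have hs: "h q = l q * of_real s"
    proof -
      have im: "(1 / (2 * \<i>)) * (y * cnj z - cnj y * z) = of_real (Im y * Re z - Re y * Im z)" for y z
      proof -
        have "y * cnj z - cnj y * z = (2 * \<i>) * of_real (Im y * Re z - Re y * Im z)"
          by (simp add: complex_eq_iff algebra_simps)
        then show ?thesis by simp
      qed
      have "h q = of_real \<tau> * of_real (Im (fst x) * Re (fst Z) - Re (fst x) * Im (fst Z)) + l q * of_real (snd Z)"
        unfolding h_def qx fst_conv snd_conv mult.assoc[of "of_real \<tau>"] im ..
      also have "\<dots> = l q * of_real s"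
        using L by (simp add: lL s_def E3_form_def field_simps)
      finally show ?thesis .
    qed
    have "A1 q = l q * north_num a w s" "B1 q = l q * north_den a w s"
      "A2 q = l q * south_num a w s" "B2 q = l q * south_den a w s"
      unfolding A1_def B1_def A2_def B2_def hs north_num_def north_den_def south_num_def south_den_def
      by (simp_all add: qx v a_def cl[unfolded qx] algebra_simps)
    moreover have "f q = gauss_map a w s" using f[of x Z] q by (simp add: qx E3_gauss_def a_def w_def s_def)
    moreover have "(cmod w)\<^sup>2 + s\<^sup>2 = 1" using Z by (simp add: E3_metric_unit_iff w_def s_def)
    moreover have "cmod a < 1" unfolding a_def by (rule cpar_mult_less_1[OF \<kappa> x])
    ultimately show ?thesis using l0 hs by (intro exI[of _ a] exI[of _ w] exI[of _ s]) (simp add: algebra_simps)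
  qed
  have f1: "f q = sphere_frac (A1 q) (B1 q)" if "q \<in> UE \<kappa> \<tau>" "l q + h q \<noteq> 0" for q
    using key[OF that(1)] that(2)
    by (auto simp: sphere_frac_scale gauss_map_def one_plus_of_real_eq_0)
  have f2: "f q = sphere_frac (A2 q) (B2 q)" if q: "q \<in> UE \<kappa> \<tau>" "l q - h q \<noteq> 0" for q
  proof -
    obtain a w s where k: "cmod a < 1" "(cmod w)\<^sup>2 + s\<^sup>2 = 1" "f q = gauss_map a w s" "l q \<noteq> 0"
      "l q - h q = l q * (1 - of_real s)" "A2 q = l q * south_num a w s" "B2 q = l q * south_den a w s"
      using key[OF q(1)] by blast
    have "s \<noteq> 1" using q(2) unfolding k(5) by auto
    then show ?thesis
      unfolding k(3,6,7) sphere_frac_scale[OF k(4)] by (rule gauss_map_south[OF k(1,2)])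
  qed
  have nz1: "A1 q \<noteq> 0 \<or> B1 q \<noteq> 0" if q: "q \<in> UE \<kappa> \<tau>" "l q + h q \<noteq> 0" for q
    using key[OF q(1)] q(2) north_nonzero by auto
  have nz2: "A2 q \<noteq> 0 \<or> B2 q \<noteq> 0" if q: "q \<in> UE \<kappa> \<tau>" "l q - h q \<noteq> 0" for q
  proof -
    obtain a w s where k: "cmod a < 1" "l q \<noteq> 0" "l q - h q = l q * (1 - of_real s)"
      "A2 q = l q * south_num a w s" "B2 q = l q * south_den a w s"
      using key[OF q(1)] by blast
    have "1 - complex_of_real s \<noteq> 0" using q(2) unfolding k(3) by auto
    from south_nonzero[OF k(1) this, of w] show ?thesis unfolding k(4,5) using k(2) by auto
  qed
  show ?thesis
    unfolding real_analytic_to_sphere_def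
  proof
    fix p assume p: "p \<in> UE \<kappa> \<tau>"
    show "\<exists>U F. local_expr (UE \<kappa> \<tau>) f p U F \<and> real_analytic_on U F"
    proof (cases "l p + h p = 0")
      case False
      show ?thesis
        by (rule analytic_sphere_frac_chart[OF E(1,2) C(1,2,5) False nz1[OF p False] f1])
    next
      case True
      have "l p - h p \<noteq> 0"
      proof
        assume "l p - h p = 0"
        then have "2 * l p = 0" using True by (simp add: algebra_simps)
        then show False using key[OF p] by auto
      qed
      show ?thesis
        by (rule analytic_sphere_frac_chart[OF E(3,4) C(3,4,6) \<open>l p - h p \<noteq> 0\<close> nz2[OF p \<open>l p - h p \<noteq> 0\<close>] f2])
    qed
  qed
qed

section \<open>Equivariance\<close>

lemma psi_sphere_frac:
  assumes "p \<noteq> 0 \<or> q \<noteq> 0"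
  shows "psi M (sphere_frac p q) = sphere_frac (M$1$1 * p + M$1$2 * q) (M$2$1 * p + M$2$2 * q)"
proof (cases "q = 0")
  case True
  then show ?thesis
    using assms sphere_frac_scale[of p "M$1$1" "M$2$1"] by (simp add: sphere_frac_def[of p 0] mult.commute)
next
  case False
  have "q * (M$1$1 * (p / q) + M$1$2) = M$1$1 * p + M$1$2 * q" "q * (M$2$1 * (p / q) + M$2$2) = M$2$1 * p + M$2$2 * q"
    using False by (simp_all add: field_simps)
  then show ?thesis
    using False sphere_frac_scale[of q "M$1$1 * (p / q) + M$1$2" "M$2$1 * (p / q) + M$2$2"]
    by (simp add: sphere_frac_def[of p q])
qed

lemma SU11_denom_nonzero:
  assumes "(cmod \<alpha>)\<^sup>2 - (cmod \<beta>)\<^sup>2 = 1" "cmod a \<le> 1"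
  shows "cnj \<beta> * a + cnj \<alpha> \<noteq> 0"
proof
  assume "cnj \<beta> * a + cnj \<alpha> = 0"
  then have "cnj \<alpha> = - (cnj \<beta> * a)" by (simp add: eq_neg_iff_add_eq_0 add.commute)
  then have "cmod (cnj \<alpha>) = cmod (- (cnj \<beta> * a))" by simp
  then have "cmod \<alpha> = cmod \<beta> * cmod a" by (simp add: norm_mult)
  then have "cmod \<alpha> \<le> cmod \<beta>" using assms(2) by (simp add: mult_left_le)
  then have "(cmod \<alpha>)\<^sup>2 \<le> (cmod \<beta>)\<^sup>2" by (intro power_mono) auto
  then show False using assms(1) by linarith
qed

lemma SU11_det: "(cmod \<alpha>)\<^sup>2 - (cmod \<beta>)\<^sup>2 = 1 \<Longrightarrow> \<alpha> * cnj \<alpha> - \<beta> * cnj \<beta> = 1"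
  unfolding mult_cnj_cmod of_real_diff[symmetric] by simp

text \<open>With a' the image of a, the matrix of M composed with the Moebius map of a is that of
  the map of a' composed with the rotation by cnj D / D. Homogeneous coordinates on the two sides
  differ by the factor D.\<close>

lemma gauss_map_SU11:
  fixes M :: "complex^2^2"
  assumes a: "cmod a < 1" and M: "M$1$1 = \<alpha>" "M$1$2 = \<beta>" "M$2$1 = cnj \<beta>" "M$2$2 = cnj \<alpha>"
    and det: "(cmod \<alpha>)\<^sup>2 - (cmod \<beta>)\<^sup>2 = 1"
  defines "D \<equiv> cnj \<beta> * a + cnj \<alpha>"
  shows "gauss_map ((\<alpha> * a + \<beta>) / D) (w * cnj D / D) s = psi M (gauss_map a w s)"
proof -
  have D: "D \<noteq> 0" unfolding D_def by (rule SU11_denom_nonzero[OF det]) (use a in simp)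
  have cD: "cnj D = \<beta> * cnj a + \<alpha>" by (simp add: D_def)
  have cD0: "cnj D \<noteq> 0" using D by simp
  show ?thesis
  proof (cases "s = -1")
    case False
    let ?p = "north_num a w s" and ?q = "north_den a w s" and ?t = "1 + complex_of_real s"
    have nz: "?p \<noteq> 0 \<or> ?q \<noteq> 0" by (rule north_nonzero[OF a]) (use False in \<open>simp add: one_plus_of_real_eq_0\<close>)
    have n: "north_num ((\<alpha> * a + \<beta>) / D) (w * cnj D / D) s = inverse D * (\<alpha> * ?p + \<beta> * ?q)"
    proof -
      have "\<alpha> * ?p + \<beta> * ?q = w * cnj D + (\<alpha> * a + \<beta>) * ?t"
        unfolding north_num_def north_den_def cD by (simp add: algebra_simps)
      then show ?thesis
        unfolding north_num_def[of "_ / D"] by (simp add: divide_inverse algebra_simps)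
    qed
    have d: "north_den ((\<alpha> * a + \<beta>) / D) (w * cnj D / D) s = inverse D * (cnj \<beta> * ?p + cnj \<alpha> * ?q)"
    proof -
      have "cnj \<beta> * ?p + cnj \<alpha> * ?q = cnj (\<alpha> * a + \<beta>) * w + D * ?t"
        unfolding north_num_def north_den_def D_def by (simp add: algebra_simps)
      moreover have "cnj ((\<alpha> * a + \<beta>) / D) * (w * cnj D / D) = inverse D * (cnj (\<alpha> * a + \<beta>) * w)"
        unfolding complex_cnj_divide using cD0 by (simp add: divide_inverse)
      moreover have "?t = inverse D * (D * ?t)" using D by simp
      ultimately show ?thesis
        unfolding north_den_def[of "_ / D"] by (simp only: distrib_left)
    qed
    have "gauss_map ((\<alpha> * a + \<beta>) / D) (w * cnj D / D) s =
        sphere_frac (\<alpha> * ?p + \<beta> * ?q) (cnj \<beta> * ?p + cnj \<alpha> * ?q)"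
      unfolding gauss_map_def n d using False D by (simp add: sphere_frac_scale)
    also have "\<dots> = psi M (gauss_map a w s)"
      using False by (simp add: gauss_map_def psi_sphere_frac[OF nz] M)
    finally show ?thesis .
  next
    case True
    \<comment> \<open>At the south pole the homogeneous coordinates on the two sides differ by
      \<open>cnj D\<close> instead of \<open>D\<close>.\<close>
    have c: "cnj ((\<alpha> * a + \<beta>) / D) = inverse (cnj D) * (cnj \<beta> + cnj \<alpha> * cnj a)"
      unfolding complex_cnj_divide by (simp add: divide_inverse algebra_simps)
    have "gauss_map ((\<alpha> * a + \<beta>) / D) (w * cnj D / D) s =
        sphere_frac (inverse (cnj D) * cnj D) (inverse (cnj D) * (cnj \<beta> + cnj \<alpha> * cnj a))"
      using True cD0 by (simp add: gauss_map_def c del: complex_cnj_divide)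
    also have "\<dots> = sphere_frac (\<alpha> * 1 + \<beta> * cnj a) (cnj \<beta> * 1 + cnj \<alpha> * cnj a)"
      by (subst sphere_frac_scale[OF nonzero_imp_inverse_nonzero[OF cD0]]) (simp add: cD add.commute)
    also have "\<dots> = psi M (gauss_map a w s)"
      using True by (simp add: gauss_map_def psi_sphere_frac M)
    finally show ?thesis .
  qed
qed

section \<open>Isometries over a prescribed Moebius map\<close>

lemma open_E3: "open (E3 \<kappa>)"
proof -
  have "H2 \<kappa> = ball 0 (1 / cpar \<kappa>)" by (auto simp: H2_def)
  then show ?thesis by (simp add: E3_def open_Times)
qed

lemma connected_E3: "connected (E3 \<kappa>)"
proof -
  have "H2 \<kappa> = ball 0 (1 / cpar \<kappa>)" by (auto simp: H2_def)
  then show ?thesis by (simp add: E3_def connected_Times)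
qed

lemma sphere_degree_cong:
  "(\<And>v. norm v = 1 \<Longrightarrow> h v = h' v) \<Longrightarrow> sphere_degree h = sphere_degree h'"
  unfolding sphere_degree_def
  by (intro Brouwer_degree2_eq) (simp add: nsphere_2 norm_pt_of_coords)

lemma E3_metric_xi: "E3_metric \<kappa> \<tau> x Z xi = E3_form \<kappa> \<tau> x Z"
  by (simp add: E3_metric_coord E3_coord_def E3_form_def xi_def)

lemma phi_eq:
  fixes M :: "complex^2^2"
  assumes "M$1$1 = \<alpha>" "M$1$2 = \<beta>" "M$2$1 = cnj \<beta>" "M$2$2 = cnj \<alpha>"
  shows "phi \<kappa> M \<zeta> = of_real (1 / cpar \<kappa>) *
    ((\<alpha> * (of_real (cpar \<kappa>) * \<zeta>) + \<beta>) / (cnj \<beta> * (of_real (cpar \<kappa>) * \<zeta>) + cnj \<alpha>))"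
  by (simp add: phi_def moebius_def assms)

locale horizontal_isometry =
  fixes \<kappa> \<tau> :: real and f :: "pt \<Rightarrow> pt" and M :: "complex^2^2" and \<alpha> \<beta> :: complex
  assumes \<kappa>: "\<kappa> < 0" and iso: "f \<in> isometries \<kappa> \<tau>"
    and M: "M$1$1 = \<alpha>" "M$1$2 = \<beta>" "M$2$1 = cnj \<beta>" "M$2$2 = cnj \<alpha>"
    and det: "(cmod \<alpha>)\<^sup>2 - (cmod \<beta>)\<^sup>2 = 1"
    and hor: "is_horizontal_part \<kappa> f (phi \<kappa> M)"
begin

definition c :: complex where "c = of_real (cpar \<kappa>)"

definition denom :: "complex \<Rightarrow> complex" where
  "denom \<zeta> = cnj \<beta> * (c * \<zeta>) + cnj \<alpha>"

lemma c_nonzero: "c \<noteq> 0"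
  using cpar_pos[OF \<kappa>] by (simp add: c_def)

lemma denom_nonzero:
  assumes "\<zeta> \<in> H2 \<kappa>"
  shows "denom \<zeta> \<noteq> 0"
  unfolding denom_def
  by (rule SU11_denom_nonzero[OF det])
    (use assms cpar_pos[OF \<kappa>] in \<open>simp add: H2_iff[OF \<kappa>] c_def norm_mult\<close>)

lemma fst_E3: "x \<in> E3 \<kappa> \<Longrightarrow> fst x \<in> H2 \<kappa>"
  by (auto simp: E3_def)

lemma f_in_E3: "x \<in> E3 \<kappa> \<Longrightarrow> f x \<in> E3 \<kappa>"
  using iso by (auto simp: isometries_def)

lemma fst_f:
  assumes "x \<in> E3 \<kappa>"
  shows "fst (f x) = (\<alpha> * (c * fst x) + \<beta>) / denom (fst x) / c"
  using hor assms by (simp add: is_horizontal_part_def hproj_def phi_eq[OF M] denom_def c_def mult_ac)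

lemma smooth_f: "smooth_on (E3 \<kappa>) f"
  using iso by (simp add: isometries_def)

lemma f_has_derivative:
  "x \<in> E3 \<kappa> \<Longrightarrow> (f has_derivative differential f x) (at x)"
  by (rule smooth_on_has_derivative[OF smooth_f])

text \<open>A Moebius map with determinant 1 has derivative 1 / denom^2, and the scalings by
  \<open>c\<close> cancel.\<close>

lemma fst_derivative:
  assumes x: "x \<in> E3 \<kappa>"
  shows "fst (differential f x v) = fst v / (denom (fst x))\<^sup>2"
proof -
  let ?D = "denom (fst x)"
  have D: "?D \<noteq> 0" by (rule denom_nonzero[OF fst_E3[OF x]])
  have d: "((\<lambda>y. (\<alpha> * (c * y) + \<beta>) / denom y / c) has_field_derivative
      ((\<alpha> * c) * ?D - (\<alpha> * (c * fst x) + \<beta>) * (cnj \<beta> * c)) / (?D * ?D) / c) (at (fst x))"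
  proof -
    have "((\<lambda>y. \<alpha> * (c * y) + \<beta>) has_field_derivative \<alpha> * c) (at (fst x))"
      by (auto intro!: derivative_eq_intros)
    moreover have "(denom has_field_derivative cnj \<beta> * c) (at (fst x))"
      unfolding denom_def[abs_def] by (auto intro!: derivative_eq_intros)
    ultimately show ?thesis using D by (intro DERIV_cdivide DERIV_divide)
  qed
  have eq: "((\<alpha> * c) * ?D - (\<alpha> * (c * fst x) + \<beta>) * (cnj \<beta> * c)) / (?D * ?D) / c = 1 / ?D\<^sup>2"
  proof -
    have "(\<alpha> * c) * ?D - (\<alpha> * (c * fst x) + \<beta>) * (cnj \<beta> * c) = c * (\<alpha> * cnj \<alpha> - \<beta> * cnj \<beta>)"
      by (simp add: denom_def algebra_simps)
    then show ?thesis using SU11_det[OF det] c_nonzero by (simp add: power2_eq_square)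
  qed
  have "((\<lambda>y. (\<alpha> * (c * y) + \<beta>) / denom y / c) has_derivative (\<lambda>h. 1 / ?D\<^sup>2 * h)) (at (fst x))"
    using d unfolding eq has_field_derivative_def .
  from diff_chain_at[OF has_derivative_fst[OF has_derivative_ident] this]
  have 1: "((\<lambda>y. (\<alpha> * (c * fst y) + \<beta>) / denom (fst y) / c) has_derivative (\<lambda>v. fst v / ?D\<^sup>2)) (at x)"
    by (simp add: o_def)
  have "((\<lambda>y. fst (f y)) has_derivative (\<lambda>v. fst v / ?D\<^sup>2)) (at x)"
    by (rule has_derivative_transform_within_open[OF 1 open_E3 x]) (simp add: fst_f)
  from has_derivative_unique[OF has_derivative_fst[OF f_has_derivative[OF x]] this]
  show ?thesis by (rule fun_cong)
qed

lemma isometry: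
  "x \<in> E3 \<kappa> \<Longrightarrow> E3_metric \<kappa> \<tau> (f x) (differential f x v) (differential f x w) =
     E3_metric \<kappa> \<tau> x v w"
  using iso unfolding isometries_def by blast

text \<open>Because \<open>f\<close> covers a map of the base, it sends fibres to fibres and
  \<open>xi\<close> to a multiple of \<open>xi\<close>; this is the multiple.\<close>

definition vert :: "pt \<Rightarrow> real" where
  "vert x = snd (differential f x xi)"

lemma derivative_xi:
  assumes "x \<in> E3 \<kappa>"
  shows "differential f x xi = vert x *\<^sub>R xi"
  using fst_derivative[OF assms, of xi] by (simp add: prod_eq_iff vert_def xi_def)

lemma vert_cases:
  assumes "x \<in> E3 \<kappa>"
  shows "vert x = 1 \<or> vert x = -1"
proof -
  have "vert x * vert x = 1"
    using isometry[OF assms, of xi xi] unfolding derivative_xi[OF assms]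
    by (simp add: E3_metric_coord E3_coord_def E3_form_def xi_def)
  then show ?thesis by (simp add: square_eq_1_iff)
qed

lemma vert_constant: "(\<forall>x\<in>E3 \<kappa>. vert x = 1) \<or> (\<forall>x\<in>E3 \<kappa>. vert x = -1)"
proof -
  have "continuous_on (E3 \<kappa>) vert"
    unfolding vert_def[abs_def]
    by (intro continuous_on_snd smooth_on_continuous_derivative[OF smooth_f])
  moreover have "finite (vert ` E3 \<kappa>)"
    by (rule finite_subset[of _ "{1, -1}"]) (use vert_cases in auto)
  ultimately have "vert constant_on E3 \<kappa>"
    by (intro continuous_finite_range_constant connected_E3)
  then show ?thesis using vert_cases unfolding constant_on_def by (metis (full_types))
qed

text \<open>Half the radius of the disk keeps the closed ball inside the domain. The horizontal part
  of f (r v) - f 0 is \<open>fst v\<close> times a nonvanishing function of \<open>fst v\<close>,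
  and on the fibre over 0 the height decreases with slope -1: the situation of
  \<open>sphere_degree_fibre_reversing\<close>.\<close>

lemma degree_if_reversing:
  assumes rev: "\<forall>x\<in>E3 \<kappa>. vert x = -1"
  defines "r \<equiv> 1 / (2 * cpar \<kappa>)"
  shows "sphere_degree (\<lambda>v. f (r *\<^sub>R v) - f 0) = -1"
proof -
  have cp: "cpar \<kappa> > 0" by (rule cpar_pos[OF \<kappa>])
  have r: "r > 0" using cp by (simp add: r_def)
  have in_E3: "r *\<^sub>R v \<in> E3 \<kappa>" if "cmod (fst v) \<le> 1" for v
  proof -
    have eq: "cpar \<kappa> * cmod (fst (r *\<^sub>R v)) = cmod (fst v) / 2"
      using cp by (simp add: r_def)
    have "fst (r *\<^sub>R v) \<in> H2 \<kappa>" unfolding H2_iff[OF \<kappa>] eq using that by simp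
    then show ?thesis by (cases v) (simp add: E3_def)
  qed
  have E30: "0 \<in> E3 \<kappa>" using in_E3[of 0] by simp
  have le1: "cmod (fst v) \<le> 1" if "norm v = 1" for v :: pt
    using norm_fst_le[of "fst v" "snd v"] that by simp
  have rz: "of_real r * z \<in> H2 \<kappa>" if "cmod z \<le> 1" for z
    using in_E3[of "(z, 0)"] that by (simp add: E3_def scaleR_conv_of_real)
  \<comment> \<open>The difference of the Moebius map at r * z and at 0 is z times this quotient, by
    the determinant condition.\<close>
  define k where "k z = of_real r / (denom 0 * denom (of_real r * z))" for z
  have D0: "denom 0 \<noteq> 0" using rz[of 0] by (intro denom_nonzero) simp
  \<comment> \<open>The degree lemma inspects heights only at the poles, so integrating along the
    fibre over 0 suffices.\<close>
  have fibre: "snd (f (0, t)) = snd (f (0, 0)) - t" for t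
  proof -
    have in0: "(0, t) \<in> E3 \<kappa>" for t using E30 by (simp add: E3_def zero_prod_def)
    have "((\<lambda>t. snd (f (0, t)) + t) has_vector_derivative 0) (at t)" for t
    proof -
      have "((\<lambda>t :: real. (0 :: complex, t)) has_derivative (\<lambda>h. (0, h))) (at t)"
        by (auto intro!: derivative_eq_intros)
      from diff_chain_at[OF this f_has_derivative[OF in0]]
      have d: "((\<lambda>t. f (0, t)) has_derivative (\<lambda>h. differential f (0, t) (0, h))) (at t)"
        by (simp add: o_def)
      have "differential f (0, t) (0, h) = h *\<^sub>R (- 1 *\<^sub>R xi)" for h
      proof -
        have "linear (differential f (0, t))"
          using f_has_derivative[OF in0] has_derivative_linear by blast
        from linear_scale[OF this, of h xi] show ?thesis
          using derivative_xi[OF in0] rev in0 by (simp add: xi_def)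
      qed
      then have "((\<lambda>t. snd (f (0, t))) has_vector_derivative - 1) (at t)"
        using has_derivative_snd[OF d] by (simp add: has_vector_derivative_def xi_def)
      from has_vector_derivative_add[OF this has_vector_derivative_id] show ?thesis by simp
    qed
    from has_vector_derivative_zero_imp_const[of "\<lambda>t. snd (f (0, t)) + t" t, OF this] show ?thesis
      by simp
  qed
  show ?thesis
  proof (rule sphere_degree_fibre_reversing[where k = k])
    show "continuous_on (sphere 0 1) (\<lambda>v. f (r *\<^sub>R v) - f 0)"
    proof (rule continuous_on_scaled_diff)
      show "continuous_on (E3 \<kappa>) f" by (rule smooth_on_continuous_on[OF smooth_f])
      show "cball 0 r \<subseteq> E3 \<kappa>"
      proof
        fix x :: pt assume "x \<in> cball 0 r"
        then have "norm x \<le> r" by simp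
        then have "cmod (fst x) \<le> r" using norm_fst_le[of "fst x" "snd x"] by simp
        then have "cmod (fst ((1 / r) *\<^sub>R x)) \<le> 1" using r by simp
        from in_E3[OF this] show "x \<in> E3 \<kappa>" using r by simp
      qed
    qed (use r in simp)
    show "k z \<noteq> 0" if "cmod z \<le> 1" for z
      using denom_nonzero[OF rz[OF that]] D0 r by (simp add: k_def)
    show "continuous_on (cball 0 1) k"
      unfolding k_def[abs_def] using denom_nonzero[OF rz] D0
      by (intro continuous_intros) (auto simp: denom_def intro!: continuous_intros)
    fix v :: pt assume v: "norm v = 1"
    let ?D = "denom (of_real r * fst v)"
    have D: "?D \<noteq> 0" by (rule denom_nonzero[OF rz[OF le1[OF v]]])
    have "fst (f (r *\<^sub>R v) - f 0) = (\<alpha> * (c * (of_real r * fst v)) + \<beta>) / ?D / c - \<beta> / denom 0 / c"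
      using fst_f[OF in_E3[OF le1[OF v]]] fst_f[OF E30] by (simp add: scaleR_conv_of_real)
    also have "\<dots> = ((\<alpha> * (c * (of_real r * fst v)) + \<beta>) * denom 0 - \<beta> * ?D) / (?D * denom 0) / c"
      unfolding diff_divide_distrib[symmetric] diff_frac_eq[OF D D0] ..
    also have "(\<alpha> * (c * (of_real r * fst v)) + \<beta>) * denom 0 - \<beta> * ?D =
        c * (of_real r * fst v) * (\<alpha> * cnj \<alpha> - \<beta> * cnj \<beta>)"
      by (simp add: denom_def algebra_simps)
    also have "\<dots> / (?D * denom 0) / c = fst v * k (fst v)"
      unfolding SU11_det[OF det] using c_nonzero by (simp add: k_def mult_ac)
    finally show "fst (f (r *\<^sub>R v) - f 0) = fst v * k (fst v)" .
  next
    show "snd (f (r *\<^sub>R (0, 1)) - f 0) < 0" "snd (f (r *\<^sub>R (0, -1)) - f 0) > 0"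
      using fibre[of r] fibre[of "- r"] r by (simp_all add: zero_prod_def)
  qed
qed

text \<open>An isometry of the identity component over an orientation-preserving isometry cannot reverse
  the fibres: its degree at the origin would be \<open>-1\<close>.\<close>

lemma vert_Isom0:
  assumes "f \<in> Isom0 \<kappa> \<tau>" "x \<in> E3 \<kappa>"
  shows "vert x = 1"
proof (rule ccontr)
  assume "vert x \<noteq> 1"
  then have rev: "\<forall>x\<in>E3 \<kappa>. vert x = -1" using vert_constant assms(2) by blast
  define r where "r = 1 / (2 * cpar \<kappa>)"
  have cp: "cpar \<kappa> > 0" by (rule cpar_pos[OF \<kappa>])
  have r: "r > 0" using cp by (simp add: r_def)
  have sub: "cball 0 r \<subseteq> E3 \<kappa>"
  proof
    fix x :: pt assume "x \<in> cball 0 r"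
    then have "norm x \<le> r" by simp
    then have "cmod (fst x) \<le> r" using norm_fst_le[of "fst x" "snd x"] by simp
    then have "cpar \<kappa> * cmod (fst x) \<le> cpar \<kappa> * r" using cp by simp
    also have "\<dots> < 1" using cp by (simp add: r_def)
    finally show "x \<in> E3 \<kappa>" by (cases x) (simp add: E3_def H2_iff[OF \<kappa>])
  qed
  have "sphere_degree (\<lambda>v. (\<lambda>x\<in>E3 \<kappa>. x) (r *\<^sub>R v) - (\<lambda>x\<in>E3 \<kappa>. x) 0) =
      sphere_degree (\<lambda>v. f (r *\<^sub>R v) - f 0)"
  proof (rule sphere_degree_compact_open_component[OF _ _ r sub])
    show "connected_component_of (compact_open (E3 \<kappa>) (isometries \<kappa> \<tau>)) (\<lambda>x\<in>E3 \<kappa>. x) f"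
      using assms(1) by (simp add: Isom0_def)
  qed (auto simp: isometries_def bij_betw_def intro: smooth_on_continuous_on)
  also have "\<dots> = -1" unfolding r_def by (rule degree_if_reversing[OF rev])
  also have "sphere_degree (\<lambda>v. (\<lambda>x\<in>E3 \<kappa>. x) (r *\<^sub>R v) - (\<lambda>x\<in>E3 \<kappa>. x) 0) = sphere_degree (\<lambda>v. r *\<^sub>R v)"
  proof (rule sphere_degree_cong)
    fix v :: pt assume "norm v = 1"
    then have "r *\<^sub>R v \<in> E3 \<kappa>" "0 \<in> E3 \<kappa>" using sub r by auto
    then show "(\<lambda>x\<in>E3 \<kappa>. x) (r *\<^sub>R v) - (\<lambda>x\<in>E3 \<kappa>. x) 0 = r *\<^sub>R v" by simp
  qed
  finally show False using sphere_degree_scale[OF r] by simp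
qed

text \<open>Pairing with the preserved field \<open>xi\<close> shows that the fibre coordinate is
  unchanged. Horizontally, Lam gains the factor |D|^2 and the derivative is 1 / D^2, so the frame
  coordinate turns by cnj D / D, exactly the rotation in \<open>gauss_map_SU11\<close>.\<close>

lemma E3_gauss_equivariant:
  assumes f: "f \<in> Isom0 \<kappa> \<tau>" and x: "x \<in> E3 \<kappa>"
  shows "E3_gauss \<kappa> \<tau> (f x) (differential f x Z) = psi M (E3_gauss \<kappa> \<tau> x Z)"
proof -
  let ?f' = "differential f x" and ?\<zeta> = "fst x"
  let ?D = "denom ?\<zeta>" and ?N = "\<alpha> * (c * ?\<zeta>) + \<beta>"
  have D: "?D \<noteq> 0" by (rule denom_nonzero[OF fst_E3[OF x]])
  have "?f' xi = xi" using derivative_xi[OF x] vert_Isom0[OF f x] by simp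
  then have form: "E3_form \<kappa> \<tau> (f x) (?f' Z) = E3_form \<kappa> \<tau> x Z"
    using isometry[OF x, of Z xi] by (simp add: E3_metric_xi)
  have base: "c * fst (f x) = ?N / ?D" using fst_f[OF x] c_nonzero by simp
  have lam: "complex_of_real (Lam \<kappa> (fst (f x))) = of_real (Lam \<kappa> ?\<zeta>) * (?D * cnj ?D)"
  proof -
    have L: "complex_of_real (Lam \<kappa> y) = 1 / (1 - (c * y) * cnj (c * y))" for y
      by (simp add: Lam_def c_def mult_cnj_cmod power2_eq_square norm_mult mult_ac del: complex_cnj_mult)
    have "1 - (?N / ?D) * cnj (?N / ?D) = (?D * cnj ?D - ?N * cnj ?N) / (?D * cnj ?D)"
      using D unfolding complex_cnj_divide by (simp add: diff_divide_distrib del: complex_cnj_add)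
    also have "?D * cnj ?D - ?N * cnj ?N = (\<alpha> * cnj \<alpha> - \<beta> * cnj \<beta>) * (1 - (c * ?\<zeta>) * cnj (c * ?\<zeta>))"
      by (simp add: denom_def algebra_simps)
    finally show ?thesis unfolding L base SU11_det[OF det] by simp
  qed
  have coord: "E3_coord \<kappa> (f x) (?f' Z) = E3_coord \<kappa> x Z * cnj ?D / ?D"
    unfolding E3_coord_def lam fst_derivative[OF x] using D by (simp add: power2_eq_square)
  have "cmod (c * ?\<zeta>) < 1" unfolding c_def by (rule cpar_mult_less_1[OF \<kappa> x])
  from gauss_map_SU11[OF this M det, of "E3_coord \<kappa> x Z" "E3_form \<kappa> \<tau> x Z"]
  show ?thesis
    unfolding E3_gauss_def form coord c_def[symmetric] base denom_def[symmetric] .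
qed

end

section \<open>Endpoints and frame coordinates\<close>

text \<open>At s = 0 the north form is (w + a) / (cnj a * w + 1), which is c times the endpoint in
  \<open>geodesic_endpoint_eq\<close>.\<close>

lemma E3_gauss_horizontal:
  assumes \<kappa>: "\<kappa> < 0" and xZ: "(x, Z) \<in> UE \<kappa> \<tau>" and hor: "E3_form \<kappa> \<tau> x Z = 0"
  shows "E3_gauss \<kappa> \<tau> x Z = sigma \<kappa> (geodesic_endpoint \<kappa> (hproj x) (differential hproj x Z))"
proof -
  let ?c = "complex_of_real (cpar \<kappa>)" and ?w = "E3_coord \<kappa> x Z"
  have x: "x \<in> E3 \<kappa>" and Z: "E3_metric \<kappa> \<tau> x Z Z = 1" using xZ by (auto simp: UE_def)
  have c: "?c \<noteq> 0" using cpar_pos[OF \<kappa>] by simp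
  have w: "cmod ?w = 1"
    using Z hor by (simp add: E3_metric_unit_iff power2_eq_1_iff) (use norm_ge_zero[of ?w] in linarith)
  have "(hproj has_derivative fst) (at x)"
    unfolding hproj_def[abs_def] by (rule has_derivative_fst[OF has_derivative_ident])
  then have d: "differential hproj x = fst" using frechet_derivative_at by metis
  have "geodesic_endpoint \<kappa> (fst x) (fst Z) =
      (?w + ?c * fst x) / (1 + ?c * cnj (fst x) * ?w) / ?c"
    by (rule geodesic_endpoint_eq[OF \<kappa> _ _ w]) (use x in \<open>auto simp: E3_def E3_coord_def\<close>)
  moreover have "1 + ?c * cnj (fst x) * ?w \<noteq> 0"
  proof -
    have "cmod (?c * cnj (fst x) * ?w) < 1"
      using cpar_mult_less_1[OF \<kappa> x] w by (simp add: norm_mult)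
    then show ?thesis by (metis add_eq_0_iff norm_minus_cancel norm_one order_less_irrefl)
  qed
  ultimately show ?thesis
    using c by (simp add: E3_gauss_def gauss_map_def hor sigma_def d hproj_def north_num_def north_den_def
        sphere_frac_def add.commute)
qed

lemma E3_frame_coords:
  assumes "Lam \<kappa> (fst x) \<noteq> 0" "Z = Z1 *\<^sub>R V1 \<kappa> \<tau> x + Z2 *\<^sub>R V2 \<kappa> \<tau> x + Z3 *\<^sub>R xi"
  shows "E3_coord \<kappa> x Z = Complex Z1 Z2" "E3_form \<kappa> \<tau> x Z = Z3"
proof -
  have "Z = E3_lift \<kappa> \<tau> x (Complex Z1 Z2) Z3"
    unfolding assms(2) E3_lift_def V1_def V2_def xi_def
    by (simp add: prod_eq_iff complex_eq_iff algebra_simps)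
  then show "E3_coord \<kappa> x Z = Complex Z1 Z2" "E3_form \<kappa> \<tau> x Z = Z3"
    by (simp_all add: E3_lift_coords[OF assms(1)])
qed

text \<open>The map of the theorem is restricted to the unit tangent bundle and agrees with
  \<open>E3_gauss\<close> only on unit vectors.\<close>

lemma conformal_diffeo_to_sphere_cong:
  assumes "\<And>Z. g Z Z = 1 \<Longrightarrow> f Z = f' Z" "conformal_diffeo_to_sphere g f"
  shows "conformal_diffeo_to_sphere g f'"
proof -
  let ?M = "{Z. g Z Z = 1}"
  have "bij_betw f ?M UNIV = bij_betw f' ?M UNIV"
    by (rule bij_betw_cong) (use assms(1) in simp)
  moreover have "local_expr ?M f Z U F = local_expr ?M f' Z U F" for Z U F
    using assms(1) by (auto simp: local_expr_def)
  moreover have "inv_into ?M f = inv_into ?M f'"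
    unfolding inv_into_def using assms(1) by (intro ext arg_cong[where f = Eps]) auto
  ultimately show ?thesis
    using assms(2) by (simp add: conformal_diffeo_to_sphere_def)
qed

theorem theorem3p1:
  fixes \<kappa> \<tau> c :: real
  assumes "\<kappa> < 0" and "c = sqrt (- \<kappa>) / 2"
  shows "\<exists>P. P \<in> UE \<kappa> \<tau> \<rightarrow>\<^sub>E (UNIV :: riemann_sphere set) \<and>
      equivariant \<kappa> \<tau> P \<and> respects_hemispheres \<kappa> \<tau> P \<and>
      endpoint_on_horizontal \<kappa> \<tau> P \<and> fibrewise_conformal \<kappa> \<tau> P \<and>
      (\<forall>Q. Q \<in> UE \<kappa> \<tau> \<rightarrow>\<^sub>E (UNIV :: riemann_sphere set) \<and>
         equivariant \<kappa> \<tau> Q \<and> respects_hemispheres \<kappa> \<tau> Q \<and>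
         endpoint_on_horizontal \<kappa> \<tau> Q \<and> fibrewise_conformal \<kappa> \<tau> Q \<longrightarrow> Q = P) \<and>
      real_analytic_to_sphere (UE \<kappa> \<tau>) P \<and>
      (\<forall>x1 x2 x3 Z1 Z2 Z3 :: real.
         let \<zeta> = Complex x1 x2; x = (\<zeta>, x3);
             Z = Z1 *\<^sub>R V1 \<kappa> \<tau> x + Z2 *\<^sub>R V2 \<kappa> \<tau> x + Z3 *\<^sub>R xi;
             w = Complex Z1 Z2
         in (x, Z) \<in> UE \<kappa> \<tau> \<longrightarrow>
           (Z3 \<noteq> -1 \<longrightarrow> P (x, Z) = sphere_frac
              (w + of_real c * \<zeta> * (1 + of_real Z3)) (of_real c * cnj \<zeta> * w + 1 + of_real Z3)) \<and>
           \<comment> \<open>for \<open>Z = - xi\<close> the quotient reads \<open>0 / 0\<close> and stands for its continuous extension\<close>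
           (Z3 = -1 \<longrightarrow> P (x, Z) = sphere_frac 1 (of_real c * cnj \<zeta>)))"
proof -
  note \<kappa> = assms(1)
  have c: "cpar \<kappa> = c" by (simp add: cpar_def assms(2))
  \<comment> \<open>The restriction makes \<open>P\<close> extensional, so uniqueness can be
    equality of functions.\<close>
  define P where "P = (\<lambda>(x, Z)\<in>UE \<kappa> \<tau>. E3_gauss \<kappa> \<tau> x Z)"
  have P: "P (x, Z) = E3_gauss \<kappa> \<tau> x Z" if "(x, Z) \<in> UE \<kappa> \<tau>" for x Z
    using that by (simp add: P_def)
  have UE: "(x, Z) \<in> UE \<kappa> \<tau> \<longleftrightarrow> x \<in> E3 \<kappa> \<and> E3_metric \<kappa> \<tau> x Z Z = 1" for x Z
    by (simp add: UE_def)
  have ext: "P \<in> UE \<kappa> \<tau> \<rightarrow>\<^sub>E UNIV" by (simp add: P_def)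
  have equiv: "equivariant \<kappa> \<tau> P"
    unfolding equivariant_def
  proof (intro ballI impI, clarify)
    fix f M x Z
    assume f: "f \<in> Isom0 \<kappa> \<tau>" and M: "M \<in> SU11" and hor: "is_horizontal_part \<kappa> f (phi \<kappa> M)"
      and xZ: "(x, Z) \<in> UE \<kappa> \<tau>"
    obtain \<alpha> \<beta> where \<alpha>\<beta>: "M$1$1 = \<alpha>" "M$1$2 = \<beta>" "M$2$1 = cnj \<beta>" "M$2$2 = cnj \<alpha>"
      "(cmod \<alpha>)\<^sup>2 - (cmod \<beta>)\<^sup>2 = 1" using M unfolding SU11_def by blast
    \<comment> \<open>Every generator of the compact-open topology consists of isometries, so the
      topological space contains nothing else.\<close>
    have iso: "f \<in> isometries \<kappa> \<tau>"
    proof -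
      obtain T where T: "connectedin (compact_open (E3 \<kappa>) (isometries \<kappa> \<tau>)) T" "f \<in> T"
        using f unfolding Isom0_def connected_component_of_def by blast
      from connectedin_subset_topspace[OF T(1)] T(2) show ?thesis
        unfolding compact_open_def by auto
    qed
    interpret horizontal_isometry \<kappa> \<tau> f M \<alpha> \<beta>
      by unfold_locales (fact \<kappa> iso \<alpha>\<beta> hor)+
    have "(f x, differential f x Z) \<in> UE \<kappa> \<tau>"
      using xZ f_in_E3 isometry by (simp add: UE)
    then show "P (f x, differential f x Z) = psi M (P (x, Z))"
      using xZ E3_gauss_equivariant[OF f] by (simp add: P UE)
  qed
  have hemi: "respects_hemispheres \<kappa> \<tau> P"
    unfolding respects_hemispheres_def
  proof clarify
    fix x Z assume xZ: "(x, Z) \<in> UE \<kappa> \<tau>"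
    have a: "cmod (of_real (cpar \<kappa>) * fst x) < 1" using xZ by (intro cpar_mult_less_1[OF \<kappa>]) (simp add: UE)
    have on: "(cmod (E3_coord \<kappa> x Z))\<^sup>2 + (E3_form \<kappa> \<tau> x Z)\<^sup>2 = 1"
      using xZ by (simp add: UE E3_metric_unit_iff)
    show "(P (x, Z) \<in> equator \<longleftrightarrow> horizontal \<kappa> \<tau> x Z) \<and> (P (x, Z) \<in> north \<longleftrightarrow> upwards \<kappa> \<tau> x Z) \<and>
        (P (x, Z) \<in> south \<longleftrightarrow> downwards \<kappa> \<tau> x Z)"
      unfolding P[OF xZ] E3_gauss_def horizontal_def upwards_def downwards_def E3_metric_xi
      using gauss_map_hemispheres[OF a on] by simp
  qed
  have endp: "endpoint_on_horizontal \<kappa> \<tau> P"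
    unfolding endpoint_on_horizontal_def horizontal_def E3_metric_xi
    using E3_gauss_horizontal[OF \<kappa>] P by auto
  have conf: "fibrewise_conformal \<kappa> \<tau> P"
    unfolding fibrewise_conformal_def
  proof
    fix x assume x: "x \<in> E3 \<kappa>"
    show "conformal_diffeo_to_sphere (E3_metric \<kappa> \<tau> x) (\<lambda>Z. P (x, Z))"
      by (rule conformal_diffeo_to_sphere_cong[OF _ E3_gauss_conformal_diffeo[OF \<kappa> x]])
        (simp add: P UE x)
  qed
  have uniq: "Q = P" if Q: "Q \<in> UE \<kappa> \<tau> \<rightarrow>\<^sub>E UNIV" "respects_hemispheres \<kappa> \<tau> Q"
    "endpoint_on_horizontal \<kappa> \<tau> Q" "fibrewise_conformal \<kappa> \<tau> Q" for Q
  proof (rule PiE_ext[OF Q(1) ext], clarify)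
    fix x Z assume xZ: "(x, Z) \<in> UE \<kappa> \<tau>"
    then have x: "x \<in> E3 \<kappa>" by (simp add: UE)
    have U: "(x, Z) \<in> UE \<kappa> \<tau>" if "E3_metric \<kappa> \<tau> x Z Z = 1" for Z using that x by (simp add: UE)
    have hP: "P (x, Z) \<in> equator \<longleftrightarrow> horizontal \<kappa> \<tau> x Z" "P (x, Z) \<in> north \<longleftrightarrow> upwards \<kappa> \<tau> x Z"
      "P (x, Z) \<in> south \<longleftrightarrow> downwards \<kappa> \<tau> x Z" if "E3_metric \<kappa> \<tau> x Z Z = 1" for Z
      using hemi U[OF that] unfolding respects_hemispheres_def by auto
    have hQ: "Q (x, Z) \<in> north \<longleftrightarrow> upwards \<kappa> \<tau> x Z"
      "Q (x, Z) \<in> south \<longleftrightarrow> downwards \<kappa> \<tau> x Z" if "E3_metric \<kappa> \<tau> x Z Z = 1" for Z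
      using Q(2) U[OF that] unfolding respects_hemispheres_def by auto
    \<comment> \<open>On the equator \<open>Z\<close> is horizontal, and there both maps are given
      by the same geodesic endpoint.\<close>
    have QP: "Q (x, Z) = P (x, Z)" if "E3_metric \<kappa> \<tau> x Z Z = 1" "P (x, Z) \<in> equator" for Z
    proof -
      have h: "horizontal \<kappa> \<tau> x Z" using hP(1)[OF that(1)] that(2) by simp
      have *: "R (x, Z) = sigma \<kappa> (geodesic_endpoint \<kappa> (hproj x) (differential hproj x Z))"
        if "endpoint_on_horizontal \<kappa> \<tau> R" for R
        using that U[OF \<open>E3_metric \<kappa> \<tau> x Z Z = 1\<close>] h unfolding endpoint_on_horizontal_def by auto
      show ?thesis unfolding *[OF endp] *[OF Q(3)] ..
    qed
    show "Q (x, Z) = P (x, Z)"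
    proof (rule conformal_diffeo_to_sphere_unique[of "E3_metric \<kappa> \<tau> x" "\<lambda>Z. P (x, Z)" "\<lambda>Z. Q (x, Z)"])
      show "conformal_diffeo_to_sphere (E3_metric \<kappa> \<tau> x) (\<lambda>Z. P (x, Z))"
        "conformal_diffeo_to_sphere (E3_metric \<kappa> \<tau> x) (\<lambda>Z. Q (x, Z))"
        using conf Q(4) x unfolding fibrewise_conformal_def by auto
    qed (use bounded_bilinear_E3_metric E3_metric_sym QP hP hQ xZ in \<open>auto simp: UE\<close>)
  qed
  have analytic: "real_analytic_to_sphere (UE \<kappa> \<tau>) P"
    by (rule E3_gauss_real_analytic[OF \<kappa> P])
  have formula: "(Z3 \<noteq> -1 \<longrightarrow> P (x, Z) = sphere_frac
            (Complex Z1 Z2 + of_real c * fst x * (1 + of_real Z3))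
            (of_real c * cnj (fst x) * Complex Z1 Z2 + 1 + of_real Z3)) \<and>
         (Z3 = -1 \<longrightarrow> P (x, Z) = sphere_frac 1 (of_real c * cnj (fst x)))"
    if xZ: "(x, Z) \<in> UE \<kappa> \<tau>" and Z: "Z = Z1 *\<^sub>R V1 \<kappa> \<tau> x + Z2 *\<^sub>R V2 \<kappa> \<tau> x + Z3 *\<^sub>R xi" for x Z Z1 Z2 Z3
  proof -
    have "x \<in> E3 \<kappa>" using xZ by (simp add: UE)
    note coords = E3_frame_coords[OF E3_Lam_nonzero[OF \<kappa> this] Z]
    show ?thesis
      unfolding P[OF xZ] E3_gauss_def coords c
      by (simp add: gauss_map_def north_num_def north_den_def add.assoc)
  qed
  show ?thesis
  proof (intro exI[of _ P] conjI allI impI ext equiv hemi endp conf analytic, goal_cases)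
    case (1 Q)
    then show ?case by (intro uniq) blast+
  next
    case (2 x1 x2 x3 Z1 Z2 Z3)
    show ?case
      unfolding Let_def using formula[OF _ refl, of "(Complex x1 x2, x3)" Z1 Z2 Z3]
      unfolding fst_conv by blast
  qed
qed

end
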